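(* Let $n\ge 1$. The map $\psi$ is a bijection from $T_n^B$ to $NC_n^B$.
   Context: Consider a convex, centrally symmetric $(2n+2)$-gon with vertices labelled clockwise $1,2,\dots,n+1,\bar 1,\bar 2,\dots,\overline{n+1}$, so that the half-turn exchanges $i$ and $\bar i$. A triangulation is a division of the polygon into triangles by chords (segments joining two non-adjacent vertices) which do not cross in the interior. $T_n^B$ is the set of triangulations fixed under the half-turn. In a triangulation, each chord $C$ is a diagonal of a unique quadrilateral $Q(C)$, the union of the two triangles having $C$ as a side. A chord is pure if it joins two barred or two unbarred vertices; otherwise it is mixed. A pure chord $C$ is red if $Q(C)$ contains another vertex of the same type (barred/unbarred) as the endpoints of $C$ whose label is higher than those of both endpoints of $C$, and green otherwise. A mixed chord $C$ is red if $Q(C)$ contains an unbarred vertex whose label is higher than that of the unbarred endpoint of $C$, or a barred vertex whose label is higher than that of the barred endpoint of $C$; otherwise it is green. $NC_n^B$, the noncrossing partitions of type $B_n$, is the set of partitions of $\{1,\dots,n,\bar 1,\dots,\bar n\}$ which are fixed under interchanging $i\leftrightarrow\bar i$ for all $i$ and such that, if $2n$ points on a circle are labelled in cyclic order $1,\dots,n,\bar 1,\dots,\bar n$, the convex hulls of the blocks are pairwise disjoint. The map $\psi:T_n^B\to NC_n^B$: given a triangulation, erase all green chords and all exterior edges. Move both endpoints of each mixed red chord slightly counterclockwise (so a mixed red chord $a\bar b$ comes to separate $\{a,\dots,n+1,\bar 1,\dots,\overline{b-1}\}$ from $\{\bar b,\dots,\overline{n+1},1,\dots,a-1\}$). Move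 the endpoints of each pure red chord slightly together, so that both its original endpoints lie on the side of the chord which includes the larger part of the polygon (so a pure red chord joining $a<b$, both unbarred, comes to separate $\{a+1,\dots,b-1\}$ from all other vertices, and likewise for barred vertices). Erase the vertices $n+1$ and $\overline{n+1}$. The remaining vertices are partitioned by the moved red chords (two vertices are in the same block iff no moved red chord separates them); this partition is the value of $\psi$. *)

theory Defs
  imports "HOL-Analysis.Analysis" "HOL-Library.Disjoint_Sets"
begin

datatype vertex = Unbarred (label: nat) | Barred (label: nat)

primrec bar :: "vertex \<Rightarrow> vertex" where
  "bar (Unbarred i) = Barred i"
| "bar (Barred i) = Unbarred i"

text \<open>The labels \<open>1, \<dots>, m\<close> with and without bar, in the cyclic order
  \<open>1, \<dots>, m, bar 1, \<dots>, bar m\<close>. Below, \<open>m = n + 1\<close> for the polygon and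
  \<open>m = n\<close> for the noncrossing partitions.\<close>

definition verts :: "nat \<Rightarrow> vertex set" where
  "verts m = Unbarred ` {1..m} \<union> Barred ` {1..m}"

primrec pos :: "nat \<Rightarrow> vertex \<Rightarrow> nat" where
  "pos m (Unbarred i) = i"
| "pos m (Barred i) = m + i"

primrec next_vertex :: "nat \<Rightarrow> vertex \<Rightarrow> vertex" where
  "next_vertex m (Unbarred i) = (if i = m then Barred 1 else Unbarred (Suc i))"
| "next_vertex m (Barred i) = (if i = m then Unbarred 1 else Barred (Suc i))"


text \<open>\<open>P\<close> places the vertices in the plane. The first condition says that they are
  in strictly convex position and listed clockwise: \<open>Im (cnj z * w)\<close> is the determinant of
  \<open>(z, w)\<close>, which is negative iff \<open>w\<close> points to the right of \<open>z\<close>.\<close>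

definition convex_cs_polygon :: "nat \<Rightarrow> (vertex \<Rightarrow> complex) \<Rightarrow> bool" where
  "convex_cs_polygon n P \<longleftrightarrow>
     (\<forall>u\<in>verts (n + 1). \<forall>v\<in>verts (n + 1). \<forall>w\<in>verts (n + 1).
        pos (n + 1) u < pos (n + 1) v \<longrightarrow> pos (n + 1) v < pos (n + 1) w \<longrightarrow>
        Im (cnj (P v - P u) * (P w - P u)) < 0) \<and>
     (\<exists>c. \<forall>v\<in>verts (n + 1). P (bar v) = 2 * c - P v)"

text \<open>Edges and chords are represented by the set of their two endpoints, triangles by the
  set of their three corners.\<close>

definition edges :: "nat \<Rightarrow> vertex set set" where
  "edges n = {{v, next_vertex (n + 1) v} |v. v \<in> verts (n + 1)}"

definition chords :: "nat \<Rightarrow> vertex set set" where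
  "chords n = {C. C \<subseteq> verts (n + 1) \<and> card C = 2} - edges n"

definition triangles :: "nat \<Rightarrow> vertex set set \<Rightarrow> vertex set set" where
  "triangles n T = {t. t \<subseteq> verts (n + 1) \<and> card t = 3 \<and>
     (\<forall>u\<in>t. \<forall>v\<in>t. u \<noteq> v \<longrightarrow> {u, v} \<in> edges n \<union> T)}"

text \<open>Since all vertices are in convex position and the chords in \<open>T\<close> do not cross, distinct
  members of \<open>triangles n T\<close> have disjoint interiors, and no chord meets the interior of any of
  them. So the polygon is divided into triangles iff they cover it.\<close>

definition triangulation :: "nat \<Rightarrow> (vertex \<Rightarrow> complex) \<Rightarrow> vertex set set \<Rightarrow> bool" where
  "triangulation n P T \<longleftrightarrow>
     T \<subseteq> chords n \<and>
     (\<forall>C\<in>T. \<forall>D\<in>T. C \<noteq> D \<longrightarrow>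
        convex hull (P ` C) \<inter> convex hull (P ` D) \<inter>
          interior (convex hull (P ` verts (n + 1))) = {}) \<and>
     convex hull (P ` verts (n + 1)) = (\<Union>t\<in>triangles n T. convex hull (P ` t))"

definition triangulations_B :: "nat \<Rightarrow> (vertex \<Rightarrow> complex) \<Rightarrow> vertex set set set" where
  "triangulations_B n P = {T. triangulation n P T \<and> (\<lambda>C. bar ` C) ` T = T}"


definition same_type :: "vertex \<Rightarrow> vertex \<Rightarrow> bool" where
  "same_type u v \<longleftrightarrow> is_Unbarred u = is_Unbarred v"

definition pure :: "vertex set \<Rightarrow> bool" where
  "pure C \<longleftrightarrow> (\<forall>u\<in>C. \<forall>v\<in>C. same_type u v)"

text \<open>\<open>Q(C)\<close>, given by its corners.\<close>

definition quad :: "nat \<Rightarrow> vertex set set \<Rightarrow> vertex set \<Rightarrow> vertex set" where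
  "quad n T C = \<Union>{t \<in> triangles n T. C \<subseteq> t}"

definition red :: "nat \<Rightarrow> vertex set set \<Rightarrow> vertex set \<Rightarrow> bool" where
  "red n T C \<longleftrightarrow>
     (if pure C then \<exists>v\<in>quad n T C. \<forall>u\<in>C. same_type u v \<and> label u < label v
      else \<exists>v\<in>quad n T C. \<exists>u\<in>C. same_type u v \<and> label u < label v)"

text \<open>Shifting the endpoints \<open>a\<close> and \<open>bar b\<close> of a mixed chord counterclockwise puts both of
  them after the respective new endpoint, so one side is \<open>a, \<dots>, n + 1, bar 1, \<dots>, bar (b - 1)\<close>.
  Shifting the endpoints of a pure chord \<open>a < b\<close> together cuts off just the labels strictly
  between \<open>a\<close> and \<open>b\<close>.\<close>

definition mixed_side :: "nat \<Rightarrow> nat \<Rightarrow> nat \<Rightarrow> vertex set" where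
  "mixed_side n a b = Unbarred ` {a..n + 1} \<union> Barred ` {1..<b}"

definition separates :: "nat \<Rightarrow> vertex set \<Rightarrow> vertex \<Rightarrow> vertex \<Rightarrow> bool" where
  "separates n C x y \<longleftrightarrow>
     (\<exists>a b. C = {Unbarred a, Barred b} \<and>
        (x \<in> mixed_side n a b) \<noteq> (y \<in> mixed_side n a b)) \<or>
     (\<exists>a b. a < b \<and> C = {Unbarred a, Unbarred b} \<and>
        (x \<in> Unbarred ` {a<..<b}) \<noteq> (y \<in> Unbarred ` {a<..<b})) \<or>
     (\<exists>a b. a < b \<and> C = {Barred a, Barred b} \<and>
        (x \<in> Barred ` {a<..<b}) \<noteq> (y \<in> Barred ` {a<..<b}))"

definition psi :: "nat \<Rightarrow> vertex set set \<Rightarrow> vertex set set" where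
  "psi n T = verts n //
     {(x, y). x \<in> verts n \<and> y \<in> verts n \<and> \<not> (\<exists>C\<in>T. red n T C \<and> separates n C x y)}"


text \<open>The \<open>2n\<close> labels, in clockwise order on the unit circle.\<close>

definition circle_point :: "nat \<Rightarrow> vertex \<Rightarrow> complex" where
  "circle_point n v = cis (- (2 * pi * real (pos n v) / real (2 * n)))"

definition NC_B :: "nat \<Rightarrow> vertex set set set" where
  "NC_B n = {\<pi>. partition_on (verts n) \<pi> \<and> (\<lambda>B. bar ` B) ` \<pi> = \<pi> \<and>
     (\<forall>B\<in>\<pi>. \<forall>B'\<in>\<pi>. B \<noteq> B' \<longrightarrow>
        convex hull (circle_point n ` B) \<inter> convex hull (circle_point n ` B') = {})}"

end

theory Submission
  imports Defs
begin

text \<open>Put \<open>m = n + 1\<close>. Everything is symmetric under the half-turn, so half of the data suffices on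
  either side.

  A symmetric triangulation is recorded by two relations on \<open>{1..m}\<close>: \<open>U i j\<close>, for \<open>i < j\<close>, says that the
  unbarred vertices \<open>i\<close> and \<open>j\<close> are joined by an edge or a chord, and \<open>X a b\<close> that \<open>a\<close> is joined to
  \<open>bar b\<close>. A symmetric partition is recorded by two relations on \<open>{1..n}\<close>: \<open>E i j\<close> says that \<open>i\<close> and \<open>j\<close>
  lie in one block, and \<open>F i j\<close> that \<open>i\<close> and \<open>bar j\<close> do.

  Chords that do not cross make \<open>X\<close> a staircase in the \<open>(a, b)\<close>-plane: starting at the edge \<open>(1, m)\<close>, each
  mixed chord is followed by one in which \<open>a\<close> is larger or \<open>b\<close> is smaller, until the edge \<open>(m, 1)\<close> is
  reached. A mixed chord is green iff \<open>a\<close> has just increased and \<open>b\<close> is about to decrease, that is, iff it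
  is an outer corner of the staircase. Let \<open>r i\<close> be the largest \<open>j\<close> with \<open>U i j\<close>. The partition
  \<open>\<psi> T\<close> is given by

    \<open>E i j\<close> iff \<open>r i = r j\<close>, and \<open>F i j\<close> iff \<open>(r i, r j)\<close> is an outer corner

  (lemmas \<open>E_iff\<close> and \<open>F_iff\<close> in \<open>half_triangulation\<close>); this makes the noncrossing conditions easy to check.

  In the other direction \<open>r i\<close> is one more than the largest unbarred element of the block of \<open>i\<close>. The
  outer corners are therefore known, and between two of them the staircase first descends (\<open>b\<close>
  decreases) and then moves to the right (\<open>a\<close> increases). This gives explicit conditions \<open>chordU\<close> and
  \<open>chordX\<close> on \<open>E\<close> and \<open>F\<close>. They are satisfied by all chords of a triangulation with partition \<open>(E, F)\<close> (\<open>U_imp_chordU\<close>, \<open>X_imp_chordX\<close>), and no two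
  chords satisfying them cross. As a triangulation is a maximal set of noncrossing chords, it consists of
  exactly the chords that satisfy the conditions, so \<open>\<psi>\<close> is injective. For an arbitrary
  noncrossing partition the chords that satisfy the conditions split into triangles (\<open>chordU_inner\<close>,
  \<open>chordX_inner\<close>), hence are a triangulation \<open>T\<close>; and \<open>(E, F)\<close> can be recovered from them
  (\<open>half_noncrossing_eqI\<close>). The partition \<open>\<psi> T\<close> has the same chords, so it is the given one and
  \<open>\<psi>\<close> is surjective.

  Geometry enters through points in convex position only: distinct chords meet inside the polygon iff their
  endpoints alternate, each chord of a triangulation has a triangle on either side, conversely the triangles
  found by descending from a polygon edge cover the polygon, and the hulls of two disjoint vertex sets meet
  iff the sets cross.\<close>

section \<open>Orientation and points in convex position\<close>

text \<open>Twice the signed area of the triangle \<open>a\<close>, \<open>b\<close>, \<open>x\<close>; it is negative for a clockwise triangle. As a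
  function of \<open>x\<close> it is affine and cuts the plane along the line through \<open>a\<close> and \<open>b\<close>.\<close>

definition orient :: "complex \<Rightarrow> complex \<Rightarrow> complex \<Rightarrow> real" where
  "orient a b x = Im (cnj (b - a) * (x - a))"

lemma orient_inner: "orient a b x = (\<i> * (b - a)) \<bullet> x - (\<i> * (b - a)) \<bullet> a"
  unfolding orient_def inner_complex_def by (simp add: algebra_simps)

lemma orient_rotate: "orient b c a = orient a b c"
  unfolding orient_def by (simp add: algebra_simps)

lemma orient_swap: "orient b a c = - orient a b c"
  unfolding orient_def by (simp add: algebra_simps)

lemma orient_swap': "orient a c b = - orient a b c"
  unfolding orient_def by (simp add: algebra_simps)

lemma orient_self [simp]: "orient a b a = 0" "orient a b b = 0"
  unfolding orient_def by (simp_all add: algebra_simps)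

lemma orient_affine: "orient a b ((1 - t) *\<^sub>R x + t *\<^sub>R y) = (1 - t) * orient a b x + t * orient a b y"
  unfolding orient_def by (simp add: algebra_simps)

lemma orient_nonneg_hull:
  assumes "\<And>s. s \<in> S \<Longrightarrow> 0 \<le> orient a b s" "x \<in> convex hull S"
  shows "0 \<le> orient a b x"
proof -
  let ?c = "\<i> * (b - a)"
  have "S \<subseteq> {x. ?c \<bullet> x \<ge> ?c \<bullet> a}" using assms(1) unfolding orient_inner by fastforce
  then have "convex hull S \<subseteq> {x. ?c \<bullet> x \<ge> ?c \<bullet> a}" by (rule hull_minimal) (rule convex_halfspace_ge)
  then show ?thesis using assms(2) unfolding orient_inner by auto
qed

lemma orient_nonpos_hull:
  assumes "\<And>s. s \<in> S \<Longrightarrow> orient a b s \<le> 0" "x \<in> convex hull S"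
  shows "orient a b x \<le> 0"
  using orient_nonneg_hull[of S b a x] assms unfolding orient_swap[of b a] by simp

lemma orient_pos_hull:
  assumes "\<And>s. s \<in> S \<Longrightarrow> 0 < orient a b s" "x \<in> convex hull S"
  shows "0 < orient a b x"
proof -
  let ?c = "\<i> * (b - a)"
  have "S \<subseteq> {x. ?c \<bullet> x > ?c \<bullet> a}" using assms(1) unfolding orient_inner by fastforce
  then have "convex hull S \<subseteq> {x. ?c \<bullet> x > ?c \<bullet> a}" by (rule hull_minimal) (rule convex_halfspace_gt)
  then show ?thesis using assms(2) unfolding orient_inner by auto
qed

text \<open>A supporting line cuts a face out of the hull, and a face is spanned by the vertices it contains.\<close>

lemma hull_on_supporting_line:
  assumes "finite S" "\<And>s. s \<in> S \<Longrightarrow> 0 \<le> orient a b s" "x \<in> convex hull S" "orient a b x = 0"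
  shows "x \<in> convex hull {s \<in> S. orient a b s = 0}"
proof -
  let ?c = "\<i> * (b - a)"
  let ?L = "{x. ?c \<bullet> x = ?c \<bullet> a}"
  have "convex hull S \<inter> ?L face_of convex hull S"
  proof (rule face_of_Int_supporting_hyperplane_ge)
    fix y assume "y \<in> convex hull S"
    then show "?c \<bullet> y \<ge> ?c \<bullet> a" using orient_nonneg_hull[of S a b y] assms(2) unfolding orient_inner by auto
  qed simp
  then obtain S' where S': "S' \<subseteq> S" "convex hull S \<inter> ?L = convex hull S'"
    using face_of_convex_hull_subset[of S] assms(1) finite_imp_compact by metis
  have "S' \<subseteq> ?L" using hull_subset[of S' convex] S'(2) by auto
  then have "S' \<subseteq> {s \<in> S. orient a b s = 0}" using S'(1) unfolding orient_inner by auto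
  then have "convex hull S' \<subseteq> convex hull {s \<in> S. orient a b s = 0}" by (rule hull_mono)
  moreover have "x \<in> convex hull S'" using assms(3,4) S'(2) unfolding orient_inner by auto
  ultimately show ?thesis by blast
qed

lemma interior_not_on_supporting_line:
  assumes "a \<noteq> b" "\<And>s. s \<in> S \<Longrightarrow> orient a b s \<le> 0" "x \<in> interior (convex hull S)"
  shows "orient a b x < 0"
proof -
  let ?c = "\<i> * (b - a)"
  have "S \<subseteq> {x. ?c \<bullet> x \<le> ?c \<bullet> a}" using assms(2) unfolding orient_inner by fastforce
  then have "convex hull S \<subseteq> {x. ?c \<bullet> x \<le> ?c \<bullet> a}" by (rule hull_minimal) (rule convex_halfspace_le)
  then have "interior (convex hull S) \<subseteq> interior {x. ?c \<bullet> x \<le> ?c \<bullet> a}" by (rule interior_mono)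
  then have "interior (convex hull S) \<subseteq> {x. ?c \<bullet> x < ?c \<bullet> a}"
    using interior_halfspace_le[of ?c "?c \<bullet> a"] assms(1) by simp
  then show ?thesis using assms(3) unfolding orient_inner by auto
qed

lemma on_line: assumes "a \<noteq> b" "orient a b x = 0" obtains t where "x = (1 - t) *\<^sub>R a + t *\<^sub>R b"
proof
  let ?t = "Re ((x - a) / (b - a))"
  have n: "b - a \<noteq> 0" using assms by simp
  have "Im ((x - a) / (b - a)) = 0"
    using assms(2) unfolding orient_def Im_divide by (simp add: algebra_simps)
  then have "(x - a) / (b - a) = of_real ?t" by (simp add: complex_eq_iff)
  then have "x - a = ?t * (b - a)" using n by (simp add: field_simps)
  then show "x = (1 - ?t) *\<^sub>R a + ?t *\<^sub>R b" by (simp add: scaleR_conv_of_real algebra_simps)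
qed

lemma orthogonal_orient: assumes "c \<noteq> 0" "c \<bullet> (b - a) = 0" "c \<bullet> (x - a) = 0" shows "orient a b x = 0"
proof -
  define z w where "z = b - a" and "w = x - a"
  have 1: "Re c * Re z + Im c * Im z = 0" "Re c * Re w + Im c * Im w = 0"
    using assms unfolding inner_complex_def z_def w_def by auto
  have "Re c * (Re z * Im w - Im z * Re w) = 0" "Im c * (Re z * Im w - Im z * Re w) = 0"
    using 1 by algebra+
  moreover have "Re c \<noteq> 0 \<or> Im c \<noteq> 0" using assms(1) complex_eq_iff by auto
  ultimately have "Re z * Im w - Im z * Re w = 0" by auto
  then show ?thesis unfolding orient_def z_def[symmetric] w_def[symmetric] by simp
qed

locale clockwise_points =
  fixes N :: nat and p :: "nat \<Rightarrow> complex"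
  assumes turn: "1 \<le> i \<Longrightarrow> i < j \<Longrightarrow> j < k \<Longrightarrow> k \<le> N \<Longrightarrow> orient (p i) (p j) (p k) < 0"
    and inj: "inj_on p {1..N}"
begin

abbreviation conv :: "nat set \<Rightarrow> complex set" where
  "conv A \<equiv> convex hull (p ` A)"


lemma p_neq: "i \<in> {1..N} \<Longrightarrow> j \<in> {1..N} \<Longrightarrow> i \<noteq> j \<Longrightarrow> p i \<noteq> p j"
  using inj unfolding inj_on_def by blast

lemma turn_inside: "1 \<le> i \<Longrightarrow> i < k \<Longrightarrow> k < j \<Longrightarrow> j \<le> N \<Longrightarrow> 0 < orient (p i) (p j) (p k)"
  using turn[of i k j] orient_swap'[of "p i" "p j" "p k"] by simp

lemma turn_outside: "1 \<le> i \<Longrightarrow> i < j \<Longrightarrow> j \<le> N \<Longrightarrow> 1 \<le> k \<Longrightarrow> k \<le> N \<Longrightarrow> k < i \<or> j < k \<Longrightarrow>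
    orient (p i) (p j) (p k) < 0"
  using turn[of i j k] turn[of k i j] orient_rotate[of "p i" "p j" "p k"] by auto

lemma inside_nonneg: "1 \<le> i \<Longrightarrow> j \<le> N \<Longrightarrow> k \<in> {i..j} \<Longrightarrow> 0 \<le> orient (p i) (p j) (p k)"
  using turn_inside[of i k j] by (cases "k = i"; cases "k = j") auto

lemma outside_nonpos: "1 \<le> i \<Longrightarrow> i < j \<Longrightarrow> j \<le> N \<Longrightarrow> k \<in> {1..N} \<Longrightarrow> k \<le> i \<or> j \<le> k \<Longrightarrow>
    orient (p i) (p j) (p k) \<le> 0"
  using turn_outside[of i j k] by (cases "k = i"; cases "k = j") auto

lemma edge_nonpos:
  assumes "1 \<le> i" "Suc i \<le> N" "k \<in> {1..N}" shows "orient (p i) (p (Suc i)) (p k) \<le> 0"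
  using assms by (intro outside_nonpos) auto

lemma inside_outside_disjoint:
  assumes "1 \<le> i" "i < j" "j \<le> N" "A \<subseteq> {1..N} - {i<..<j}" "B \<subseteq> {i<..<j}"
  shows "conv A \<inter> conv B = {}"
proof -
  have "orient (p i) (p j) (p k) \<le> 0" if "k \<in> A" for k
  proof (rule outside_nonpos)
    show "k \<in> {1..N}" "k \<le> i \<or> j \<le> k" using that assms(4) by fastforce+
  qed (use assms in simp_all)
  then have "orient (p i) (p j) x \<le> 0" if "x \<in> conv A" for x
    by (intro orient_nonpos_hull[OF _ that]) blast
  moreover have "0 < orient (p i) (p j) (p k)" if "k \<in> B" for k
    by (rule turn_inside) (use that assms in auto)
  then have "0 < orient (p i) (p j) x" if "x \<in> conv B" for x
    by (intro orient_pos_hull[OF _ that]) blast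
  ultimately show ?thesis by fastforce
qed

lemma inside_outside_disjoint':
  assumes "1 \<le> i" "i < j" "j \<le> N" "A \<subseteq> {i..j}" "B \<subseteq> {1..N} - {i..j}"
  shows "conv A \<inter> conv B = {}"
proof -
  have "0 \<le> orient (p i) (p j) (p k)" if "k \<in> A" for k
    by (rule inside_nonneg) (use that assms in auto)
  then have "0 \<le> orient (p i) (p j) x" if "x \<in> conv A" for x
    by (intro orient_nonneg_hull[OF _ that]) blast
  moreover have "0 < orient (p j) (p i) (p k)" if "k \<in> B" for k
  proof -
    have "k \<in> {1..N}" "k \<notin> {i..j}" using that assms(5) by auto
    then have "orient (p i) (p j) (p k) < 0" using assms by (intro turn_outside) auto
    then show ?thesis using orient_swap[of "p j" "p i"] by simp
  qed
  then have "0 < orient (p j) (p i) x" if "x \<in> conv B" for x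
    by (intro orient_pos_hull[OF _ that]) blast
  ultimately show ?thesis using orient_swap[of "p j" "p i"] by fastforce
qed

text \<open>The line through \<open>p i\<close> and \<open>p j\<close> separates \<open>p k\<close> from \<open>p l\<close>, so it meets their segment in a point
  \<open>x\<close>. That \<open>x\<close> is between \<open>p i\<close> and \<open>p j\<close> follows by measuring it against the two sides
  \<open>(i, k)\<close> and \<open>(j, l)\<close> of the quadrilateral, each of which has the other two corners on one side.\<close>

lemma crossing_point:
  assumes "1 \<le> i" "i < k" "k < j" "j < l" "l \<le> N"
  obtains s t where "0 < s" "s < 1" "0 < t" "t < 1"
    "(1 - s) *\<^sub>R p i + s *\<^sub>R p j = (1 - t) *\<^sub>R p k + t *\<^sub>R p l"
proof -
  let ?f = "orient (p i) (p j)"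
  have fk: "0 < ?f (p k)" using turn_inside assms by simp
  have fl: "?f (p l) < 0" using turn_outside assms by simp
  define t where "t = ?f (p k) / (?f (p k) - ?f (p l))"
  have t: "0 < t" "t < 1" unfolding t_def using fk fl by (auto simp: field_simps)
  define x where "x = (1 - t) *\<^sub>R p k + t *\<^sub>R p l"
  have "?f x = (1 - t) * ?f (p k) + t * ?f (p l)" unfolding x_def orient_affine ..
  also have "\<dots> = 0" unfolding t_def using fk fl by (simp add: divide_simps)
  finally have fx: "?f x = 0" .
  have "p i \<noteq> p j" using p_neq assms by simp
  then obtain s where s: "x = (1 - s) *\<^sub>R p i + s *\<^sub>R p j" using on_line fx by blast
  have "orient (p i) (p k) x = t * orient (p i) (p k) (p l)" unfolding x_def orient_affine by simp
  moreover have "orient (p i) (p k) x = s * orient (p i) (p k) (p j)" unfolding s orient_affine by simp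
  moreover have "orient (p i) (p k) (p l) < 0" "orient (p i) (p k) (p j) < 0" using turn assms by auto
  ultimately have s0: "0 < s" using t by (metis mult_less_0_iff mult_pos_neg not_less_iff_gr_or_eq)
  have "orient (p j) (p l) x = (1 - t) * orient (p j) (p l) (p k)" unfolding x_def orient_affine by simp
  moreover have "orient (p j) (p l) x = (1 - s) * orient (p j) (p l) (p i)" unfolding s orient_affine by simp
  moreover have "orient (p j) (p l) (p k) < 0" "orient (p j) (p l) (p i) < 0"
    using turn_outside[of j l] assms by auto
  ultimately have "0 < 1 - s" using t
    by (metis diff_gt_0_iff_gt mult_less_0_iff mult_pos_neg not_less_iff_gr_or_eq)
  then show ?thesis using that[of s t] s0 t s x_def by simp
qed

lemma crossing_hulls_meet:
  assumes "1 \<le> i" "i < k" "k < j" "j < l" "l \<le> N" "i \<in> A" "j \<in> A" "k \<in> B" "l \<in> B"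
  shows "conv A \<inter> conv B \<noteq> {}"
proof -
  obtain s t where st: "0 < s" "s < 1" "0 < t" "t < 1"
    "(1 - s) *\<^sub>R p i + s *\<^sub>R p j = (1 - t) *\<^sub>R p k + t *\<^sub>R p l" using crossing_point[OF assms(1-5)] .
  let ?x = "(1 - s) *\<^sub>R p i + s *\<^sub>R p j"
  have "?x \<in> conv A"
    by (rule convexD[OF convex_convex_hull]) (use st assms in \<open>auto intro: hull_inc\<close>)
  moreover have "?x \<in> conv B" unfolding st(5)
    by (rule convexD[OF convex_convex_hull]) (use st assms in \<open>auto intro: hull_inc\<close>)
  ultimately show ?thesis by blast
qed

text \<open>If the crossing point were on the boundary, a supporting functional there would be constant along both
  chords, as the point is interior to each of them. But three of their endpoints are not collinear.\<close>

lemma crossing_interior: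
  assumes "1 \<le> i" "i < k" "k < j" "j < l" "l \<le> N"
  shows "conv {i, j} \<inter> conv {k, l} \<inter> interior (conv {1..N}) \<noteq> {}"
proof -
  obtain s t where st: "0 < s" "s < 1" "0 < t" "t < 1"
    "(1 - s) *\<^sub>R p i + s *\<^sub>R p j = (1 - t) *\<^sub>R p k + t *\<^sub>R p l" using crossing_point[OF assms] .
  define x where "x = (1 - s) *\<^sub>R p i + s *\<^sub>R p j"
  let ?K = "conv {1..N}"
  have x1: "x \<in> conv {i, j}" unfolding x_def
    by (rule convexD[OF convex_convex_hull]) (use st in \<open>auto intro: hull_inc\<close>)
  have x2: "x \<in> conv {k, l}" unfolding x_def st(5)
    by (rule convexD[OF convex_convex_hull]) (use st in \<open>auto intro: hull_inc\<close>)
  have in_K: "p q \<in> ?K" if "q \<in> {1..N}" for q using that by (auto intro: hull_inc)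
  have xK: "x \<in> ?K" using x1 hull_mono[of "p ` {i, j}" "p ` {1..N}" convex] assms by auto
  have "x \<in> interior ?K"
  proof (rule ccontr)
    assume nx: "x \<notin> interior ?K"
    obtain c where c: "c \<noteq> 0" "\<And>y. y \<in> ?K \<Longrightarrow> c \<bullet> x \<le> c \<bullet> y"
    proof (cases "interior ?K = {}")
      case True
      then obtain c b where cb: "c \<noteq> 0" "?K \<subseteq> {y. c \<bullet> y = b}"
        using empty_interior_subset_hyperplane[OF convex_convex_hull] by metis
      have "c \<bullet> y = b" if "y \<in> ?K" for y using cb(2) that by blast
      then show ?thesis using that[OF cb(1)] xK by simp
    next
      case False
      then have "x \<notin> rel_interior ?K" using rel_interior_nonempty_interior[OF False] nx by simp
      then show ?thesis using supporting_hyperplane_rel_boundary[OF convex_convex_hull xK] that by metis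
    qed
    have eq: "c \<bullet> y = c \<bullet> x \<and> c \<bullet> z = c \<bullet> x"
      if "x = (1 - u) *\<^sub>R y + u *\<^sub>R z" "0 < u" "u < 1" "y \<in> ?K" "z \<in> ?K" for u y z
    proof -
      have "(1 - u) * (c \<bullet> y - c \<bullet> x) + u * (c \<bullet> z - c \<bullet> x) = 0"
        using arg_cong[OF that(1), of "inner c"] by (simp add: inner_add_right algebra_simps)
      moreover have "0 \<le> (1 - u) * (c \<bullet> y - c \<bullet> x)" "0 \<le> u * (c \<bullet> z - c \<bullet> x)" using c that by auto
      ultimately have "(1 - u) * (c \<bullet> y - c \<bullet> x) = 0" "u * (c \<bullet> z - c \<bullet> x) = 0" by linarith+
      then show ?thesis using that by auto
    qed
    have "c \<bullet> p i = c \<bullet> x" "c \<bullet> p j = c \<bullet> x" using eq[OF x_def st(1,2) in_K in_K] assms by auto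
    moreover have "c \<bullet> p k = c \<bullet> x" using eq[OF _ st(3,4) in_K in_K, of k l] st(5) x_def assms by auto
    ultimately have "orient (p i) (p j) (p k) = 0"
      using orthogonal_orient[OF c(1)] by (simp add: inner_diff_right)
    then show False using turn_inside[of i k j] assms by simp
  qed
  then show ?thesis using x1 x2 by blast
qed

lemma vertex_not_interior: assumes "q \<in> {1..N}" "2 \<le> N" shows "p q \<notin> interior (conv {1..N})"
proof
  assume q: "p q \<in> interior (conv {1..N})"
  show False
  proof (cases "q = N")
    case False
    then have "p q \<noteq> p (Suc q)" using p_neq[of q "Suc q"] assms by auto
    then have "orient (p q) (p (Suc q)) (p q) < 0"
      by (rule interior_not_on_supporting_line[OF _ _ q]) (use edge_nonpos[of q] False assms in auto)
    then show False by simp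
  next
    case True
    have "p q \<noteq> p 1" using p_neq[of q 1] assms True by auto
    moreover have "orient (p q) (p 1) (p k) \<le> 0" if "k \<in> {1..N}" for k
      using inside_nonneg[of 1 q k] that True orient_swap[of "p q" "p 1"] by simp
    ultimately have "orient (p q) (p 1) (p q) < 0"
      by (intro interior_not_on_supporting_line[OF _ _ q]) auto
    then show False by simp
  qed
qed

text \<open>On one side of the chord the orientation is a supporting functional, and it vanishes at the endpoints
  of the chord only.\<close>

lemma hull_meets_chord:
  assumes ij: "1 \<le> i" "i < j" "j \<le> N" and A: "A \<subseteq> {1..N}"
    and side: "A \<subseteq> {i..j} \<or> A \<inter> {i<..<j} = {}"
    and x: "x \<in> conv A" "orient (p i) (p j) x = 0"
  shows "x \<in> conv (A \<inter> {i, j})"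
proof -
  have fin: "finite (p ` A)" using A finite_subset by blast
  have zero: "q \<in> {i, j}" if "q \<in> A" "orient (p i) (p j) (p q) = 0" for q
  proof (rule ccontr)
    assume nq: "q \<notin> {i, j}"
    have "q \<in> {1..N}" using that A by blast
    then consider "i < q \<and> q < j" | "q < i \<or> j < q" using nq by fastforce
    then show False using turn_inside[of i q j] turn_outside[of i j q] that(2) ij \<open>q \<in> {1..N}\<close> by cases auto
  qed
  show ?thesis
  proof (cases "A \<subseteq> {i..j}")
    case True
    have "x \<in> convex hull {s \<in> p ` A. orient (p i) (p j) s = 0}"
      by (rule hull_on_supporting_line[OF fin _ x]) (use inside_nonneg[of i j] True ij in auto)
    moreover have "{s \<in> p ` A. orient (p i) (p j) s = 0} \<subseteq> p ` (A \<inter> {i, j})" using zero by blast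
    ultimately show ?thesis using hull_mono by blast
  next
    case False
    then have out: "A \<inter> {i<..<j} = {}" using side by blast
    have "0 \<le> orient (p j) (p i) (p q)" if "q \<in> A" for q
    proof -
      have "q \<notin> {i<..<j}" "q \<in> {1..N}" using that out A by auto
      then have "orient (p i) (p j) (p q) \<le> 0" using outside_nonpos[of i j q] ij by force
      then show ?thesis using orient_swap[of "p i" "p j"] by simp
    qed
    moreover have "orient (p j) (p i) x = 0" using x(2) orient_swap[of "p i" "p j"] by simp
    ultimately have "x \<in> convex hull {s \<in> p ` A. orient (p j) (p i) s = 0}"
      by (intro hull_on_supporting_line[OF fin _ x(1)]) auto
    moreover have "{s \<in> p ` A. orient (p j) (p i) s = 0} \<subseteq> p ` (A \<inter> {i, j})"
      using zero orient_swap[of "p i" "p j"] by auto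
    ultimately show ?thesis using hull_mono by blast
  qed
qed

lemma chord_line: "x \<in> conv {i, j} \<Longrightarrow> orient (p i) (p j) x = 0"
  by (rule antisym) (auto intro: orient_nonneg_hull[of "p ` {i, j}"] orient_nonpos_hull[of "p ` {i, j}"])

text \<open>Chords that do not cross share at most one endpoint, and then meet nowhere else; no vertex is interior.\<close>

lemma noncrossing_chords_meet_outside_interior:
  assumes "1 \<le> i" "i < j" "j \<le> N" "1 \<le> k" "k < l" "l \<le> N" "(i, j) \<noteq> (k, l)"
    and nc: "\<not> (i < k \<and> k < j \<and> j < l)" "\<not> (k < i \<and> i < l \<and> l < j)"
  shows "conv {i, j} \<inter> conv {k, l} \<inter> interior (conv {1..N}) = {}"
proof (rule ccontr)
  assume "\<not> ?thesis"
  then obtain x where x: "x \<in> conv {i, j}" "x \<in> conv {k, l}"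
    "x \<in> interior (conv {1..N})" by blast
  have "(i \<le> k \<and> l \<le> j) \<or> l \<le> i \<or> j \<le> k \<or> (k \<le> i \<and> j \<le> l)" using nc assms(2,5) by linarith
  then have "{k, l} \<subseteq> {i..j} \<or> {k, l} \<inter> {i<..<j} = {}" using assms(2,5) by fastforce
  moreover have "{k, l} \<subseteq> {1..N}" using assms by simp
  ultimately have "x \<in> conv ({k, l} \<inter> {i, j})"
    using hull_meets_chord[OF assms(1-3) _ _ x(2) chord_line[OF x(1)]] by blast
  moreover obtain q where q: "q \<in> {1..N}" "{k, l} \<inter> {i, j} \<subseteq> {q}"
  proof (cases "k \<in> {i, j}")
    case True
    then have "l \<notin> {i, j}" using assms(2,5,7) by auto
    then show ?thesis using that[of k] assms by auto
  next
    case False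
    then show ?thesis using that[of l] assms by auto
  qed
  then have "p ` ({k, l} \<inter> {i, j}) \<subseteq> {p q}" by blast
  ultimately have "x \<in> convex hull {p q}" using hull_mono by blast
  then have "x = p q" by simp
  moreover have "2 \<le> N" using assms(1-3) by linarith
  ultimately show False using vertex_not_interior[OF q(1)] x(3) by simp
qed

end

section \<open>Hulls of vertex sets\<close>

text \<open>Not symmetric: the least of the four alternating positions is in \<open>A\<close>.\<close>

definition crossing :: "nat set \<Rightarrow> nat set \<Rightarrow> bool" where
  "crossing A B \<longleftrightarrow> (\<exists>w\<in>A. \<exists>x\<in>B. \<exists>y\<in>A. \<exists>z\<in>B. w < x \<and> x < y \<and> y < z)"

lemma crossingI: "w \<in> A \<Longrightarrow> x \<in> B \<Longrightarrow> y \<in> A \<Longrightarrow> z \<in> B \<Longrightarrow> w < x \<Longrightarrow> x < y \<Longrightarrow> y < z \<Longrightarrow> crossing A B"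
  unfolding crossing_def by blast

context clockwise_points
begin

text \<open>If some vertex of one set is strictly inside the span of the other, then the whole set lies in a single gap
  of the other, and the chord closing the gap separates the two. If neither happens, the chord spanned by
  the extreme elements of one of them does, unless both sets are single vertices.\<close>

lemma noncrossing_hulls_disjoint:
  assumes A: "A \<subseteq> {1..N}" and B: "B \<subseteq> {1..N}" and disj: "A \<inter> B = {}"
    and nc: "\<not> crossing A B" and nc': "\<not> crossing B A"
  shows "conv A \<inter> conv B = {}"
proof -
  have gap: "conv C \<inter> conv D = {}"
    if C: "C \<subseteq> {1..N}" and D: "D \<subseteq> {1..N}" and disj: "C \<inter> D = {}"
      and nc: "\<not> crossing C D" and nc': "\<not> crossing D C"
      and d: "a \<in> C" "d \<in> D" "c \<in> C" "a < d" "d < c" for C D a c d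
  proof -
    have "finite C" using C finite_subset by blast
    then have fin: "finite {x \<in> C. x < d}" "finite {x \<in> C. d < x}" by simp_all
    define i where "i = Max {x \<in> C. x < d}"
    define j where "j = Min {x \<in> C. d < x}"
    have i: "i \<in> C" "i < d" "\<And>x. x \<in> C \<Longrightarrow> x < d \<Longrightarrow> x \<le> i"
      using Max_in[OF fin(1)] Max_ge[OF fin(1)] d unfolding i_def by blast+
    have j: "j \<in> C" "d < j" "\<And>x. x \<in> C \<Longrightarrow> d < x \<Longrightarrow> j \<le> x"
      using Min_in[OF fin(2)] Min_le[OF fin(2)] d unfolding j_def by blast+
    have "x \<notin> {i<..<j}" if "x \<in> C" for x
    proof -
      have "x \<noteq> d" using that d(2) disj by blast
      then consider "x < d" | "d < x" by linarith
      then show ?thesis using i(3)[OF that] j(3)[OF that] by cases auto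
    qed
    then have "C \<subseteq> {1..N} - {i<..<j}" using C by blast
    moreover have "x \<in> {i<..<j}" if "x \<in> D" for x
    proof -
      have "x \<noteq> i" "x \<noteq> j" using that i(1) j(1) disj by blast+
      moreover have "\<not> x < i" using crossingI[OF that i(1) d(2) j(1)] nc' i(2) j(2) by blast
      moreover have "\<not> j < x" using crossingI[OF i(1) d(2) j(1) that] nc i(2) j(2) by blast
      ultimately show ?thesis by auto
    qed
    then have "D \<subseteq> {i<..<j}" by blast
    moreover have "1 \<le> i" "j \<le> N" "i < j" using i j C by auto
    ultimately show ?thesis by (intro inside_outside_disjoint)
  qed
  have span: "conv C \<inter> conv D = {}"
    if C: "C \<subseteq> {1..N}" and D: "D \<subseteq> {1..N}" and ac: "a \<in> C" "c \<in> C" "a < c"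
      and out: "\<And>a d c. a \<in> C \<Longrightarrow> d \<in> D \<Longrightarrow> c \<in> C \<Longrightarrow> a \<le> d \<Longrightarrow> d \<le> c \<Longrightarrow> False" for C D a c
  proof -
    have fin: "finite C" and ne: "C \<noteq> {}" using C finite_subset ac by auto
    have ij: "Min C \<in> C" "Max C \<in> C" "\<And>x. x \<in> C \<Longrightarrow> Min C \<le> x \<and> x \<le> Max C" using fin ne by auto
    have "C \<subseteq> {Min C..Max C}" using ij(3) by auto
    moreover have "D \<subseteq> {1..N} - {Min C..Max C}" using out[OF ij(1) _ ij(2)] D by auto
    moreover have "Min C < Max C" using ij(3)[OF ac(1)] ij(3)[OF ac(2)] ac(3) by linarith
    ultimately show ?thesis using ij(1,2) C by (intro inside_outside_disjoint') auto
  qed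
  consider (P) a d c where "a \<in> A" "d \<in> B" "c \<in> A" "a < d" "d < c"
    | (Q) a d c where "a \<in> B" "d \<in> A" "c \<in> B" "a < d" "d < c"
    | (R) "\<And>a d c. a \<in> A \<Longrightarrow> d \<in> B \<Longrightarrow> c \<in> A \<Longrightarrow> a < d \<Longrightarrow> d < c \<Longrightarrow> False"
      "\<And>a d c. a \<in> B \<Longrightarrow> d \<in> A \<Longrightarrow> c \<in> B \<Longrightarrow> a < d \<Longrightarrow> d < c \<Longrightarrow> False"
    by blast
  then show ?thesis
  proof cases
    case P then show ?thesis by (rule gap[OF A B disj nc nc'])
  next
    case Q
    have "B \<inter> A = {}" using disj by blast
    then have "conv B \<inter> conv A = {}" by (rule gap[OF B A _ nc' nc Q])
    then show ?thesis by blast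
  next
    case R
    have ne: "a \<noteq> d" if "a \<in> A" "d \<in> B" for a d using that disj by blast
    have R1: "False" if "a \<in> A" "d \<in> B" "c \<in> A" "a \<le> d" "d \<le> c" for a d c
      using R(1)[OF that(1-3)] that ne[OF that(1,2)] ne[OF that(3,2)] by linarith
    have R2: "False" if "a \<in> B" "d \<in> A" "c \<in> B" "a \<le> d" "d \<le> c" for a d c
      using R(2)[OF that(1-3)] that ne[OF that(2,1)] ne[OF that(2,3)] by linarith
    consider a c where "a \<in> A" "c \<in> A" "a < c" | a c where "a \<in> B" "c \<in> B" "a < c"
      | "\<And>a c. a \<in> A \<Longrightarrow> c \<in> A \<Longrightarrow> a = c" "\<And>a c. a \<in> B \<Longrightarrow> c \<in> B \<Longrightarrow> a = c"
      by (meson linorder_neqE_nat)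
    then show ?thesis
    proof cases
      case 1 show ?thesis by (rule span[OF A B 1 R1])
    next
      case 2
      have "conv B \<inter> conv A = {}" by (rule span[OF B A 2 R2])
      then show ?thesis by blast
    next
      case 3
      show ?thesis
      proof (cases "A = {} \<or> B = {}")
        case False
        then obtain a b where ab: "a \<in> A" "b \<in> B" by blast
        then have "A = {a}" "B = {b}" using 3 by auto
        moreover have "p a \<noteq> p b" using p_neq ab A B ne by blast
        ultimately show ?thesis by simp
      qed auto
    qed
  qed
qed

text \<open>Near the midpoint \<open>M\<close> of the chord, on the side of \<open>q\<close>, there are points \<open>y\<close> of the polygon. The triangles
  that do not contain \<open>M\<close> form a closed set, so for \<open>y\<close> close to \<open>M\<close> a triangle containing \<open>y\<close> contains
  \<open>M\<close> as well. Its sides do not cross the chord, so it lies on one side; containing the point \<open>M\<close>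
  between the endpoints of the chord, it has both endpoints as corners.\<close>

lemma triangle_on_side:
  assumes Tr: "finite Tr" "\<And>t. t \<in> Tr \<Longrightarrow> t \<subseteq> {1..N} \<and> card t = 3"
    and adj: "\<And>t a b. t \<in> Tr \<Longrightarrow> a \<in> t \<Longrightarrow> b \<in> t \<Longrightarrow> a < b \<Longrightarrow> e a b"
    and nc: "\<And>a b c d. e a b \<Longrightarrow> e c d \<Longrightarrow> a < c \<Longrightarrow> c < b \<Longrightarrow> d \<le> b"
    and cover: "conv {1..N} \<subseteq> (\<Union>t\<in>Tr. conv t)"
    and ij: "e i j" "1 \<le> i" "i < j" "j \<le> N" and q: "q \<in> {1..N}" "q \<notin> {i, j}"
  shows "\<exists>k\<in>{1..N}. k \<notin> {i, j} \<and> {i, j, k} \<in> Tr \<and> (i < k \<and> k < j) = (i < q \<and> q < j)"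
proof -
  let ?in = "\<lambda>k. i < k \<and> k < j"
  define f where "f x = (if ?in q then orient (p i) (p j) x else orient (p j) (p i) x)" for x
  have f_aff: "f ((1 - t) *\<^sub>R x + t *\<^sub>R y) = (1 - t) * f x + t * f y" for t x y
    unfolding f_def by (simp add: orient_affine)
  have f0: "f x = 0 \<longleftrightarrow> orient (p i) (p j) x = 0" for x
    unfolding f_def using orient_swap[of "p j" "p i" x] by simp
  have fpos: "0 < f (p k) \<longleftrightarrow> k \<notin> {i, j} \<and> ?in k = ?in q" if "k \<in> {1..N}" for k
  proof -
    consider "k \<in> {i, j}" | "?in k" | "k < i \<or> j < k" using ij by fastforce
    then show ?thesis
    proof cases
      case 1 then show ?thesis unfolding f_def by auto
    next
      case 2
      then show ?thesis using turn_inside[of i k j] ij orient_swap[of "p j" "p i" "p k"] unfolding f_def by auto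
    next
      case 3
      then show ?thesis using turn_outside[of i j k] that ij orient_swap[of "p j" "p i" "p k"] unfolding f_def by auto
    qed
  qed
  have f_hull: "f x \<le> 0" if "x \<in> conv t" "\<And>k. k \<in> t \<Longrightarrow> f (p k) \<le> 0" for x t
  proof (cases "?in q")
    case True
    then have f: "f = orient (p i) (p j)" unfolding f_def by auto
    show ?thesis unfolding f by (rule orient_nonpos_hull[OF _ that(1)]) (use that(2) f in auto)
  next
    case False
    then have f: "f = orient (p j) (p i)" unfolding f_def by auto
    show ?thesis unfolding f by (rule orient_nonpos_hull[OF _ that(1)]) (use that(2) f in auto)
  qed
  define M where "M = (1 - 1/2) *\<^sub>R p i + (1/2) *\<^sub>R p j"
  have pij: "p i \<noteq> p j" using p_neq ij by simp
  have fM: "f M = 0" unfolding M_def f_aff unfolding f_def by simp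
  have in_K: "p k \<in> conv {1..N}" if "k \<in> {1..N}" for k using that by (auto intro: hull_inc)
  have MK: "M \<in> conv {1..N}" unfolding M_def
    by (rule convexD[OF convex_convex_hull in_K in_K]) (use ij in auto)
  \<comment> \<open>The triangles avoiding \<open>M\<close> keep a positive distance from it.\<close>
  define C where "C = (\<Union>t\<in>{t \<in> Tr. M \<notin> conv t}. conv t)"
  have "closed C" unfolding C_def
  proof (intro closed_UN ballI)
    fix t assume "t \<in> {t \<in> Tr. M \<notin> conv t}"
    then have "finite t" using Tr(2) finite_subset by blast
    then show "closed (conv t)"
      by (intro compact_imp_closed finite_imp_compact_convex_hull) simp
  qed (use Tr in simp)
  moreover have "M \<notin> C" unfolding C_def by blast
  ultimately obtain \<epsilon> where eps: "0 < \<epsilon>" "ball M \<epsilon> \<inter> C = {}"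
    by (metis Compl_iff disjoint_eq_subset_Compl open_Compl open_contains_ball)
  \<comment> \<open>With this \<open>s\<close> the point at fraction \<open>s\<close> of the way from \<open>M\<close> to \<open>p q\<close> is less than \<open>\<epsilon>\<close> away from \<open>M\<close>.\<close>
  define d where "d = norm (p q - M)"
  define s where "s = \<epsilon> / (\<epsilon> + d)"
  have d: "0 \<le> d" unfolding d_def by simp
  have s: "0 < s" "s \<le> 1" "s * d < \<epsilon>" unfolding s_def using eps(1) d by (auto simp: field_simps)
  define y where "y = (1 - s) *\<^sub>R M + s *\<^sub>R p q"
  have "y - M = s *\<^sub>R (p q - M)" unfolding y_def by (simp add: algebra_simps)
  then have "norm (y - M) = s * d" unfolding d_def using s by simp
  then have "y \<in> ball M \<epsilon>" using s(3) by (simp add: dist_norm norm_minus_commute)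
  then have "y \<notin> C" using eps by blast
  moreover have "y \<in> conv {1..N}" unfolding y_def
    by (rule convexD[OF convex_convex_hull MK in_K]) (use q s in auto)
  ultimately obtain t where t: "t \<in> Tr" "y \<in> conv t" "M \<in> conv t"
    using cover unfolding C_def by blast
  have tN: "t \<subseteq> {1..N}" "card t = 3" using Tr(2)[OF t(1)] by auto
  have "0 < f (p q)" using fpos[OF q(1)] q(2) by simp
  then have "0 < f y" unfolding y_def f_aff fM using s by simp
  then obtain k where k: "k \<in> t" "0 < f (p k)" using f_hull[OF t(2)] by (meson not_le)
  have kN: "k \<in> {1..N}" using k tN by blast
  then have kq: "k \<notin> {i, j}" "?in k = ?in q" using fpos k by auto
  have "t \<subseteq> {i..j} \<or> t \<inter> {i<..<j} = {}"
  proof (rule ccontr)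
    assume "\<not> ?thesis"
    then obtain a b where a: "a \<in> t" "a < i \<or> j < a" and b: "b \<in> t" "i < b" "b < j" by fastforce
    from a(2) show False
    proof
      assume "a < i"
      then have "e a b" using adj[OF t(1) a(1) b(1)] b by simp
      then show False using nc[OF _ ij(1)] \<open>a < i\<close> b by (meson leD)
    next
      assume "j < a"
      then have "e b a" using adj[OF t(1) b(1) a(1)] b by simp
      then show False using nc[OF ij(1)] \<open>j < a\<close> b by (meson leD)
    qed
  qed
  then have M: "M \<in> conv (t \<inter> {i, j})"
    using hull_meets_chord[OF ij(2-4) tN(1) _ t(3)] fM f0 by blast
  have "M \<noteq> p i" "M \<noteq> p j"
  proof -
    have "M = midpoint (p i) (p j)" unfolding M_def midpoint_def by (simp add: scaleR_add_right)
    then show "M \<noteq> p i" "M \<noteq> p j" using pij by simp_all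
  qed
  have "i \<in> t"
  proof (rule ccontr)
    assume "i \<notin> t"
    then have "p ` (t \<inter> {i, j}) \<subseteq> {p j}" by blast
    then have "M \<in> convex hull {p j}" using M hull_mono by blast
    then show False using \<open>M \<noteq> p j\<close> by simp
  qed
  moreover have "j \<in> t"
  proof (rule ccontr)
    assume "j \<notin> t"
    then have "p ` (t \<inter> {i, j}) \<subseteq> {p i}" by blast
    then have "M \<in> convex hull {p i}" using M hull_mono by blast
    then show False using \<open>M \<noteq> p i\<close> by simp
  qed
  ultimately have "{i, j, k} \<subseteq> t" using k by blast
  moreover have "card {i, j, k} = 3" using kq(1) ij(3) by auto
  ultimately have "t = {i, j, k}" using card_subset_eq[of t "{i, j, k}"] tN finite_subset by auto
  then show ?thesis using t(1) kq kN by blast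
qed

text \<open>A point on the side of \<open>A\<close> is a combination of some \<open>y\<close> in the hull of \<open>A\<close> and some \<open>z\<close> in the hull of
  \<open>B\<close>. The segment from it to \<open>z\<close> meets the line in a point \<open>w\<close>, which is in the hull of \<open>A\<close> by
  assumption; so the point lies between two elements \<open>y\<close> and \<open>w\<close> of that hull.\<close>

lemma hull_split_along_line:
  assumes A: "\<And>x. x \<in> A \<Longrightarrow> 0 \<le> orient a b x" and B: "\<And>x. x \<in> B \<Longrightarrow> orient a b x \<le> 0"
    and meet: "\<And>w. w \<in> convex hull (A \<union> B) \<Longrightarrow> orient a b w = 0 \<Longrightarrow> w \<in> convex hull A"
    and x: "x \<in> convex hull (A \<union> B)" "0 \<le> orient a b x" and ne: "A \<noteq> {}" "B \<noteq> {}"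
  shows "x \<in> convex hull A"
proof -
  let ?f = "orient a b"
  have "convex hull (A \<union> B) = convex hull (convex hull A \<union> convex hull B)"
    by (rule hull_Un) (simp add: convex_Inter)
  moreover have "convex hull (convex hull A \<union> convex hull B) =
      {u *\<^sub>R s + v *\<^sub>R t |u v s t. 0 \<le> u \<and> 0 \<le> v \<and> u + v = 1 \<and> s \<in> convex hull A \<and> t \<in> convex hull B}"
    by (rule convex_hull_union_two) (use ne in simp_all)
  ultimately obtain u v y z where uv: "0 \<le> u" "0 \<le> v" "u + v = 1" "x = u *\<^sub>R y + v *\<^sub>R z"
      "y \<in> convex hull A" "z \<in> convex hull B"
    using x(1) by auto
  have x_eq: "x = (1 - v) *\<^sub>R y + v *\<^sub>R z" using uv(3,4) by (simp add: eq_diff_eq[symmetric])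
  have fz: "?f z \<le> 0" using orient_nonpos_hull[OF B uv(6)] .
  have zAB: "z \<in> convex hull (A \<union> B)"
    using uv(6) hull_mono[of B "A \<union> B" convex] by auto
  show ?thesis
  proof (cases "?f x = 0")
    case True then show ?thesis using meet x by blast
  next
    case False
    then have fx: "0 < ?f x" using x by simp
    define t where "t = ?f x / (?f x - ?f z)"
    have t: "0 < t" "t \<le> 1" unfolding t_def using fx fz by (auto simp: field_simps)
    define w where "w = (1 - t) *\<^sub>R x + t *\<^sub>R z"
    have "?f w = (1 - t) * ?f x + t * ?f z" unfolding w_def orient_affine ..
    also have "\<dots> = 0" unfolding t_def using fx fz by (simp add: divide_simps)
    finally have fw: "?f w = 0" .
    have "w \<in> convex hull (A \<union> B)" unfolding w_def
      by (rule convexD[OF convex_convex_hull]) (use x(1) zAB t in auto)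
    then have w: "w \<in> convex hull A" using meet fw by blast
    \<comment> \<open>\<open>x\<close> lies between \<open>y\<close> and \<open>w\<close>\<close>
    have nz: "t + v - t * v > 0"
    proof -
      have "t + v - t * v = t * (1 - v) + v" by (simp add: algebra_simps)
      moreover have "0 \<le> t * (1 - v)" using t uv by simp
      moreover have "v = 0 \<Longrightarrow> t * (1 - v) > 0" using t by simp
      ultimately show ?thesis using uv(2) by (cases "v = 0") auto
    qed
    let ?l = "v / (t + v - t * v)"
    have "x = (1 - ?l) *\<^sub>R y + ?l *\<^sub>R w"
    proof -
      let ?D = "t + v - t * v"
      have "?D *\<^sub>R x = (?D - v) *\<^sub>R y + v *\<^sub>R w"
        unfolding w_def x_eq by (simp add: algebra_simps)
      then have "(1 / ?D) *\<^sub>R (?D *\<^sub>R x) = (1 / ?D) *\<^sub>R ((?D - v) *\<^sub>R y + v *\<^sub>R w)" by simp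
      moreover have "(1 / ?D) * (?D - v) = 1 - ?l" using nz by (simp add: field_simps)
      ultimately show ?thesis using nz by (simp add: scaleR_add_right)
    qed
    moreover have "0 \<le> ?l" "?l \<le> 1"
      using nz uv t by (auto simp: field_simps mult_left_le)
    ultimately show ?thesis using convexD[OF convex_convex_hull uv(5) w, of "1 - ?l" ?l] by auto
  qed
qed

text \<open>Beyond either endpoint the line of the chord has left the polygon across a polygon edge at that endpoint.
  That edge must not be the chord itself, whence the second and the fourth assumption.\<close>

lemma hull_meets_chord_line:
  assumes ab: "1 \<le> a" "Suc a < b" "b \<le> N" "(a, b) \<noteq> (1, N)"
    and w: "w \<in> conv {1..N}" "orient (p a) (p b) w = 0"
  shows "w \<in> convex hull {p a, p b}"
proof -
  have "p a \<noteq> p b" using p_neq ab by simp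
  then obtain t where t: "w = (1 - t) *\<^sub>R p a + t *\<^sub>R p b" using on_line w(2) by blast
  have "orient (p a) (p (Suc a)) w \<le> 0"
    by (rule orient_nonpos_hull[OF _ w(1)]) (use edge_nonpos[of a] ab in auto)
  moreover have "orient (p a) (p (Suc a)) w = t * orient (p a) (p (Suc a)) (p b)"
    unfolding t orient_affine by simp
  moreover have "orient (p a) (p (Suc a)) (p b) < 0" using turn ab by simp
  ultimately have t0: "0 \<le> t" by (simp add: mult_le_0_iff)
  have t1: "0 \<le> 1 - t"
  proof (cases "b = N")
    case False
    have "orient (p b) (p (Suc b)) w \<le> 0"
      by (rule orient_nonpos_hull[OF _ w(1)]) (use edge_nonpos[of b] ab False in auto)
    moreover have "orient (p b) (p (Suc b)) w = (1 - t) * orient (p b) (p (Suc b)) (p a)"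
      unfolding t orient_affine by simp
    moreover have "orient (p b) (p (Suc b)) (p a) < 0" using turn_outside[of b "Suc b" a] ab False by simp
    ultimately show ?thesis by (simp add: mult_le_0_iff)
  next
    case True
    then have "1 < a" using ab by auto
    have "0 \<le> orient (p 1) (p N) w"
      by (rule orient_nonneg_hull[OF _ w(1)]) (use inside_nonneg[of 1 N] in auto)
    moreover have "orient (p 1) (p N) w = (1 - t) * orient (p 1) (p N) (p a)"
      unfolding t True orient_affine by simp
    moreover have "0 < orient (p 1) (p N) (p a)" using turn_inside[of 1 a N] \<open>1 < a\<close> ab True by simp
    ultimately show ?thesis by (simp add: zero_le_mult_iff)
  qed
  show ?thesis unfolding t by (rule convexD[OF convex_convex_hull]) (use t0 t1 in \<open>auto intro: hull_inc\<close>)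
qed

lemma hull_cut_by_chord:
  assumes ab: "1 \<le> a" "a < b" "b \<le> N" and A: "A \<subseteq> {a..b}" "{a, b} \<subseteq> A"
    and B: "B \<subseteq> {1..N} - {a<..<b}" "{a, b} \<subseteq> B"
  shows "conv (A \<union> B) \<subseteq> conv A \<union> conv B"
proof (cases "A = {a, b} \<or> B = {a, b}")
  case True
  then have "A \<union> B = B \<or> A \<union> B = A" using A B by blast
  then show ?thesis by auto
next
  case False
  have AN: "A \<union> B \<subseteq> {1..N}" using A(1) B(1) ab by fastforce
  obtain k where k: "k \<in> A" "k \<noteq> a" "k \<noteq> b" using False A(2) by blast
  then have "a < k" "k < b" using A(1) by fastforce+
  then have ab1: "Suc a < b" by simp
  obtain l where l: "l \<in> B" "l \<noteq> a" "l \<noteq> b" using False B(2) by blast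
  then have "l \<in> {1..N}" "l < a \<or> b < l" using B(1) by fastforce+
  then have ab2: "(a, b) \<noteq> (1, N)" by auto
  have meet: "w \<in> conv A \<and> w \<in> conv B"
    if "w \<in> convex hull (p ` A \<union> p ` B)" "orient (p a) (p b) w = 0" for w
  proof -
    have "p ` A \<union> p ` B \<subseteq> p ` {1..N}" using AN by auto
    then have "w \<in> conv {1..N}" using that(1) hull_mono by blast
    then have "w \<in> convex hull {p a, p b}" using hull_meets_chord_line[OF ab(1) ab1 ab(3) ab2] that(2) by blast
    moreover have "{p a, p b} \<subseteq> p ` A" "{p a, p b} \<subseteq> p ` B" using A(2) B(2) by auto
    ultimately show ?thesis using hull_mono by blast
  qed
  have fA: "0 \<le> orient (p a) (p b) x" if "x \<in> p ` A" for x
    using that A(1) inside_nonneg[of a b] ab by auto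
  have fB: "orient (p a) (p b) x \<le> 0" if "x \<in> p ` B" for x
  proof -
    obtain k where k: "x = p k" "k \<in> B" using \<open>x \<in> p ` B\<close> by blast
    then have "k \<in> {1..N}" "k \<le> a \<or> b \<le> k" using B(1) by fastforce+
    then show ?thesis using outside_nonpos[of a b k] k ab by simp
  qed
  have neA: "p ` A \<noteq> {}" "p ` B \<noteq> {}" using A(2) B(2) by auto
  show ?thesis
  proof
    fix x assume "x \<in> conv (A \<union> B)"
    then have x: "x \<in> convex hull (p ` A \<union> p ` B)" by (simp add: image_Un)
    show "x \<in> conv A \<union> conv B"
    proof (cases "0 \<le> orient (p a) (p b) x")
      case True
      have "x \<in> conv A"
        by (rule hull_split_along_line[OF fA fB meet[THEN conjunct1] x True neA])
      then show ?thesis by blast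
    next
      case False
      have "x \<in> conv B"
      proof (rule hull_split_along_line[of "p ` B" "p b" "p a" "p ` A"])
        show "x \<in> convex hull (p ` B \<union> p ` A)" using x by (simp add: Un_commute)
        show "w \<in> conv B" if "w \<in> convex hull (p ` B \<union> p ` A)" "orient (p b) (p a) w = 0" for w
          using meet[of w] that orient_swap[of "p b" "p a" w] by (simp add: Un_commute)
      qed (use fA fB neA False orient_swap[of "p b" "p a"] in auto)
      then show ?thesis by blast
    qed
  qed
qed

lemma hull_split_triangle:
  assumes "1 \<le> i" "i < k" "k < j" "j \<le> N"
  shows "conv {i..j} \<subseteq>
    conv {i..k} \<union> conv {i, k, j} \<union> conv {k..j}"
proof -
  have 1: "conv ({i..k} \<union> insert i {k..j}) \<subseteq> conv {i..k} \<union> convex hull (p ` insert i {k..j})"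
    by (rule hull_cut_by_chord[of i k]) (use assms in auto)
  have 2: "conv ({k..j} \<union> {i, k, j}) \<subseteq> conv {k..j} \<union> conv {i, k, j}"
    by (rule hull_cut_by_chord[of k j]) (use assms in auto)
  have "{i..k} \<union> insert i {k..j} = {i..j}" "{k..j} \<union> {i, k, j} = insert i {k..j}" using assms by auto
  then show ?thesis using 1 2 by auto
qed

text \<open>Induction on the length of the chord: the triangle on its inner side splits the polygon that it cuts off
  into that triangle and two smaller polygons of the same kind.\<close>

lemma inner_triangles_cover:
  assumes inner: "\<And>i j. e i j \<Longrightarrow> Suc i < j \<Longrightarrow> \<exists>k. i < k \<and> k < j \<and> e i k \<and> e k j"
    and e_bounds: "\<And>i j. e i j \<Longrightarrow> 1 \<le> i \<and> i < j \<and> j \<le> N"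
    and "e i j" "Suc i < j"
  shows "conv {i..j} \<subseteq>
    (\<Union>(a, b, c)\<in>{(a, b, c). e a b \<and> e b c \<and> e a c}. conv {a, b, c})"
  using assms(3,4)
proof (induction "j - i" arbitrary: i j rule: less_induct)
  case less
  let ?U = "\<Union>(a, b, c)\<in>{(a, b, c). e a b \<and> e b c \<and> e a c}. conv {a, b, c}"
  obtain k where k: "i < k" "k < j" "e i k" "e k j" using inner[OF less.prems] by blast
  have bd: "1 \<le> i" "j \<le> N" using e_bounds less.prems by auto
  have tri: "conv {i, k, j} \<subseteq> ?U" using k less.prems by blast
  have sub: "conv {a..b} \<subseteq> ?U" if "e a b" "b - a < j - i" "{a, b} \<subseteq> {i, k, j}" for a b
  proof (cases "Suc a < b")
    case True then show ?thesis using less.hyps that by blast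
  next
    case False
    then have "b = Suc a" using e_bounds[OF that(1)] by simp
    then have "{a..b} \<subseteq> {i, k, j}" using that(3) by auto
    then have "p ` {a..b} \<subseteq> p ` {i, k, j}" by (rule image_mono)
    then have "conv {a..b} \<subseteq> conv {i, k, j}" by (rule hull_mono)
    then show ?thesis using tri by blast
  qed
  have "conv {i..k} \<subseteq> ?U" "conv {k..j} \<subseteq> ?U"
    using sub[OF k(3)] sub[OF k(4)] k by auto
  then show ?case using hull_split_triangle[OF bd(1) k(1,2) bd(2)] tri by blast
qed

end

section \<open>The partition read off from half of a symmetric triangulation\<close>

text \<open>One half of a symmetric triangulation, as in the introduction. Polygon edges count as chords here, whence
  \<open>U_edge\<close> and \<open>X_edge\<close>. The half-turn exchanges \<open>X a b\<close> and \<open>X b a\<close>, since it maps \<open>a\<close> and \<open>bar b\<close> to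
  \<open>bar a\<close> and \<open>b\<close>. The last two assumptions give the triangle outside a pure chord, and the triangle on the
  side \<open>a, \<dots>, m, bar 1, \<dots>, bar b\<close> of a mixed chord, which is the next step of the staircase.\<close>

locale half_triangulation =
  fixes m :: nat and U X :: "nat \<Rightarrow> nat \<Rightarrow> bool"
  assumes m_ge: "2 \<le> m"
    and U_bounds: "U i j \<Longrightarrow> 1 \<le> i \<and> i < j \<and> j \<le> m"
    and X_bounds: "X a b \<Longrightarrow> 1 \<le> a \<and> a \<le> m \<and> 1 \<le> b \<and> b \<le> m"
    and U_edge: "1 \<le> i \<Longrightarrow> i < m \<Longrightarrow> U i (Suc i)"
    and X_edge: "X m 1"
    and X_sym: "X a b \<Longrightarrow> X b a"
    and U_U: "U i j \<Longrightarrow> U k l \<Longrightarrow> i < k \<Longrightarrow> k < j \<Longrightarrow> l \<le> j"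
    and U_X: "U i j \<Longrightarrow> X a b \<Longrightarrow> i < a \<Longrightarrow> a < j \<Longrightarrow> False"
    and X_X: "X a b \<Longrightarrow> X c d \<Longrightarrow> a < c \<Longrightarrow> b < d \<Longrightarrow> False"
    and U_outer: "U i j \<Longrightarrow> (\<exists>k>j. U i k \<and> U j k) \<or> (\<exists>k<i. U k i \<and> U k j) \<or> (\<exists>b. X i b \<and> X j b)"
    and X_inner: "X a b \<Longrightarrow> (a, b) \<noteq> (m, 1) \<Longrightarrow>
      (\<exists>k>a. U a k \<and> X k b) \<or> (\<exists>k<b. U k b \<and> X a k)"
begin

lemma X_outer: "X a b \<Longrightarrow> (a, b) \<noteq> (1, m) \<Longrightarrow>
      (\<exists>k>b. U b k \<and> X a k) \<or> (\<exists>k<a. U k a \<and> X k b)"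
  using X_inner[of b a] X_sym by blast

lemma U_X': "U i j \<Longrightarrow> X a b \<Longrightarrow> i < b \<Longrightarrow> b < j \<Longrightarrow> False"
  using U_X X_sym by blast

text \<open>The definitions of redness of the pure and the mixed chords. Polygon edges may be red as well; this is
  harmless, because a moved edge has all vertices other than \<open>m\<close> and \<open>bar m\<close> on one side.\<close>

definition redU :: "nat \<Rightarrow> nat \<Rightarrow> bool" where
  "redU i j \<longleftrightarrow> U i j \<and> (\<exists>k>j. U i k \<and> U j k)"

definition redX :: "nat \<Rightarrow> nat \<Rightarrow> bool" where
  "redX a b \<longleftrightarrow> X a b \<and> ((\<exists>k>a. U a k \<and> X k b) \<or> (\<exists>k>b. U b k \<and> X a k))"

definition E :: "nat \<Rightarrow> nat \<Rightarrow> bool" where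
  "E i j \<longleftrightarrow> i \<in> {1..<m} \<and> j \<in> {1..<m} \<and>
     (\<forall>p q. redU p q \<longrightarrow> (p < i \<and> i < q) = (p < j \<and> j < q)) \<and>
     (\<forall>a b. redX a b \<longrightarrow> (a \<le> i) = (a \<le> j))"

definition F :: "nat \<Rightarrow> nat \<Rightarrow> bool" where
  "F i j \<longleftrightarrow> i \<in> {1..<m} \<and> j \<in> {1..<m} \<and>
     (\<forall>p q. redU p q \<longrightarrow> \<not> (p < i \<and> i < q) \<and> \<not> (p < j \<and> j < q)) \<and>
     (\<forall>a b. redX a b \<longrightarrow> (a \<le> i) = (j < b))"

definition r :: "nat \<Rightarrow> nat" where "r i = Max {j. U i j}"

lemma finite_U: "finite {j. U i j}"
  by (rule finite_subset[of _ "{..m}"]) (use U_bounds in auto)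

lemma r_max: "U i j \<Longrightarrow> j \<le> r i"
  unfolding r_def using finite_U by simp

lemma U_r: assumes "1 \<le> i" "i < m" shows "U i (r i)"
  using Max_in[OF finite_U[of i]] U_edge[OF assms] unfolding r_def by blast

lemma r_gt: "1 \<le> i \<Longrightarrow> i < m \<Longrightarrow> i < r i"
  using U_r U_bounds by blast

lemma r_le: "1 \<le> i \<Longrightarrow> i < m \<Longrightarrow> r i \<le> m"
  using U_r U_bounds by blast

lemma redX_sym: "redX a b \<Longrightarrow> redX b a"
  unfolding redX_def using X_sym by blast

lemma r_pred: assumes "1 \<le> i" "i < m" shows "r (r i - 1) = r i"
proof -
  let ?c = "r i"
  have c: "i < ?c" "?c \<le> m" using assms r_gt r_le by auto
  have le: "?c \<le> r (?c - 1)" using U_edge[of "?c - 1"] r_max[of "?c - 1" ?c] c assms by simp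
  have U: "U (?c - 1) (r (?c - 1))" using U_r[of "?c - 1"] c assms by simp
  show ?thesis
  proof (cases "i = ?c - 1")
    case False
    then have "i < ?c - 1" using c by simp
    then show ?thesis using U_U[OF U_r[OF assms] U] le c by simp
  qed simp
qed

lemma r_X_pred: assumes "X a b" "2 \<le> a" shows "r (a - 1) = a"
proof -
  have b: "a \<le> m" using X_bounds assms by blast
  have "U (a - 1) (r (a - 1))" using U_r[of "a - 1"] assms b by simp
  moreover have "a \<le> r (a - 1)" using U_edge[of "a - 1"] r_max[of "a - 1" a] assms b by simp
  moreover have "\<not> a < r (a - 1)" using U_X[OF calculation(1) assms(1)] assms(2) by auto
  ultimately show ?thesis by simp
qed

text \<open>Look at the outer triangle of \<open>(p, c)\<close>. If its third corner is higher, the chord is red. If it is a lower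
  \<open>k\<close>, pass to the longer chord \<open>(k, c)\<close>. If it is barred, there is a mixed chord at \<open>c\<close> which the
  staircase has reached by increasing the first coordinate. It is red itself if the next step also
  increases the first coordinate, and else the next mixed chord at \<open>c\<close> is red.\<close>

lemma red_below:
  assumes "U p c" "c < m"
  shows "(\<exists>q\<le>p. redU q c) \<or> (\<exists>b. redX c b)"
  using assms
proof (induction p rule: less_induct)
  case (less p)
  consider "\<exists>k>c. U p k \<and> U c k" | k where "k < p" "U k p" "U k c" | b where "X p b" "X c b"
    using U_outer[OF less.prems(1)] by blast
  then show ?case
  proof cases
    case 1 then show ?thesis using less.prems unfolding redU_def by blast
  next
    case 2 then show ?thesis using less.IH[of k] less.prems by (meson le_trans less_imp_le)
  next
    case 3
    consider k where "k > c" "U c k" "X k b" | k where "k < b" "U k b" "X c k"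
      using X_inner[OF 3(2)] less.prems by auto
    then show ?thesis
    proof cases
      case 1 then show ?thesis using 3 unfolding redX_def by blast
    next
      case 2 then show ?thesis using 3 unfolding redX_def by blast
    qed
  qed
qed

lemma r_noncrossing: assumes "1 \<le> i" "i < m" "i < k" "k < r i" shows "r k \<le> r i"
  using U_U[OF U_r[OF assms(1,2)] U_r[of k] assms(3,4)] assms r_le[OF assms(1,2)] by simp

text \<open>If \<open>r i \<noteq> r j\<close>, then \<open>red_below\<close> applied to \<open>(i, r i)\<close> or to \<open>(j, r j)\<close> yields a red chord that
  separates \<open>i\<close> from \<open>j\<close>.\<close>

lemma E_imp_r_eq: assumes "E i j" "i < j" shows "r i = r j"
proof (rule ccontr)
  assume ne: "r i \<noteq> r j"
  have ij: "1 \<le> i" "i < m" "1 \<le> j" "j < m" using assms unfolding E_def by auto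
  have Ered: "\<And>p q. redU p q \<Longrightarrow> (p < i \<and> i < q) = (p < j \<and> j < q)"
    and Ered': "\<And>a b. redX a b \<Longrightarrow> (a \<le> i) = (a \<le> j)" using assms(1) unfolding E_def by blast+
  have nored: "\<not> redU x (r x)" if "1 \<le> x" "x < m" for x
    using r_max unfolding redU_def by (meson leD)
  show False
  proof (cases "r i \<le> j")
    case True
    have "r i < m" using True ij by simp
    with red_below[OF U_r[OF ij(1,2)]]
    consider q where "q \<le> i" "redU q (r i)" | b where "redX (r i) b" by blast
    then show False
    proof cases
      case 1
      then have "q < i" using nored[OF ij(1,2)] le_neq_implies_less by blast
      then show False using Ered[OF 1(2)] True r_gt[OF ij(1,2)] by auto
    next
      case 2 then show False using Ered'[OF 2] True r_gt[OF ij(1,2)] by auto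
    qed
  next
    case False
    then have lt: "r j < r i" using r_noncrossing[OF ij(1,2) assms(2)] ne by auto
    then have "r j < m" using r_le[OF ij(1,2)] by simp
    with red_below[OF U_r[OF ij(3,4)]]
    consider q where "q \<le> j" "redU q (r j)" | b where "redX (r j) b" by blast
    then show False
    proof cases
      case 1
      then have "q < j" using nored[OF ij(3,4)] le_neq_implies_less by blast
      then have "q < i" using Ered[OF 1(2)] r_gt[OF ij(3,4)] by auto
      then show False using U_U[OF _ U_r[OF ij(1,2)], of q "r j"] 1 lt assms(2) r_gt[OF ij(3,4)]
        unfolding redU_def by auto
    next
      case 2 then show False using U_X[OF U_r[OF ij(1,2)], of "r j" b] lt assms(2) r_gt[OF ij(3,4)]
        unfolding redX_def by auto
    qed
  qed
qed

text \<open>A red chord that separates \<open>i\<close> from \<open>j\<close> must end at the common value \<open>c = r i = r j\<close>, since it does not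
  cross \<open>(i, c)\<close> and \<open>(j, c)\<close>. Being red it has a triangle with a third corner above \<open>c\<close>, and this
  triangle crosses \<open>(i, c)\<close> or contradicts the maximality of \<open>c\<close>.\<close>

lemma r_eq_imp_E: assumes "1 \<le> i" "i < j" "j < m" "r i = r j" shows "E i j"
proof -
  have ij: "1 \<le> i" "i < m" "1 \<le> j" "j < m" using assms by auto
  note Ui = U_r[OF ij(1,2)] and Uj = U_r[OF ij(3,4)]
  have jc: "j < r i" using r_gt[OF ij(3,4)] assms by simp
  have pureC: "(p < i \<and> i < q) = (p < j \<and> j < q)" if red: "redU p q" for p q
  proof -
    obtain k where U: "U p q" and k: "k > q" "U p k" "U q k" using red unfolding redU_def by blast
    have 1: "p < j \<and> j < q" if "p < i" "i < q"
      using U_U[OF U Ui that] jc that assms by auto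
    have 2: "p < i \<and> i < q" if "p < j" "j < q"
    proof (rule ccontr)
      assume "\<not> (p < i \<and> i < q)"
      then have ip: "i \<le> p" using that assms by auto
      have "r j \<le> q" using U_U[OF U Uj that] .
      moreover have "q \<le> r i"
      proof (cases "i = p")
        case True then show ?thesis using r_max[OF U] by simp
      next
        case False
        then show ?thesis using U_U[OF Ui U] ip that jc by auto
      qed
      ultimately have q: "q = r i" using assms by simp
      show False
      proof (cases "i = p")
        case True then show ?thesis using r_max[OF k(2)] k(1) q by simp
      next
        case False
        then show ?thesis using U_U[OF Ui k(2)] ip that q k(1) jc by auto
      qed
    qed
    show ?thesis using 1 2 by blast
  qed
  have mixedC: "(a \<le> i) = (a \<le> j)" if "redX a b" for a b
  proof -
    have "X a b" using that redX_def by blast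
    then have "\<not> (i < a \<and> a < r i)" using U_X[OF Ui] by blast
    then show ?thesis using assms jc by linarith
  qed
  show ?thesis unfolding E_def
  proof (intro conjI allI impI)
    show "i \<in> {1..<m}" "j \<in> {1..<m}" using ij by auto
  qed (rule pureC mixedC; assumption)+
qed

lemma E_sym: "E i j \<Longrightarrow> E j i" unfolding E_def by blast

lemma E_iff: "E i j \<longleftrightarrow> i \<in> {1..<m} \<and> j \<in> {1..<m} \<and> r i = r j"
proof (intro iffI)
  assume E: "E i j"
  then have "r i = r j"
    using E_imp_r_eq[OF E] E_imp_r_eq[OF E_sym[OF E]] by (metis linorder_neqE_nat)
  then show "i \<in> {1..<m} \<and> j \<in> {1..<m} \<and> r i = r j" using E E_def by blast
next
  assume h: "i \<in> {1..<m} \<and> j \<in> {1..<m} \<and> r i = r j"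
  consider "i < j" | "i = j" | "j < i" by linarith
  then show "E i j"
  proof cases
    case 1 then show ?thesis using r_eq_imp_E[of i j] h by simp
  next
    case 2 then show ?thesis using h unfolding E_def by simp
  next
    case 3 then show ?thesis using r_eq_imp_E[of j i] E_sym h by simp
  qed
qed

lemma F_sym: assumes "F i j" shows "F j i"
proof -
  have "(a \<le> j) = (i < b)" if "redX a b" for a b
  proof -
    have "(b \<le> i) = (j < a)" using assms redX_sym[OF that] unfolding F_def by blast
    then show ?thesis by auto
  qed
  then show ?thesis using assms unfolding F_def by blast
qed

text \<open>If \<open>(c, b)\<close> is on the staircase above \<open>(c, e)\<close>, then \<open>(c, e)\<close> was reached by decreasing the second
  coordinate, so it is not an outer corner.\<close>

lemma same_column_red: assumes "X c e" "X c b" "e < b" shows "redX c e"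
proof -
  have "(c, e) \<noteq> (1, m)" using X_bounds[OF assms(2)] assms(3) by auto
  then consider k where "k > e" "U e k" "X c k" | k where "k < c" "U k c" "X k e"
    using X_outer[OF assms(1)] by blast
  then show ?thesis
    using X_X[OF _ assms(2) _ assms(3)] assms(1) unfolding redX_def by cases blast+
qed

lemma same_row_red: "X c e \<Longrightarrow> X a e \<Longrightarrow> c < a \<Longrightarrow> redX c e"
  using same_column_red[of e c a] X_sym redX_sym by blast

text \<open>No mixed chord ends strictly between \<open>i\<close> and \<open>r i\<close>, or between \<open>j\<close> and \<open>r j\<close>. So a mixed chord
  beyond \<open>(i, j)\<close> is weakly beyond the outer corner \<open>(r i, r j)\<close>, and therefore equal to it.\<close>

lemma peak_unique:
  assumes "1 \<le> i" "i < m" "1 \<le> j" "j < m" "X (r i) (r j)" "\<not> redX (r i) (r j)"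
    and "X a b" "i < a" "j < b"
  shows "a = r i \<and> b = r j"
proof -
  have "r i \<le> a" using U_X[OF U_r[OF assms(1,2)] assms(7)] assms(8) by (meson not_le)
  moreover have "r j \<le> b" using U_X'[OF U_r[OF assms(3,4)] assms(7)] assms(9) by (meson not_le)
  moreover have "a = r i \<or> b = r j" using X_X[OF assms(5,7)] calculation by (metis le_neq_implies_less)
  moreover have "\<not> (a = r i \<and> r j < b)" using same_column_red[OF assms(5)] assms(6,7) by blast
  moreover have "\<not> (b = r j \<and> r i < a)" using same_row_red[OF assms(5)] assms(6,7) by blast
  ultimately show ?thesis by (metis le_neq_implies_less)
qed

lemma peak_no_red_around:
  assumes "1 \<le> i" "i < m" "X (r i) e" "redU p q" "p < i" "i < q"
  shows False
proof -
  obtain k where U: "U p q" and k: "k > q" "U p k" "U q k" using assms(4) unfolding redU_def by blast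
  have "r i \<le> q" using U_U[OF U U_r[OF assms(1,2)]] assms by blast
  then show False using U_X[OF k(2) assms(3)] k(1) assms r_gt[OF assms(1,2)] by auto
qed

lemma peak_imp_F:
  assumes "1 \<le> i" "i < m" "1 \<le> j" "j < m" "X (r i) (r j)" "\<not> redX (r i) (r j)"
  shows "F i j"
proof -
  have pureC: "\<not> (p < i \<and> i < q) \<and> \<not> (p < j \<and> j < q)" if "redU p q" for p q
    using peak_no_red_around[OF assms(1,2,5) that] peak_no_red_around[OF assms(3,4) X_sym[OF assms(5)] that]
    by blast
  have mixedC: "(a \<le> i) = (j < b)" if red: "redX a b" for a b
  proof -
    have X: "X a b" using red redX_def by blast
    have "\<not> (a \<le> i \<and> b \<le> j)" using X_X[OF X assms(5)] r_gt assms by fastforce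
    moreover have "\<not> (i < a \<and> j < b)" using peak_unique[OF assms X] red assms(6) by blast
    ultimately show ?thesis by auto
  qed
  show ?thesis unfolding F_def using assms(1-4) pureC mixedC by simp
qed

text \<open>A mixed chord at \<open>r i\<close> comes from \<open>red_below\<close>; since it does not separate \<open>i\<close> from \<open>bar j\<close>, its barred
  end is at most \<open>j\<close>.\<close>

lemma F_below: assumes "F i j" shows "\<exists>b\<le>j. X (r i) b"
proof (cases "r i = m")
  case True
  then show ?thesis using X_edge assms unfolding F_def by auto
next
  case False
  have ij: "1 \<le> i" "i < m" using assms unfolding F_def by auto
  then have "r i < m" using False r_le[OF ij] by simp
  then consider q where "q \<le> i" "redU q (r i)" | b where "redX (r i) b"
    using red_below[OF U_r[OF ij]] by blast
  then show ?thesis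
  proof cases
    case 1
    have "\<not> redU i (r i)" using r_max unfolding redU_def by (meson leD)
    then have "q < i" using 1 le_neq_implies_less by blast
    then show ?thesis using assms 1(2) r_gt[OF ij] unfolding F_def by blast
  next
    case 2
    then have "\<not> j < b" using assms r_gt[OF ij] unfolding F_def by (meson leD)
    then show ?thesis using 2 unfolding redX_def by (meson not_le)
  qed
qed

text \<open>By \<open>F_below\<close> and symmetry the staircase runs through some \<open>(a, r j)\<close> with \<open>a \<le> i\<close> and some
  \<open>(r i, b)\<close> with \<open>b \<le> j\<close>. It has to pass through \<open>(r i, r j)\<close>: otherwise the highest \<open>(r i, b)\<close> with
  \<open>b < r j\<close> is entered by a step from some \<open>(k, b)\<close>, which is red and either separates \<open>i\<close> from \<open>bar j\<close> or
  crosses \<open>(i, r i)\<close>.\<close>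

lemma F_imp_peak: assumes "F i j" shows "X (r i) (r j) \<and> \<not> redX (r i) (r j)"
proof -
  have ij: "1 \<le> i" "i < m" "1 \<le> j" "j < m" using assms unfolding F_def by auto
  have Fred: "\<And>a b. redX a b \<Longrightarrow> (a \<le> i) = (j < b)" using assms unfolding F_def by blast
  let ?c = "r i" and ?e = "r j"
  have c: "i < ?c" "j < ?e" "?c \<le> m" "?e \<le> m" using r_gt r_le ij by auto
  obtain a where a: "a \<le> i" "X a ?e" using F_below[OF F_sym[OF assms]] X_sym by blast
  let ?B = "{b. X ?c b \<and> b \<le> ?e}"
  obtain b0 where "b0 \<le> j" "X ?c b0" using F_below[OF assms] by blast
  then have ne: "b0 \<in> ?B" using c by auto
  have fin: "finite ?B" by (rule finite_subset[of _ "{..?e}"]) auto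
  define b where "b = Max ?B"
  have b: "X ?c b" "b \<le> ?e" using Max_in[OF fin] ne unfolding b_def by blast+
  have bmax: "k \<le> b" if "X ?c k" "k \<le> ?e" for k using Max_ge[OF fin] that unfolding b_def by blast
  have "b = ?e"
  proof (rule ccontr)
    assume "b \<noteq> ?e"
    then have lt: "b < ?e" using b by simp
    then have "(?c, b) \<noteq> (1, m)" using c by auto
    then consider k where "k > b" "U b k" "X ?c k" | k where "k < ?c" "U k ?c" "X k b"
      using X_outer[OF b(1)] by blast
    then show False
    proof cases
      case 1
      then have "?e < k" using bmax[of k] by (meson leD not_le)
      then show False using X_X[OF a(2) 1(3)] a(1) c by auto
    next
      case 2
      then have "redX k b" using b(1) unfolding redX_def by blast
      then have "(k \<le> i) = (j < b)" by (rule Fred)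
      moreover have "\<not> j < b" using U_X'[OF U_r[OF ij(3,4)] b(1)] lt by blast
      ultimately show False using U_X[OF U_r[OF ij(1,2)] 2(3)] 2(1) by auto
    qed
  qed
  then show ?thesis using b Fred[of ?c ?e] c by auto
qed

lemma F_iff: "F i j \<longleftrightarrow> i \<in> {1..<m} \<and> j \<in> {1..<m} \<and> X (r i) (r j) \<and> \<not> redX (r i) (r j)"
proof
  assume F: "F i j"
  then show "i \<in> {1..<m} \<and> j \<in> {1..<m} \<and> X (r i) (r j) \<and> \<not> redX (r i) (r j)"
    using F_imp_peak[OF F] unfolding F_def by blast
qed (use peak_imp_F in simp)

definition matched :: "nat \<Rightarrow> bool" where "matched i \<longleftrightarrow> (\<exists>j. F i j)"

text \<open>If the staircase leaves \<open>(a, b)\<close> to the right, then its last chord in that row is an outer corner;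
  otherwise its first chord in that column is.\<close>

lemma X_matched: assumes "X a b" "2 \<le> a" "2 \<le> b" shows "matched (a - 1) \<or> matched (b - 1)"
proof -
  have bd: "a \<le> m" "b \<le> m" using X_bounds[OF assms(1)] by auto
  let ?A = "{k. X k b}" and ?B = "{k. X a k}"
  have "?A \<subseteq> {..m}" "?B \<subseteq> {..m}" by (auto dest: X_bounds)
  then have fin: "finite ?A" "finite ?B" by (meson finite_atMost finite_subset)+
  define a' where "a' = Max ?A"
  define b' where "b' = Max ?B"
  have A: "X a' b" "\<And>k. X k b \<Longrightarrow> k \<le> a'" using Max_in[OF fin(1)] Max_ge[OF fin(1)] assms(1)
    unfolding a'_def by blast+
  have B: "X a b'" "\<And>k. X a k \<Longrightarrow> k \<le> b'" using Max_in[OF fin(2)] Max_ge[OF fin(2)] assms(1)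
    unfolding b'_def by blast+
  have ge: "a \<le> a'" "b \<le> b'" using A B assms by auto
  have "\<not> redX a' b \<or> \<not> redX a b'"
  proof (rule ccontr)
    assume "\<not> ?thesis"
    then have 1: "redX a' b" and 2: "redX a b'" by blast+
    obtain k where k: "k > b" "X a' k" using 1 A(2) unfolding redX_def by (meson leD)
    obtain l where l: "l > a" "X l b'" using 2 B(2) unfolding redX_def by (meson leD)
    have "\<not> a < a'" using X_X[OF assms(1) k(2)] k(1) by blast
    moreover have "\<not> b < b'" using X_X[OF assms(1) l(2)] l(1) by blast
    ultimately have "a' = a" "b' = b" using ge by linarith+
    then show False using A(2)[of l] l by auto
  qed
  then show ?thesis
  proof
    assume "\<not> redX a' b"
    moreover have "r (a' - 1) = a'" "r (b - 1) = b" "a' \<le> m"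
      using r_X_pred[OF A(1)] r_X_pred[OF X_sym[OF assms(1)]] assms(2,3) ge X_bounds[OF A(1)] by auto
    ultimately have "F (a' - 1) (b - 1)"
      using peak_imp_F[of "a' - 1" "b - 1"] A(1) assms(2,3) ge bd by simp
    then have "F (b - 1) (a' - 1)" by (rule F_sym)
    then show ?thesis unfolding matched_def by blast
  next
    assume "\<not> redX a b'"
    moreover have "r (a - 1) = a" "r (b' - 1) = b'" "b' \<le> m"
      using r_X_pred[OF X_sym[OF B(1)]] r_X_pred[OF assms(1)] assms(2,3) ge X_bounds[OF B(1)] by auto
    ultimately have "F (a - 1) (b' - 1)"
      using peak_imp_F[of "a - 1" "b' - 1"] B(1) assms(2,3) ge bd by simp
    then show ?thesis unfolding matched_def by blast
  qed
qed

end

section \<open>The chords read off from half of a symmetric noncrossing partition\<close>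

text \<open>One half of a symmetric noncrossing partition. The last three assumptions say that two blocks do not
  cross, with four, three and two of the alternating elements unbarred; the other cases are the images of
  these under the half-turn.\<close>

locale half_noncrossing =
  fixes n :: nat and E F :: "nat \<Rightarrow> nat \<Rightarrow> bool"
  assumes E_bounds: "E i j \<Longrightarrow> i \<in> {1..n} \<and> j \<in> {1..n}"
    and E_refl: "i \<in> {1..n} \<Longrightarrow> E i i"
    and E_sym: "E i j \<Longrightarrow> E j i"
    and E_trans: "E i j \<Longrightarrow> E j k \<Longrightarrow> E i k"
    and F_bounds: "F i j \<Longrightarrow> i \<in> {1..n} \<and> j \<in> {1..n}"
    and F_sym: "F i j \<Longrightarrow> F j i"
    and E_F: "E i k \<Longrightarrow> F k j \<Longrightarrow> F i j"
    and F_F: "F i j \<Longrightarrow> F k j \<Longrightarrow> E i k"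
    and EE_nc: "E i k \<Longrightarrow> E j l \<Longrightarrow> i < j \<Longrightarrow> j < k \<Longrightarrow> k < l \<Longrightarrow> E i j"
    and EF_nc: "E i k \<Longrightarrow> F j l \<Longrightarrow> i < j \<Longrightarrow> j < k \<Longrightarrow> E i j"
    and FF_nc: "F i j \<Longrightarrow> F k l \<Longrightarrow> i < k \<Longrightarrow> j < l \<Longrightarrow> E i k"
begin

text \<open>This is the value \<open>r i\<close> of the triangulation to be found.\<close>

definition top :: "nat \<Rightarrow> nat" where "top i = Suc (Max {j. E i j})"

text \<open>\<open>c\<close> is a breakpoint if no block has unbarred elements on both sides of the gap before \<open>c\<close>. Exactly these
  labels will be ends of mixed chords.\<close>

definition breakpoint :: "nat \<Rightarrow> bool" where
  "breakpoint c \<longleftrightarrow> c \<in> {1..Suc n} \<and> (\<forall>i j. E i j \<longrightarrow> i < c \<longrightarrow> j < c)"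

definition matched :: "nat \<Rightarrow> bool" where "matched i \<longleftrightarrow> (\<exists>j. F i j)"

text \<open>A chord \<open>(i, j)\<close> must not cross the chords \<open>(x, top x)\<close>. For \<open>i < x < j\<close> this is the last condition, and
  \<open>j \<le> top i\<close> says that \<open>top i\<close> is the largest neighbour of \<open>i\<close>.\<close>

definition chordU :: "nat \<Rightarrow> nat \<Rightarrow> bool" where
  "chordU i j \<longleftrightarrow> 1 \<le> i \<and> i < j \<and> j \<le> Suc n \<and> j \<le> top i \<and> (\<forall>x. i < x \<longrightarrow> x < j \<longrightarrow> top x \<le> j)"

text \<open>The outer corners of the staircase are the \<open>(top i, top j)\<close> with \<open>F i j\<close>. A mixed chord \<open>(a, b)\<close> must not
  lie strictly below one of them, which is the condition \<open>i < a \<or> j < b\<close>, nor weakly above one of them without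
  being equal to it, which is the next condition. Only the path between two outer corners remains to be fixed. There \<open>b\<close> decreases
  first, while \<open>a - 1\<close> is the last matched label, and then \<open>a\<close> increases, when \<open>b - 1\<close> is matched.\<close>

definition chordX :: "nat \<Rightarrow> nat \<Rightarrow> bool" where
  "chordX a b \<longleftrightarrow> breakpoint a \<and> breakpoint b \<and>
     (\<forall>i j. F i j \<longrightarrow> i < a \<or> j < b) \<and>
     (\<forall>i j. F i j \<longrightarrow> i < a \<longrightarrow> j < b \<longrightarrow> a = top i \<and> b = top j) \<and>
     (a = 1 \<or> b = 1 \<or> matched (a - 1) \<or> matched (b - 1))"

lemma chordX_I:
  assumes "breakpoint a" "breakpoint b"
    and "\<And>i j. F i j \<Longrightarrow> a \<le> i \<Longrightarrow> b \<le> j \<Longrightarrow> False"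
    and "\<And>i j. F i j \<Longrightarrow> i < a \<Longrightarrow> j < b \<Longrightarrow> a = top i \<and> b = top j"
    and "a = 1 \<or> b = 1 \<or> matched (a - 1) \<or> matched (b - 1)"
  shows "chordX a b"
  unfolding chordX_def using assms by (meson not_le)

lemma finite_E: "finite {j. E i j}"
  by (rule finite_subset[of _ "{1..n}"]) (use E_bounds in auto)

lemma E_top: assumes "i \<in> {1..n}" shows "E i (top i - 1)"
  using Max_in[OF finite_E[of i]] E_refl[OF assms] unfolding top_def by auto

lemma top_ge: "E i j \<Longrightarrow> j < top i"
  unfolding top_def using finite_E by (simp add: less_Suc_eq_le)

lemma top_bounds: "i \<in> {1..n} \<Longrightarrow> i < top i \<and> top i \<le> Suc n"
  using top_ge[OF E_refl, of i] E_bounds[OF E_top, of i] by (simp add: le_diff_conv)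

lemma top_eq: assumes "E i j" shows "top i = top j"
proof -
  have "{k. E i k} = {k. E j k}" using assms E_sym E_trans by blast
  then show ?thesis unfolding top_def by simp
qed

lemma E_iff_top: "E i j \<longleftrightarrow> i \<in> {1..n} \<and> j \<in> {1..n} \<and> top i = top j"
  by (metis E_bounds E_sym E_top E_trans top_eq)

lemma top_noncrossing:
  assumes "i \<in> {1..n}" "i < x" "x < top i" shows "top x \<le> top i"
proof (rule ccontr)
  assume gt: "\<not> ?thesis"
  have x: "x \<in> {1..n}" using assms top_bounds by fastforce
  have Ei: "E i (top i - 1)" and Ex: "E x (top x - 1)" using E_top assms x by auto
  have "E i x"
  proof (cases "x = top i - 1")
    case True then show ?thesis using Ei by simp
  next
    case False
    then show ?thesis using EE_nc[OF Ei Ex] assms gt by auto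
  qed
  then show False using gt top_eq by fastforce
qed

lemma chordU_top: "i \<in> {1..n} \<Longrightarrow> chordU i (top i)"
  unfolding chordU_def using top_bounds top_noncrossing by auto

lemma top_is_Max_chordU: assumes "i \<in> {1..n}" shows "top i = Max {j. chordU i j}"
proof -
  have "finite {j. chordU i j}" by (rule finite_subset[of _ "{..Suc n}"]) (auto simp: chordU_def)
  then have "Max {j. chordU i j} = top i"
    by (rule Max_eqI) (use chordU_top[OF assms] in \<open>auto simp: chordU_def\<close>)
  then show ?thesis by simp
qed

lemma chordX_bounds: "chordX a b \<Longrightarrow> a \<in> {1..Suc n} \<and> b \<in> {1..Suc n}"
  unfolding chordX_def breakpoint_def by blast

lemma chordX_D: assumes "chordX a b" "F i j"
  shows "a \<le> i \<Longrightarrow> b \<le> j \<Longrightarrow> False" "i < a \<Longrightarrow> j < b \<Longrightarrow> a = top i \<and> b = top j"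
proof -
  have "i < a \<or> j < b" using assms unfolding chordX_def by blast
  then show "a \<le> i \<Longrightarrow> b \<le> j \<Longrightarrow> False" by linarith
  have "\<forall>i j. F i j \<longrightarrow> i < a \<longrightarrow> j < b \<longrightarrow> a = top i \<and> b = top j"
    using assms(1) unfolding chordX_def by (elim conjE)
  then show "i < a \<Longrightarrow> j < b \<Longrightarrow> a = top i \<and> b = top j" using assms(2) by simp
qed

lemma chordX_sym: assumes chordX: "chordX a b" shows "chordX b a"
proof (rule chordX_I)
  show "breakpoint b" "breakpoint a" using chordX unfolding chordX_def by blast+
  show False if "F i j" "b \<le> i" "a \<le> j" for i j using chordX_D(1)[OF chordX F_sym[OF that(1)]] that by simp
  show "b = top i \<and> a = top j" if "F i j" "i < b" "j < a" for i j
    using chordX_D(2)[OF chordX F_sym[OF that(1)]] that by simp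
  show "b = 1 \<or> a = 1 \<or> matched (b - 1) \<or> matched (a - 1)" using chordX unfolding chordX_def by blast
qed

lemma chordU_edge: "i \<in> {1..n} \<Longrightarrow> chordU i (Suc i)"
  unfolding chordU_def using top_bounds[of i] by auto

lemma chordX_edge: "chordX 1 (Suc n)"
proof -
  have "breakpoint 1" "breakpoint (Suc n)" unfolding breakpoint_def using E_bounds by fastforce+
  then show ?thesis by (rule chordX_I) (auto dest: F_bounds)
qed

lemma chordU_U: "chordU i j \<Longrightarrow> chordU k l \<Longrightarrow> i < k \<Longrightarrow> k < j \<Longrightarrow> l \<le> j"
  unfolding chordU_def by (meson le_trans)

lemma chordU_X: assumes "chordU i j" "chordX a b" "i < a" shows "j \<le> a"
proof (rule ccontr)
  assume "\<not> j \<le> a"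
  then have "a \<le> top i - 1" using assms unfolding chordU_def by auto
  moreover have "i \<in> {1..n}" using assms chordX_bounds[OF assms(2)] unfolding chordU_def by auto
  then have "E i (top i - 1)" using E_top by blast
  ultimately show False using assms(2,3) unfolding chordX_def breakpoint_def by (meson leD)
qed

lemma chordX_peak: assumes "chordX a b" "F i j" "i < a" "j < b"
  shows "F (a - 1) (b - 1)"
proof -
  have e: "a = top i" "b = top j" using chordX_D(2)[OF assms] by auto
  have ij: "i \<in> {1..n}" "j \<in> {1..n}" using F_bounds assms(2) by auto
  show ?thesis using E_F[OF E_sym[OF E_top[OF ij(1)]] F_sym[OF E_F[OF E_sym[OF E_top[OF ij(2)]] F_sym[OF assms(2)]]]] e
    by simp
qed

text \<open>Either the pair \<open>(c - 1, j)\<close> or the outer corner \<open>(c, d)\<close> shows that \<open>(a, b)\<close> is too low.\<close>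

lemma chordX_X_aux: assumes "chordX a b" "chordX c d" "a < c" "b < d" "F (c - 1) j" shows False
proof (cases "j < d")
  case True
  have "c - 1 < c" using assms by simp
  then have "F (c - 1) (d - 1)" using chordX_peak[OF assms(2,5)] True by simp
  then show False using chordX_D(1)[OF assms(1)] assms(3,4) by (metis Suc_pred' less_Suc_eq_le not_less_zero zero_less_iff_neq_zero)
next
  case False
  moreover have "a \<le> c - 1" using assms(3) by simp
  ultimately show False using chordX_D(1)[OF assms(1,5)] assms(4) by simp
qed

lemma chordX_X: assumes "chordX a b" "chordX c d" "a < c" shows "d \<le> b"
proof (rule ccontr)
  assume "\<not> d \<le> b"
  then have lt: "b < d" by simp
  have "matched (c - 1) \<or> matched (d - 1)"
    using assms(2,3) lt chordX_bounds[OF assms(1)] unfolding chordX_def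
    by (metis atLeastAtMost_iff leD)
  then show False
    using chordX_X_aux[OF assms(1,2,3) lt] chordX_X_aux[OF chordX_sym[OF assms(1)] chordX_sym[OF assms(2)] lt assms(3)]
    unfolding matched_def by blast
qed

text \<open>The inner triangle of \<open>(i, j)\<close> has as its third corner the least \<open>k\<close> between \<open>i\<close> and \<open>j\<close> with
  \<open>top k = j\<close>.\<close>

lemma chordU_inner: assumes "chordU i j" "Suc i < j" shows "\<exists>k. i < k \<and> k < j \<and> chordU i k \<and> chordU k j"
proof -
  let ?P = "\<lambda>x. i < x \<and> x < j \<and> top x = j"
  have bd: "1 \<le> i" "j \<le> Suc n" "j \<le> top i" "\<And>x. i < x \<Longrightarrow> x < j \<Longrightarrow> top x \<le> j" using assms unfolding chordU_def by auto
  have "j - 1 \<in> {1..n}" using bd assms by auto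
  then have "top (j - 1) = j" using bd(4)[of "j - 1"] top_bounds[of "j - 1"] assms by (simp; linarith)
  then have ex: "?P (j - 1)" using assms by simp
  define k where "k = (LEAST x. ?P x)"
  have k: "i < k" "k < j" "top k = j" using LeastI[of ?P, OF ex] unfolding k_def by auto
  have kmin: "\<And>x. ?P x \<Longrightarrow> k \<le> x" unfolding k_def by (rule Least_le)
  have "chordU k j" unfolding chordU_def using k bd by auto
  moreover have "top x \<le> k" if x: "i < x" "x < k" for x
  proof (rule ccontr)
    assume gt: "\<not> top x \<le> k"
    have xn: "x \<in> {1..n}" using x k bd by auto
    have "top k \<le> top x" using top_noncrossing[OF xn x(2)] gt by simp
    then have "top x = j" using k bd(4)[of x] x by auto
    then show False using kmin[of x] x k by auto
  qed
  then have "chordU i k" unfolding chordU_def using k bd by auto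
  ultimately show ?thesis using k by blast
qed

lemma breakpoint_top: assumes "breakpoint a" "a \<le> n" shows "breakpoint (top a)"
proof -
  have a: "a \<in> {1..n}" using assms unfolding breakpoint_def by auto
  have "j < top a" if "E i j" "i < top a" for i j
  proof (cases "i < a")
    case True then show ?thesis using assms that top_bounds[OF a] unfolding breakpoint_def by fastforce
  next
    case False
    then have "top i \<le> top a" using top_noncrossing[OF a, of i] that by (cases "i = a") auto
    then show ?thesis using top_ge[OF that(1)] by simp
  qed
  then show ?thesis using top_bounds[OF a] unfolding breakpoint_def by auto
qed

text \<open>For a breakpoint \<open>b\<close> this is the least label of the outermost block ending at \<open>b - 1\<close>, hence the preceding
  breakpoint, where the staircase arrives when it steps down from \<open>b\<close>.\<close>

definition bot :: "nat \<Rightarrow> nat" where "bot b = (LEAST x. 1 \<le> x \<and> top x = b)"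

lemma bot: assumes "breakpoint b" "2 \<le> b"
  shows "1 \<le> bot b" "bot b < b" "top (bot b) = b" "\<And>x. 1 \<le> x \<Longrightarrow> top x = b \<Longrightarrow> bot b \<le> x"
    "breakpoint (bot b)" "chordU (bot b) b"
proof -
  let ?P = "\<lambda>x. 1 \<le> x \<and> top x = b"
  have b1: "b - 1 \<in> {1..n}" using assms unfolding breakpoint_def by auto
  have "E (b - 1) (top (b - 1) - 1)" using E_top[OF b1] .
  then have "top (b - 1) \<le> b" using assms unfolding breakpoint_def by fastforce
  then have "?P (b - 1)" using top_bounds[OF b1] assms by (simp; linarith)
  then have P: "?P (bot b)" and le: "bot b \<le> b - 1" unfolding bot_def using LeastI[of ?P] Least_le[of ?P] by blast+
  show 1: "1 \<le> bot b" and 2: "bot b < b" and 3: "top (bot b) = b" using P le assms by auto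
  show min: "bot b \<le> x" if "1 \<le> x" "top x = b" for x unfolding bot_def using Least_le[of ?P x] that by simp
  have bn: "bot b \<in> {1..n}" using 1 le b1 by auto
  show "chordU (bot b) b" using chordU_top[OF bn] 3 by simp
  have "j < bot b" if "E i j" "i < bot b" for i j
  proof (rule ccontr)
    assume nj: "\<not> j < bot b"
    have i: "i \<in> {1..n}" and "j < top i" using E_bounds[OF that(1)] top_ge[OF that(1)] by auto
    then have "b \<le> top i" using top_noncrossing[OF i that(2)] nj 3 by simp
    moreover have "top i - 1 < b" using E_top[OF i] assms(1) that(2) 2 unfolding breakpoint_def by (meson less_trans)
    ultimately have "top i = b" by simp
    then show False using min[of i] i that(2) by simp
  qed
  then show "breakpoint (bot b)" using bn unfolding breakpoint_def by auto
qed

text \<open>A block joined to a barred element cannot be nested inside another block of unbarred labels, since the two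
  would cross.\<close>

lemma F_endpoint: assumes "F k j" "E i l" "i \<le> k" "k \<le> l" shows "F i j \<and> F l j"
proof -
  have "E i k"
    using EF_nc[OF assms(2,1)] assms E_refl[of i] E_bounds[OF assms(2)] by (cases "i = k"; cases "k = l") auto
  then show ?thesis using E_F assms E_sym E_trans by blast
qed

text \<open>The staircase may step down from \<open>(a, b)\<close> if the labels from \<open>bot b\<close> to \<open>b - 1\<close> are not matched with a label
  at or beyond \<open>a\<close>: such a match would give an outer corner that the step misses.\<close>

lemma chordX_step_down:
  assumes chordX: "chordX a b" and b: "2 \<le> b"
    and side: "a = 1 \<or> matched (a - 1)"
    and free: "\<And>i. F i (b - 1) \<Longrightarrow> i < a"
  shows "chordX a (bot b)"
proof -
  have br: "breakpoint a" "breakpoint b" using chordX unfolding chordX_def by auto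
  note bt = bot[OF br(2) b]
  show ?thesis
  proof (rule chordX_I)
    fix i j assume F: "F i j" and h: "a \<le> i" "bot b \<le> j"
    have "bot b \<in> {1..n}" using bt(1,2) br(2) unfolding breakpoint_def by auto
    then have Eb: "E (bot b) (b - 1)" using E_top[of "bot b"] bt(3) by simp
    have "j \<le> b - 1" using chordX_D(1)[OF chordX F] h b by (cases "b \<le> j") auto
    then have "F (b - 1) i" using F_endpoint[OF F_sym[OF F] Eb] h by blast
    then show False using free[OF F_sym] h by (meson leD)
  next
    fix i j assume F: "F i j" and h: "i < a" "j < bot b"
    then have "b = top j" using chordX_D(2)[OF chordX F] bt(2) by auto
    then have "bot b \<le> j" using bt(4)[of j] F_bounds[OF F] by auto
    then show "a = top i \<and> bot b = top j" using h by auto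
  qed (use br bt(5) side in blast)+
qed

text \<open>The next step decreases \<open>b\<close> to \<open>bot b\<close>, unless \<open>b = 1\<close> or \<open>b - 1\<close> is matched with a label from \<open>a\<close> on. In these
  cases there is an outer corner ahead in the same row, or nothing below, and the step increases \<open>a\<close> to
  \<open>top a\<close>.\<close>

lemma chordX_inner: assumes chordX: "chordX a b" and ne: "(a, b) \<noteq> (Suc n, 1)"
  shows "(\<exists>k>a. chordU a k \<and> chordX k b) \<or> (\<exists>k<b. chordU k b \<and> chordX a k)"
proof -
  have br: "breakpoint a" "breakpoint b" and third: "a = 1 \<or> b = 1 \<or> matched (a - 1) \<or> matched (b - 1)"
    using chordX unfolding chordX_def by auto
  have bd: "1 \<le> a" "a \<le> Suc n" "1 \<le> b" "b \<le> Suc n" using chordX_bounds[OF chordX] by auto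
  show ?thesis
  proof (cases "b = 1")
    case True
    then have an: "a \<in> {1..n}" using ne bd by auto
    have "chordX (top a) b"
    proof (rule chordX_I)
      show "breakpoint (top a)" using breakpoint_top[OF br(1)] an by simp
      show False if "F i j" "top a \<le> i" "b \<le> j" for i j
        using chordX_D(1)[OF chordX that(1)] that top_bounds[OF an] by simp
      show "top a = top i \<and> b = top j" if "F i j" "j < b" for i j using F_bounds[OF that(1)] that(2) True by simp
    qed (use br(2) True in auto)
    then show ?thesis using chordU_top[OF an] top_bounds[OF an] by blast
  next
    case False
    then have b2: "2 \<le> b" using bd by auto
    have bm: "b - 1 < b" using b2 by simp
    show ?thesis
    proof (cases "\<exists>i\<ge>a. F i (b - 1)")
      case False
      have free: "i < a" if "F i (b - 1)" for i using False that by (meson not_le)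
      have "a = 1 \<or> matched (a - 1)"
      proof (cases "matched (b - 1)")
        case True
        then obtain k where k: "F k (b - 1)" unfolding matched_def using F_sym by blast
        then have "F (a - 1) (b - 1)" using chordX_peak[OF chordX k free[OF k] bm] by simp
        then show ?thesis unfolding matched_def by blast
      qed (use third \<open>b \<noteq> 1\<close> in blast)
      then have "chordX a (bot b)" using chordX_step_down[OF chordX b2] free by blast
      then show ?thesis using bot[OF br(2) b2] by blast
    next
      case True
      then obtain k where k: "a \<le> k" "F k (b - 1)" by blast
      then have an: "a \<in> {1..n}" using F_bounds[OF k(2)] bd by auto
      have "chordX (top a) b"
      proof (rule chordX_I)
        fix i j assume F: "F i j" and "top a \<le> i" "b \<le> j"
        then show False using chordX_D(1)[OF chordX F] top_bounds[OF an] by auto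
      next
        fix i j assume F: "F i j" and h: "i < top a" "j < b"
        have ai: "a \<le> i"
        proof (rule ccontr)
          assume "\<not> a \<le> i"
          then have "F (a - 1) (b - 1)" using chordX_peak[OF chordX F] h by simp
          then have "E (a - 1) k" using F_F k(2) by blast
          moreover have "a - 1 < a" using bd by simp
          ultimately show False using br(1) k(1) unfolding breakpoint_def by (meson leD)
        qed
        have Fa: "F a j" using F_endpoint[OF F E_top[OF an] ai] h by simp
        have "E a i" using F_F[OF Fa F] .
        then have 1: "top a = top i" by (rule top_eq)
        have Ej: "E j (b - 1)"
        proof (cases "k = a \<or> j = b - 1")
          case True
          then show ?thesis
            using F_F[OF F_sym[OF Fa] F_sym[of a "b - 1"]] k(2) E_refl[of j] F_bounds[OF F] by auto
        next
          case False
          then have "a < k" "j < b - 1" using h(2) k(1) by linarith+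
          then have "E a k" using FF_nc[OF Fa k(2)] by simp
          then have "F a (b - 1)" using E_F k(2) by blast
          then show ?thesis using F_F[OF F_sym[OF Fa] F_sym] by blast
        qed
        have "j \<in> {1..n}" using F_bounds[OF F] by simp
        have "top j = top (b - 1)" using top_eq[OF Ej] .
        moreover have "top (b - 1) = b"
        proof -
          have b1: "b - 1 \<in> {1..n}" using E_bounds[OF Ej] by simp
          have "top (b - 1) - 1 < b" using E_top[OF b1] br(2) bm unfolding breakpoint_def by blast
          then show ?thesis using top_bounds[OF b1] by linarith
        qed
        ultimately show "top a = top i \<and> b = top j" using 1 by simp
      next
        have "matched (b - 1)" using k(2) F_sym unfolding matched_def by blast
        then show "top a = 1 \<or> b = 1 \<or> matched (top a - 1) \<or> matched (b - 1)" by blast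
      qed (use breakpoint_top[OF br(1)] br(2) an in auto)
      then show ?thesis using chordU_top[OF an] top_bounds[OF an] by blast
    qed
  qed
qed

text \<open>By \<open>F_endpoint\<close> the blocks of matched labels are outermost, so \<open>top i\<close> and \<open>top j\<close> are breakpoints; the
  remaining conditions hold because matched pairs do not cross.\<close>

lemma chordX_of_F: assumes F: "F i j" shows "chordX (top i) (top j)"
proof -
  have ij: "i \<in> {1..n}" "j \<in> {1..n}" using F_bounds[OF F] by auto
  have aux: "breakpoint (top i)" if F: "F i j" for i j
  proof -
    have i: "i \<in> {1..n}" using F_bounds[OF F] by auto
    have "q < top i" if E: "E p q" and lt: "p < top i" for p q
    proof (rule ccontr)
      assume nq: "\<not> q < top i"
      have "i \<le> top i - 1" using top_bounds[OF i] by linarith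
      then have "E p q \<and> F (top i - 1) j" using E F_endpoint[OF F E_top[OF i]] by simp
      then have "E p (top i - 1)"
        using EF_nc[OF E, of "top i - 1" j] E_refl[of p] E_bounds[OF E] lt nq
        by (cases "p = top i - 1") auto
      then have "E i q" using E_top[OF i] E E_sym E_trans by blast
      then show False using top_ge nq by blast
    qed
    then show ?thesis using top_bounds[OF i] unfolding breakpoint_def by auto
  qed
  show ?thesis
  proof (rule chordX_I)
    show "breakpoint (top i)" "breakpoint (top j)" using aux[OF F] aux[OF F_sym[OF F]] .
  next
    fix k l assume F': "F k l" and h: "top i \<le> k" "top j \<le> l"
    then have "E i k" using FF_nc[OF F F'] top_bounds ij by (meson order_less_le_trans)
    then show False using top_ge h(1) by (meson leD)
  next
    fix k l assume F': "F k l" and h: "k < top i" "l < top j"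
    have kl: "k \<in> {1..n}" "l \<in> {1..n}" using F_bounds[OF F'] by auto
    have "top k - 1 < top i" "top l - 1 < top j"
      using aux[OF F] aux[OF F_sym[OF F]] E_top[OF kl(1)] E_top[OF kl(2)] h unfolding breakpoint_def by blast+
    then have le: "top k \<le> top i" "top l \<le> top j" by linarith+
    have lst: "F (top i - 1) (top j - 1)" if "F i j" for i j
      using E_F[OF E_sym[OF E_top]] F_sym F_bounds[OF that] that by metis
    note l1 = lst[OF F] and l2 = lst[OF F']
    show "top i = top k \<and> top j = top l"
    proof (cases "top i = top k \<or> top j = top l")
      case True
      then have "E i k \<or> E j l" using E_iff_top ij F_bounds[OF F'] by blast
      then have "E i k \<and> E j l" using F F' E_F F_F F_sym E_sym by meson
      then show ?thesis using top_eq by blast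
    next
      case False
      then have "top k < top i" "top l < top j" using le le_neq_implies_less by metis+
      moreover have "1 \<le> top k" "1 \<le> top l" using top_bounds[OF kl(1)] top_bounds[OF kl(2)] by auto
      ultimately have "top k - 1 < top i - 1" "top l - 1 < top j - 1" by linarith+
      then have "E (top k - 1) (top i - 1)" by (rule FF_nc[OF l2 l1])
      then have "E k i" using E_trans[OF E_trans[OF E_top[OF kl(1)]] E_sym[OF E_top[OF ij(1)]]] by blast
      then show ?thesis using False top_eq by metis
    qed
  next
    have "i \<le> top i - 1" using top_bounds[OF ij(1)] by linarith
    then have "F (top i - 1) j" using F_endpoint[OF F E_top[OF ij(1)]] by simp
    then show "top i = 1 \<or> top j = 1 \<or> matched (top i - 1) \<or> matched (top j - 1)"
      unfolding matched_def by blast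
  qed
qed

text \<open>Matched pairs are recovered from the staircase as its outer corners. If \<open>(top i, top j)\<close> is one, then by
  \<open>chordX_inner\<close> there are a chord \<open>(a', top j)\<close> with smaller \<open>a'\<close> and a chord \<open>(top i, b')\<close> with smaller \<open>b'\<close>.
  One of \<open>top i - 1\<close>, \<open>top j - 1\<close> is matched, and the two chords leave only the other one as its partner.\<close>

lemma F_iff: "F i j \<longleftrightarrow> i \<in> {1..n} \<and> j \<in> {1..n} \<and> chordX (top i) (top j) \<and>
    (\<forall>k>top i. \<not> chordX k (top j)) \<and> (\<forall>k>top j. \<not> chordX (top i) k)"
proof (intro iffI)
  assume F: "F i j"
  have ij: "i \<in> {1..n}" "j \<in> {1..n}" using F_bounds[OF F] by auto
  have "\<not> chordX k (top j)" if "k > top i" for k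
    using chordX_D(2)[OF _ F, of k "top j"] that top_bounds[OF ij(1)] top_bounds[OF ij(2)] by auto
  moreover have "\<not> chordX (top i) k" if "k > top j" for k
    using chordX_D(2)[OF _ F, of "top i" k] that top_bounds[OF ij(1)] top_bounds[OF ij(2)] by auto
  ultimately show "i \<in> {1..n} \<and> j \<in> {1..n} \<and> chordX (top i) (top j) \<and>
    (\<forall>k>top i. \<not> chordX k (top j)) \<and> (\<forall>k>top j. \<not> chordX (top i) k)" using ij chordX_of_F[OF F] by blast
next
  let ?a = "top i" and ?b = "top j"
  assume h: "i \<in> {1..n} \<and> j \<in> {1..n} \<and> chordX ?a ?b \<and> (\<forall>k>?a. \<not> chordX k ?b) \<and> (\<forall>k>?b. \<not> chordX ?a k)"
  then have chordX: "chordX ?a ?b" by blast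
  have gt: "i < ?a" "j < ?b" using h top_bounds by auto
  have "1 < ?a" "1 < ?b" using h gt by auto
  then have "(?a, ?b) \<noteq> (Suc n, 1)" "(?b, ?a) \<noteq> (Suc n, 1)" by auto
  then obtain b' a' where b': "b' < ?b" "chordX ?a b'" and a': "a' < ?a" "chordX a' ?b"
    using chordX_inner[OF chordX] chordX_inner[OF chordX_sym[OF chordX]] h chordX_sym by blast
  have key: "F (?a - 1) (?b - 1)" if "F (?a - 1) l" for l
  proof (cases "l < ?b")
    case True
    then show ?thesis using chordX_peak[OF chordX that] \<open>1 < ?a\<close> by simp
  next
    case False
    moreover have "a' \<le> ?a - 1" using a'(1) by linarith
    ultimately show ?thesis using chordX_D(1)[OF a'(2) that] by auto
  qed
  have key': "F (?a - 1) (?b - 1)" if "F l (?b - 1)" for l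
  proof (cases "l < ?a")
    case True
    then show ?thesis using chordX_peak[OF chordX that] \<open>1 < ?b\<close> by simp
  next
    case False
    moreover have "b' \<le> ?b - 1" using b'(1) by linarith
    ultimately show ?thesis using chordX_D(1)[OF b'(2) that] by auto
  qed
  have "matched (?a - 1) \<or> matched (?b - 1)" using chordX \<open>1 < ?a\<close> \<open>1 < ?b\<close> unfolding chordX_def by auto
  then have "F (?a - 1) (?b - 1)" using key key' F_sym unfolding matched_def by blast
  then show "F i j" using E_F[OF E_top] F_sym h by blast
qed

end

text \<open>\<open>top\<close> is read off from the pure chords, \<open>E\<close> from \<open>top\<close>, and \<open>F\<close> from \<open>top\<close> and the mixed chords.\<close>

lemma half_noncrossing_eqI:
  assumes "half_noncrossing n E F" "half_noncrossing n E' F'"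
    and chordU: "\<And>i j. half_noncrossing.chordU n E i j = half_noncrossing.chordU n E' i j" and chordX: "\<And>a b. half_noncrossing.chordX n E F a b = half_noncrossing.chordX n E' F' a b"
  shows "E = E' \<and> F = F'"
proof -
  interpret A: half_noncrossing n E F by fact
  interpret B: half_noncrossing n E' F' by fact
  have top: "A.top i = B.top i" if "i \<in> {1..n}" for i
    using A.top_is_Max_chordU[OF that] B.top_is_Max_chordU[OF that] chordU by simp
  have E: "E i j = E' i j" for i j unfolding A.E_iff_top[of i j] B.E_iff_top[of i j] using top by auto
  have F: "F i j = F' i j" for i j unfolding A.F_iff[of i j] B.F_iff[of i j] using top chordX by auto
  show ?thesis by (intro conjI ext E F)
qed

section \<open>A triangulation lies in the chord set of its partition\<close>

context half_triangulation
begin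

lemma r_noncrossing_eq: assumes "E i k" "E j l" "i < j" "j < k" "k < l" shows "E i j"
proof -
  have bd: "1 \<le> i" "i < m" "1 \<le> j" "j < m" "1 \<le> k" "k < m" "1 \<le> l" "l < m" and eq: "r i = r k" "r j = r l"
    using assms(1,2) unfolding E_iff by auto
  have gt: "k < r i" "l < r j" using r_gt bd eq by metis+
  have "r j \<le> r i" using r_noncrossing[OF bd(1,2) assms(3)] assms(4) gt(1) by simp
  moreover have "r i \<le> r j" using r_noncrossing[OF bd(3,4) assms(4)] assms(5) gt(2) eq by simp
  ultimately show ?thesis unfolding E_iff using bd by auto
qed

lemma F_D: assumes "F i j"
  shows "1 \<le> i" "i < m" "1 \<le> j" "j < m" "X (r i) (r j)" "\<not> redX (r i) (r j)"
  using assms unfolding F_iff by auto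

sublocale nc: half_noncrossing "m - 1" E F
proof
  show "i \<in> {1..m - 1} \<and> j \<in> {1..m - 1}" if "E i j" for i j using that unfolding E_iff by auto
  show "E i i" if "i \<in> {1..m - 1}" for i using that m_ge unfolding E_iff by auto
  show "E j i" if "E i j" for i j using E_sym that .
  show "E i k" if "E i j" "E j k" for i j k using that unfolding E_iff by auto
  show "i \<in> {1..m - 1} \<and> j \<in> {1..m - 1}" if "F i j" for i j using F_D[OF that] by auto
  show "F j i" if "F i j" for i j using F_sym that .
  show "F i j" if "E i k" "F k j" for i j k using that unfolding E_iff F_iff by auto
  show "E i k" if F: "F i j" "F k j" for i j k
  proof -
    have "\<not> r i < r k" "\<not> r k < r i"
      using same_row_red[OF F_D(5)[OF F(1)] F_D(5)[OF F(2)]] same_row_red[OF F_D(5)[OF F(2)] F_D(5)[OF F(1)]]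
        F_D(6)[OF F(1)] F_D(6)[OF F(2)] by blast+
    then show ?thesis using F_D[OF F(1)] F_D[OF F(2)] unfolding E_iff by auto
  qed
  show "E i j" if "E i k" "E j l" "i < j" "j < k" "k < l" for i j k l using r_noncrossing_eq that .
  show "E i j" if E: "E i k" and F: "F j l" and lt: "i < j" "j < k" for i j k l
  proof -
    have bd: "1 \<le> i" "i < m" "1 \<le> k" "k < m" and eq: "r i = r k" using E unfolding E_iff by auto
    have "j < r i" using r_gt[OF bd(3,4)] eq lt by simp
    then have "r j \<le> r i" using r_noncrossing[OF bd(1,2) lt(1)] by simp
    moreover have "\<not> r j < r i"
      using U_X[OF U_r[OF bd(1,2)] F_D(5)[OF F]] r_gt[OF F_D(1,2)[OF F]] lt by auto
    ultimately show ?thesis using bd F_D[OF F] unfolding E_iff by auto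
  qed
  show "E i k" if F: "F i j" "F k l" and lt: "i < k" "j < l" for i j k l
  proof -
    note D1 = F_D[OF F(1)] and D2 = F_D[OF F(2)]
    have "\<not> r i < r k"
    proof
      assume less: "r i < r k"
      have "r l \<le> r j" using X_X[OF D1(5) D2(5) less] by (meson not_le)
      moreover have "\<not> r l < r j"
        using U_X'[OF U_r[OF D1(3,4)] D2(5)] r_gt[OF D2(3,4)] lt(2) by auto
      ultimately have "r j = r l" by simp
      then show False using same_row_red[OF D1(5), of "r k"] D2(5) D1(6) less by simp
    qed
    moreover have "\<not> r k < r i" using U_X[OF U_r[OF D1(1,2)] D2(5)] r_gt[OF D2(1,2)] lt(1) by auto
    ultimately have "r i = r k" by simp
    then show ?thesis unfolding E_iff using D1 D2 by simp
  qed
qed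

lemma top_eq_r: assumes "1 \<le> i" "i < m" shows "nc.top i = r i"
proof -
  have lt: "j < r i" if "E i j" for j
  proof -
    have "1 \<le> j" "j < m" "r i = r j" using that unfolding E_iff by auto
    then show ?thesis using r_gt by simp
  qed
  have "E i (r i - 1)" unfolding E_iff using assms r_pred r_gt[OF assms] r_le[OF assms] by auto
  moreover have "finite {j. E i j}" by (rule nc.finite_E)
  ultimately have "Max {j. E i j} = r i - 1" using lt by (intro Max_eqI) fastforce+
  then show ?thesis unfolding nc.top_def using r_gt[OF assms] by simp
qed

lemma U_imp_chordU: assumes "U i j" shows "nc.chordU i j"
proof -
  have bd: "1 \<le> i" "i < j" "j \<le> m" using U_bounds[OF assms] by auto
  have "nc.top x \<le> j" if "i < x" "x < j" for x
  proof -
    have "U x (r x)" using U_r that bd by simp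
    then have "r x \<le> j" using U_U[OF assms _ that] by blast
    then show ?thesis using top_eq_r[of x] that bd by simp
  qed
  moreover have "j \<le> nc.top i" using r_max[OF assms] top_eq_r bd by simp
  ultimately show ?thesis unfolding nc.chordU_def using bd m_ge by auto
qed

lemma X_imp_chordX: assumes X: "X a b" shows "nc.chordX a b"
proof (rule nc.chordX_I)
  have br: "nc.breakpoint a" if X: "X a b" for a b
  proof -
    have "j < a" if E: "E i j" and lt: "i < a" for i j
    proof -
      have ij: "1 \<le> i" "i < m" "1 \<le> j" "j < m" "r i = r j" using E unfolding E_iff by auto
      have "r i \<le> a" using U_X[OF U_r[OF ij(1,2)] X lt] by (meson not_le)
      then show ?thesis using r_gt[OF ij(3,4)] ij by simp
    qed
    then show ?thesis unfolding nc.breakpoint_def using X_bounds[OF X] m_ge by auto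
  qed
  show "nc.breakpoint a" "nc.breakpoint b" using br X X_sym by blast+
  show False if F: "F i j" and "a \<le> i" "b \<le> j" for i j
    using X_X[OF X F_D(5)[OF F]] r_gt[OF F_D(1,2)[OF F]] r_gt[OF F_D(3,4)[OF F]] that by simp
  show "a = nc.top i \<and> b = nc.top j" if F: "F i j" and "i < a" "j < b" for i j
    using peak_unique[OF F_D[OF F] X that(2,3)] top_eq_r F_D[OF F] by simp
  show "a = 1 \<or> b = 1 \<or> nc.matched (a - 1) \<or> nc.matched (b - 1)"
  proof (cases "a = 1 \<or> b = 1")
    case False
    then have "2 \<le> a" "2 \<le> b" using X_bounds[OF X] by auto
    then show ?thesis using X_matched[OF X] unfolding nc.matched_def matched_def by blast
  qed blast
qed

end

section \<open>Noncrossing partitions of type B as pairs of relations\<close>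

text \<open>The vertex at a position, inverse to \<open>pos m\<close>.\<close>

definition vert :: "nat \<Rightarrow> nat \<Rightarrow> vertex" where
  "vert m k = (if k \<le> m then Unbarred k else Barred (k - m))"

lemma pos_vert [simp]: "pos m (vert m k) = k"
  unfolding vert_def by simp

lemma vert_pos: "v \<in> verts m \<Longrightarrow> vert m (pos m v) = v"
  unfolding verts_def vert_def by auto

lemma pos_mem: "v \<in> verts m \<Longrightarrow> pos m v \<in> {1..2 * m}"
  unfolding verts_def by auto

lemma vert_mem: assumes "k \<in> {1..2 * m}" shows "vert m k \<in> verts m"
proof (cases "k \<le> m")
  case False
  then have "k - m \<in> {1..m}" using assms by auto
  then show ?thesis unfolding verts_def vert_def using False by simp
qed (use assms in \<open>simp add: verts_def vert_def\<close>)

lemma vert_eq_iff [simp]: "vert m k = vert m l \<longleftrightarrow> k = l"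
  by (metis pos_vert)

lemma pos_eq_iff: "u \<in> verts m \<Longrightarrow> v \<in> verts m \<Longrightarrow> pos m u = pos m v \<longleftrightarrow> u = v"
  by (metis vert_pos)

lemma verts_eq_image: "verts m = vert m ` {1..2 * m}"
proof
  show "verts m \<subseteq> vert m ` {1..2 * m}" using vert_pos pos_mem by (metis image_eqI subsetI)
  show "vert m ` {1..2 * m} \<subseteq> verts m" using vert_mem by blast
qed

lemma bar_bar [simp]: "bar (bar v) = v"
  by (cases v) auto

lemma bar_mem: "v \<in> verts m \<Longrightarrow> bar v \<in> verts m"
  unfolding verts_def by auto

lemma orient_cis:
  "orient (cis a) (cis b) (cis c) = 4 * sin ((b - a) / 2) * sin ((c - b) / 2) * sin ((c - a) / 2)"
proof -
  define x y where "x = (b - a) / 2" and "y = (c - b) / 2"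
  have sum: "(c - a) / 2 = x + y" "b - a = 2 * x" "c - b = 2 * y" "c - a = 2 * (x + y)"
    unfolding x_def y_def by (simp_all add: field_simps)
  have "orient (cis a) (cis b) (cis c) = sin (b - a) + sin (c - b) - sin (c - a)"
    unfolding orient_def by (simp add: sin_diff algebra_simps)
  also have "\<dots> = sin (2 * x) + sin (2 * y) - sin (2 * (x + y))" unfolding sum ..
  also have "\<dots> = 2 * sin x * cos x + 2 * sin y * cos y -
      2 * (sin x * cos y + cos x * sin y) * (cos x * cos y - sin x * sin y)"
    by (simp only: sin_double sin_add cos_add)
  also have "\<dots> = 4 * sin x * sin y * (sin x * cos y + cos x * sin y)"
    using sin_cos_squared_add[of x] sin_cos_squared_add[of y] by algebra
  finally show ?thesis unfolding sum(1) x_def[symmetric] y_def[symmetric] sin_add .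
qed

lemma clockwise_circle_points: "clockwise_points (2 * n) (\<lambda>k. circle_point n (vert n k))"
proof
  define \<theta> where "\<theta> k = - (2 * pi * real k / real (2 * n))" for k
  have p: "circle_point n (vert n k) = cis (\<theta> k)" for k
    unfolding circle_point_def \<theta>_def by simp
  have half: "0 < (\<theta> i - \<theta> j) / 2 \<and> (\<theta> i - \<theta> j) / 2 < pi" if "1 \<le> i" "i < j" "j \<le> 2 * n" for i j
  proof -
    define q where "q = real (j - i) / real (2 * n)"
    have "(\<theta> i - \<theta> j) / 2 = pi * q"
      unfolding \<theta>_def q_def using that by (simp add: field_simps of_nat_diff)
    moreover have "0 < q" "q < 1" unfolding q_def using that by auto
    ultimately show ?thesis by simp
  qed
  have neg: "sin ((\<theta> j - \<theta> i) / 2) < 0" if "1 \<le> i" "i < j" "j \<le> 2 * n" for i j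
  proof -
    have "0 < sin ((\<theta> i - \<theta> j) / 2)" using half[OF that] sin_gt_zero by blast
    moreover have "(\<theta> j - \<theta> i) / 2 = - ((\<theta> i - \<theta> j) / 2)" by (metis minus_diff_eq minus_divide_left)
    ultimately show ?thesis by (metis neg_less_0_iff_less sin_minus)
  qed
  show "orient (circle_point n (vert n i)) (circle_point n (vert n j)) (circle_point n (vert n k)) < 0"
    if "1 \<le> i" "i < j" "j < k" "k \<le> 2 * n" for i j k
    unfolding p orient_cis
    using neg[of i j] neg[of j k] neg[of i k] that by (simp add: mult_less_0_iff zero_less_mult_iff)
  show "inj_on (\<lambda>k. circle_point n (vert n k)) {1..2 * n}"
  proof (rule linorder_inj_onI)
    fix i j assume ij: "i < j" "i \<in> {1..2 * n}" "j \<in> {1..2 * n}"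
    show "circle_point n (vert n i) \<noteq> circle_point n (vert n j)"
    proof
      assume "circle_point n (vert n i) = circle_point n (vert n j)"
      then have "cis (\<theta> i) = cis (\<theta> j)" unfolding p .
      then have "cos (\<theta> i - \<theta> j) = 1" by (simp add: cos_diff complex_eq_iff flip: power2_eq_square)
      moreover have "cos (\<theta> i - \<theta> j) = 1 - 2 * (sin ((\<theta> i - \<theta> j) / 2))\<^sup>2"
        using cos_double_sin[of "(\<theta> i - \<theta> j) / 2"] by (simp only: field_sum_of_halves mult_2)
      ultimately have "sin ((\<theta> i - \<theta> j) / 2) = 0" by simp
      moreover have "0 < (\<theta> i - \<theta> j) / 2 \<and> (\<theta> i - \<theta> j) / 2 < pi" by (rule half) (use ij in auto)
      then have "0 < sin ((\<theta> i - \<theta> j) / 2)" using sin_gt_zero by blast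
      ultimately show False by simp
    qed
  qed auto
qed

text \<open>The \<open>2 n\<close> points on the circle are in convex position, so disjointness of hulls is a condition on the cyclic
  order.\<close>

lemma NC_B_iff:
  "\<pi> \<in> NC_B n \<longleftrightarrow> partition_on (verts n) \<pi> \<and> (\<lambda>B. bar ` B) ` \<pi> = \<pi> \<and>
     (\<forall>B\<in>\<pi>. \<forall>B'\<in>\<pi>. B \<noteq> B' \<longrightarrow> \<not> crossing (pos n ` B) (pos n ` B'))"
proof -
  interpret clockwise_points "2 * n" "\<lambda>k. circle_point n (vert n k)" by (rule clockwise_circle_points)
  have eq: "convex hull (circle_point n ` B) \<inter> convex hull (circle_point n ` B') = {} \<longleftrightarrow>
      \<not> crossing (pos n ` B) (pos n ` B') \<and> \<not> crossing (pos n ` B') (pos n ` B)"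
    if \<pi>: "partition_on (verts n) \<pi>" "B \<in> \<pi>" "B' \<in> \<pi>" "B \<noteq> B'" for B B'
  proof -
    have sub: "B \<subseteq> verts n" "B' \<subseteq> verts n" "B \<inter> B' = {}"
      using \<pi> unfolding partition_on_def disjoint_def by auto
    have img: "circle_point n ` C = (\<lambda>k. circle_point n (vert n k)) ` pos n ` C" if "C \<subseteq> verts n" for C
    proof -
      have "circle_point n v = circle_point n (vert n (pos n v))" if "v \<in> C" for v
        using vert_pos[of v n] that \<open>C \<subseteq> verts n\<close> by auto
      then show ?thesis unfolding image_image by (rule image_cong[OF refl])
    qed
    have in12: "pos n ` B \<subseteq> {1..2 * n}" "pos n ` B' \<subseteq> {1..2 * n}" using sub pos_mem by blast+
    have disj: "pos n ` B \<inter> pos n ` B' = {}"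
    proof (rule ccontr)
      assume "\<not> ?thesis"
      then obtain u v where "u \<in> B" "v \<in> B'" "pos n u = pos n v" by auto
      then show False using pos_eq_iff[of u n v] sub by blast
    qed
    have meet: "convex hull ((\<lambda>k. circle_point n (vert n k)) ` C) \<inter> convex hull ((\<lambda>k. circle_point n (vert n k)) ` D) \<noteq> {}"
      if cr: "crossing C D" and C: "C \<subseteq> {1..2 * n}" and D: "D \<subseteq> {1..2 * n}" for C D
    proof -
      obtain w x y z where "w \<in> C" "x \<in> D" "y \<in> C" "z \<in> D" "w < x" "x < y" "y < z"
        using cr unfolding crossing_def by blast
      moreover have "1 \<le> w" "z \<le> 2 * n" using \<open>w \<in> C\<close> \<open>z \<in> D\<close> C D by auto
      ultimately show ?thesis by (intro crossing_hulls_meet[of w x y z])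
    qed
    show ?thesis unfolding img[OF sub(1)] img[OF sub(2)]
      using noncrossing_hulls_disjoint[OF in12 disj] meet[OF _ in12] meet[OF _ in12(2,1)] by blast
  qed
  let ?H = "\<lambda>B B'. convex hull (circle_point n ` B) \<inter> convex hull (circle_point n ` B') = {}"
  let ?C = "\<lambda>B B'. crossing (pos n ` B) (pos n ` B')"
  have eq': "(\<forall>B\<in>\<pi>. \<forall>B'\<in>\<pi>. B \<noteq> B' \<longrightarrow> ?H B B') \<longleftrightarrow> (\<forall>B\<in>\<pi>. \<forall>B'\<in>\<pi>. B \<noteq> B' \<longrightarrow> \<not> ?C B B')"
    if part: "partition_on (verts n) \<pi>"
  proof (intro iffI ballI impI)
    fix B B' assume "\<forall>B\<in>\<pi>. \<forall>B'\<in>\<pi>. B \<noteq> B' \<longrightarrow> ?H B B'" and B: "B \<in> \<pi>" "B' \<in> \<pi>" "B \<noteq> B'"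
    then have "?H B B'" by blast
    then show "\<not> ?C B B'" unfolding eq[OF part B] by blast
  next
    fix B B' assume nc: "\<forall>B\<in>\<pi>. \<forall>B'\<in>\<pi>. B \<noteq> B' \<longrightarrow> \<not> ?C B B'" and B: "B \<in> \<pi>" "B' \<in> \<pi>" "B \<noteq> B'"
    show "?H B B'" unfolding eq[OF part B] using nc B(1,2) B(3) B(3)[symmetric] by blast
  qed
  show ?thesis unfolding NC_B_def mem_Collect_eq by (intro conj_cong refl eq')
qed

text \<open>Extends the two relations to all vertices, using the half-turn symmetry.\<close>

fun same_block :: "(nat \<Rightarrow> nat \<Rightarrow> bool) \<Rightarrow> (nat \<Rightarrow> nat \<Rightarrow> bool) \<Rightarrow> vertex \<Rightarrow> vertex \<Rightarrow> bool" where
  "same_block E F (Unbarred i) (Unbarred j) = E i j"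
| "same_block E F (Barred i) (Barred j) = E i j"
| "same_block E F (Unbarred i) (Barred j) = F i j"
| "same_block E F (Barred i) (Unbarred j) = F i j"

definition blocks :: "nat \<Rightarrow> (nat \<Rightarrow> nat \<Rightarrow> bool) \<Rightarrow> (nat \<Rightarrow> nat \<Rightarrow> bool) \<Rightarrow> vertex set set" where
  "blocks n E F = verts n // {(x, y). same_block E F x y}"

lemma same_block_bar: "same_block E F (bar x) (bar y) = same_block E F x y"
  by (cases x; cases y) auto

context half_noncrossing
begin

lemma same_block_sym: "same_block E F x y \<Longrightarrow> same_block E F y x"
  by (cases x; cases y) (auto intro: E_sym F_sym)

lemma F_E: "F i j \<Longrightarrow> E j k \<Longrightarrow> F i k"
  by (rule F_sym[OF E_F[OF E_sym F_sym]])

lemma F_F': "F i j \<Longrightarrow> F j k \<Longrightarrow> E i k"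
  by (rule F_F[OF _ F_sym])

lemma same_block_trans: "same_block E F x y \<Longrightarrow> same_block E F y z \<Longrightarrow> same_block E F x z"
  by (cases x; cases y; cases z; simp;
    (erule (1) E_trans | erule (1) E_F | erule (1) F_E | erule (1) F_F'))

lemma same_block_mem: "same_block E F x y \<Longrightarrow> x \<in> verts n \<and> y \<in> verts n"
  unfolding verts_def by (cases x; cases y) (auto dest: E_bounds F_bounds)

lemma equiv_same_block: "equiv (verts n) {(x, y). same_block E F x y}"
proof (rule equivI)
  show "{(x, y). same_block E F x y} \<subseteq> verts n \<times> verts n" using same_block_mem by auto
  have "same_block E F x x" if "x \<in> verts n" for x
    using that E_refl unfolding verts_def by auto
  then show "refl_on (verts n) {(x, y). same_block E F x y}" unfolding refl_on_def by auto
  show "sym {(x, y). same_block E F x y}" by (rule symI) (simp add: same_block_sym)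
  show "trans {(x, y). same_block E F x y}" by (rule transI) (auto elim: same_block_trans)
qed

lemma same_block_noncrossing:
  assumes wy: "same_block E F w y" and xz: "same_block E F x z"
    and lt: "pos n w < pos n x" "pos n x < pos n y" "pos n y < pos n z"
  shows "same_block E F w x"
proof -
  have mem: "w \<in> verts n" "x \<in> verts n" "y \<in> verts n" "z \<in> verts n"
    using same_block_mem wy xz by blast+
  show ?thesis
  proof (cases w; cases x; cases y; cases z)
    fix i j k l assume "w = Unbarred i" "x = Unbarred j" "y = Unbarred k" "z = Unbarred l"
    then show ?thesis using wy xz lt EE_nc[of i k j l] by auto
  next
    fix i j k l assume "w = Unbarred i" "x = Unbarred j" "y = Unbarred k" "z = Barred l"
    then show ?thesis using wy xz lt EF_nc[of i k j l] by auto
  next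
    fix i j k l assume "w = Unbarred i" "x = Unbarred j" "y = Barred k" "z = Barred l"
    then show ?thesis using wy xz lt FF_nc[of i k j l] by auto
  next
    fix i j k l assume "w = Unbarred i" "x = Barred j" "y = Barred k" "z = Barred l"
    then show ?thesis using wy xz lt EF_nc[of j l k i] F_sym[of i k] E_F[of j k i] F_sym[of j i] by auto
  next
    fix i j k l assume "w = Barred i" "x = Barred j" "y = Barred k" "z = Barred l"
    then show ?thesis using wy xz lt EE_nc[of i k j l] by auto
  qed (use lt mem in \<open>auto simp: verts_def\<close>)
qed

lemma blocks_in_NC_B: "blocks n E F \<in> NC_B n"
  unfolding NC_B_iff
proof (intro conjI ballI impI)
  let ?R = "{(x, y). same_block E F x y}"
  show part: "partition_on (verts n) (blocks n E F)"
    unfolding blocks_def by (rule partition_on_quotient[OF equiv_same_block])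
  have bar_class: "bar ` (?R `` {x}) = ?R `` {bar x}" for x
  proof
    show "bar ` (?R `` {x}) \<subseteq> ?R `` {bar x}" using same_block_bar by auto
    show "?R `` {bar x} \<subseteq> bar ` (?R `` {x})"
    proof
      fix y assume "y \<in> ?R `` {bar x}"
      then have "same_block E F x (bar y)" using same_block_bar[of E F x "bar y"] by simp
      then show "y \<in> bar ` (?R `` {x})" by (intro image_eqI[of y bar "bar y"]) auto
    qed
  qed
  have sub: "bar ` B \<in> blocks n E F" if B: "B \<in> blocks n E F" for B
  proof -
    obtain x where "x \<in> verts n" "B = ?R `` {x}" using B unfolding blocks_def by (blast elim: quotientE)
    then have "bar ` B = ?R `` {bar x}" "bar x \<in> verts n" using bar_class[of x] bar_mem by blast+
    then show ?thesis unfolding blocks_def using quotientI[of "bar x" "verts n" ?R] by simp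
  qed
  show "(\<lambda>B. bar ` B) ` blocks n E F = blocks n E F"
  proof
    show "(\<lambda>B. bar ` B) ` blocks n E F \<subseteq> blocks n E F" using sub by blast
    show "blocks n E F \<subseteq> (\<lambda>B. bar ` B) ` blocks n E F"
    proof
      fix B assume "B \<in> blocks n E F"
      then have "bar ` B \<in> blocks n E F" "B = bar ` (bar ` B)" using sub by (auto simp: image_image)
      then show "B \<in> (\<lambda>B. bar ` B) ` blocks n E F" by blast
    qed
  qed
  fix B B' assume B: "B \<in> blocks n E F" "B' \<in> blocks n E F" "B \<noteq> B'"
  have rel: "same_block E F u v" if "C \<in> blocks n E F" "u \<in> C" "v \<in> C" for C u v
    using quotient_eq_iff[OF equiv_same_block, of C C u v] that unfolding blocks_def by simp
  show "\<not> crossing (pos n ` B) (pos n ` B')"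
  proof
    assume "crossing (pos n ` B) (pos n ` B')"
    then obtain w x y z where h: "w \<in> B" "x \<in> B'" "y \<in> B" "z \<in> B'"
      "pos n w < pos n x" "pos n x < pos n y" "pos n y < pos n z" unfolding crossing_def by auto
    have "same_block E F w x" using same_block_noncrossing rel B h by metis
    then have "B = B'" using quotient_eq_iff[OF equiv_same_block, of B B' w x] B h unfolding blocks_def by simp
    then show False using B(3) by blast
  qed
qed

end

lemma blocks_inj:
  assumes "half_noncrossing n E F" "half_noncrossing n E' F'" "blocks n E F = blocks n E' F'"
  shows "E = E'" "F = F'"
proof -
  have rel: "same_block E F x y \<longleftrightarrow> (\<exists>B\<in>blocks n E F. x \<in> B \<and> y \<in> B)"
    if "half_noncrossing n E F" for E F x y
  proof -
    interpret half_noncrossing n E F by fact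
    note eq = equiv_same_block
    show ?thesis
    proof
      assume s: "same_block E F x y"
      let ?C = "{(x, y). same_block E F x y} `` {x}"
      have "?C \<in> blocks n E F"
        unfolding blocks_def using same_block_mem[OF s] by (intro quotientI) simp
      moreover have "x \<in> ?C \<and> y \<in> ?C" using s same_block_trans[OF s same_block_sym[OF s]] by simp
      ultimately show "\<exists>B\<in>blocks n E F. x \<in> B \<and> y \<in> B" by (rule bexI[rotated])
    next
      assume "\<exists>B\<in>blocks n E F. x \<in> B \<and> y \<in> B"
      then obtain B where B: "B \<in> verts n // {(x, y). same_block E F x y}" "x \<in> B" "y \<in> B"
        unfolding blocks_def by blast
      show "same_block E F x y" using in_quotient_imp_in_rel[OF eq B(1), of x y] B(2,3) by simp
    qed
  qed
  have same: "same_block E F x y = same_block E' F' x y" for x y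
    using rel[OF assms(1)] rel[OF assms(2)] assms(3) by simp
  show "E = E'"
  proof (intro ext)
    show "E i j = E' i j" for i j using same[of "Unbarred i" "Unbarred j"] by simp
  qed
  show "F = F'"
  proof (intro ext)
    show "F i j = F' i j" for i j using same[of "Unbarred i" "Barred j"] by simp
  qed
qed

lemma NC_B_eq_blocks:
  assumes "\<pi> \<in> NC_B n"
  obtains E F where "half_noncrossing n E F" "\<pi> = blocks n E F"
proof -
  let ?R = "\<lambda>x y. \<exists>B\<in>\<pi>. x \<in> B \<and> y \<in> B"
  have part: "partition_on (verts n) \<pi>" and bar: "(\<lambda>B. bar ` B) ` \<pi> = \<pi>"
    and nc: "\<And>B B'. B \<in> \<pi> \<Longrightarrow> B' \<in> \<pi> \<Longrightarrow> B \<noteq> B' \<Longrightarrow> \<not> crossing (pos n ` B) (pos n ` B')"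
    using assms unfolding NC_B_iff by blast+
  have mem: "x \<in> verts n \<and> y \<in> verts n" if "?R x y" for x y
    using partition_onD1[OF part] that by blast
  have refl: "?R x x" if "x \<in> verts n" for x using partition_onD1[OF part] that by blast
  have sym: "?R y x" if "?R x y" for x y using that by blast
  have uniq: "B = B'" if "B \<in> \<pi>" "B' \<in> \<pi>" "x \<in> B" "x \<in> B'" for B B' x
    using disjointD[OF partition_onD2[OF part] that(1,2)] that(3,4) by blast
  have trans: "?R x z" if xy: "?R x y" and yz: "?R y z" for x y z
  proof -
    obtain B where B: "B \<in> \<pi>" "x \<in> B" "y \<in> B" using xy by blast
    obtain B' where B': "B' \<in> \<pi>" "y \<in> B'" "z \<in> B'" using yz by blast
    have "B = B'" using uniq[OF B(1) B'(1) B(3) B'(2)] .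
    then show ?thesis using B B' by blast
  qed
  have Rbar: "?R (bar x) (bar y)" if xy: "?R x y" for x y
  proof -
    obtain B where B: "B \<in> \<pi>" "x \<in> B" "y \<in> B" using xy by blast
    have "bar ` B \<in> (\<lambda>B. bar ` B) ` \<pi>" using B(1) by (rule imageI)
    then have "bar ` B \<in> \<pi>" unfolding bar .
    moreover have "bar x \<in> bar ` B \<and> bar y \<in> bar ` B" using B(2,3) by simp
    ultimately show ?thesis by (rule bexI[rotated])
  qed
  have Rnc: "?R w x" if wy: "?R w y" and xz: "?R x z"
    and lt: "pos n w < pos n x" "pos n x < pos n y" "pos n y < pos n z" for w x y z
  proof -
    obtain B where B: "B \<in> \<pi>" "w \<in> B" "y \<in> B" using wy by blast
    obtain B' where B': "B' \<in> \<pi>" "x \<in> B'" "z \<in> B'" using xz by blast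
    have "crossing (pos n ` B) (pos n ` B')"
      by (rule crossingI[OF imageI[OF B(2)] imageI[OF B'(2)] imageI[OF B(3)] imageI[OF B'(3)] lt])
    then have "B = B'" using nc[OF B(1) B'(1)] by blast
    then show ?thesis using B B' by blast
  qed
  define E where "E i j = ?R (Unbarred i) (Unbarred j)" for i j
  define F where "F i j = ?R (Unbarred i) (Barred j)" for i j
  have lab: "i \<in> {1..n}" if "Unbarred i \<in> verts n \<or> Barred i \<in> verts n" for i
    using that unfolding verts_def by auto
  have half: "half_noncrossing n E F"
  proof
    show "i \<in> {1..n} \<and> j \<in> {1..n}" if "E i j" for i j
      using mem[OF that[unfolded E_def]] lab by simp
    show "E i i" if "i \<in> {1..n}" for i
      unfolding E_def by (rule refl) (use that in \<open>simp add: verts_def\<close>)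
    show "E j i" if "E i j" for i j using sym[OF that[unfolded E_def]] unfolding E_def .
    show "E i k" if "E i j" "E j k" for i j k
      using trans[OF that[unfolded E_def]] unfolding E_def .
    show "i \<in> {1..n} \<and> j \<in> {1..n}" if "F i j" for i j
      using mem[OF that[unfolded F_def]] lab by simp
    show "F j i" if "F i j" for i j
      using sym[OF Rbar[OF that[unfolded F_def]]] unfolding F_def by simp
    show "F i j" if "E i k" "F k j" for i j k
      using trans[OF that[unfolded E_def F_def]] unfolding F_def .
    show "E i k" if "F i j" "F k j" for i j k
      using trans[OF that(1)[unfolded F_def] sym[OF that(2)[unfolded F_def]]] unfolding E_def .
    show "E i j" if "E i k" "E j l" "i < j" "j < k" "k < l" for i j k l
      unfolding E_def
      by (rule Rnc[OF that(1)[unfolded E_def] that(2)[unfolded E_def]]) (use that in simp_all)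
    show "E i j" if h: "E i k" "F j l" "i < j" "j < k" for i j k l
    proof -
      have "k \<in> {1..n}" "l \<in> {1..n}"
        using mem[OF h(1)[unfolded E_def]] mem[OF h(2)[unfolded F_def]] lab by blast+
      then show ?thesis unfolding E_def
        by (intro Rnc[OF h(1)[unfolded E_def] h(2)[unfolded F_def]]) (use h in simp_all)
    qed
    show "E i k" if h: "F i j" "F k l" "i < k" "j < l" for i j k l
    proof -
      have "k \<in> {1..n}" "j \<in> {1..n}"
        using mem[OF h(1)[unfolded F_def]] mem[OF h(2)[unfolded F_def]] lab by blast+
      then show ?thesis unfolding E_def
        by (intro Rnc[OF h(1)[unfolded F_def] h(2)[unfolded F_def]]) (use h in simp_all)
    qed
  qed
  have Rbar': "?R (bar x) (bar y) = ?R x y" for x y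
    by (rule iffI[OF Rbar[of "bar x" "bar y", unfolded bar_bar] Rbar[of x y]])
  have "same_block E F = ?R"
  proof (intro ext)
    fix x y
    show "same_block E F x y = ?R x y"
    proof (cases x; cases y)
    fix i j assume "x = Barred i" "y = Barred j"
    then show ?thesis using Rbar'[of x y] unfolding E_def by simp
  next
    fix i j assume "x = Barred i" "y = Unbarred j"
    then show ?thesis using Rbar'[of x y] unfolding F_def by simp
    qed (simp_all add: E_def F_def)
  qed
  then have "blocks n E F = verts n // {(x, y). \<exists>B\<in>\<pi>. x \<in> B \<and> y \<in> B}" unfolding blocks_def by simp
  also have "\<dots> = \<pi>" by (rule partition_on_eq_quotient[OF part])
  finally show ?thesis by (intro that[OF half]) simp
qed

section \<open>Triangulations as relations between positions\<close>

text \<open>A triangulation of a polygon with vertices \<open>1, \<dots>, N\<close>, polygon edges included. Every chord has a triangle on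
  the side away from the edge \<open>(1, N)\<close>; applied from that edge downwards this produces all triangles.\<close>

locale position_triangulation =
  fixes N :: nat and e :: "nat \<Rightarrow> nat \<Rightarrow> bool"
  assumes e_bounds: "e i j \<Longrightarrow> 1 \<le> i \<and> i < j \<and> j \<le> N"
    and e_edge: "1 \<le> i \<Longrightarrow> i < N \<Longrightarrow> e i (Suc i)"
    and e_root: "e 1 N"
    and e_nc: "e i j \<Longrightarrow> e k l \<Longrightarrow> i < k \<Longrightarrow> k < j \<Longrightarrow> l \<le> j"
    and e_inner: "e i j \<Longrightarrow> Suc i < j \<Longrightarrow> \<exists>k. i < k \<and> k < j \<and> e i k \<and> e k j"
begin

text \<open>The shortest chord \<open>(p, q)\<close> with \<open>p \<le> i < j \<le> q\<close> is \<open>(i, j)\<close> itself, for otherwise the third corner of its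
  inner triangle lies strictly between \<open>i\<close> and \<open>j\<close> and one of the sides there crosses \<open>(i, j)\<close>.\<close>

lemma maximal:
  assumes sub: "\<And>i j. e i j \<Longrightarrow> e' i j" and bd: "e' i j \<Longrightarrow> 1 \<le> i \<and> i < j \<and> j \<le> N"
    and nc: "\<And>i j k l. e' i j \<Longrightarrow> e' k l \<Longrightarrow> i < k \<Longrightarrow> k < j \<Longrightarrow> l \<le> j"
    and e': "e' i j"
  shows "e i j"
proof -
  have ij: "1 \<le> i" "i < j" "j \<le> N" using bd e' by auto
  have "e i j" if "e p q" "p \<le> i" "j \<le> q" for p q
    using that
  proof (induction "q - p" arbitrary: p q rule: less_induct)
    case less
    show ?case
    proof (cases "p = i \<and> q = j")
      case True then show ?thesis using less.prems by simp
    next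
      case False
      then have "Suc p < q" using less.prems ij by linarith
      then obtain k where k: "p < k" "k < q" "e p k" "e k q" using e_inner less.prems by blast
      consider "k \<le> i" | "j \<le> k" | "i < k" "k < j" by linarith
      then show ?thesis
      proof cases
        case 1 then show ?thesis using less.hyps[of q k] k less.prems by simp
      next
        case 2 then show ?thesis using less.hyps[of k p] k less.prems by simp
      next
        case 3
        have "\<not> p < i" using nc[OF sub[OF k(3)] e'] 3 by auto
        moreover have "\<not> j < q" using nc[OF e' sub[OF k(4)]] 3 by auto
        ultimately show ?thesis using False less.prems by simp
      qed
    qed
  qed
  then show ?thesis using e_root ij by blast
qed

end

abbreviation side :: "nat \<Rightarrow> nat \<Rightarrow> nat \<Rightarrow> vertex set" where
  "side n i j \<equiv> {vert (Suc n) i, vert (Suc n) j}"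

definition adj :: "nat \<Rightarrow> vertex set set \<Rightarrow> nat \<Rightarrow> nat \<Rightarrow> bool" where
  "adj n T i j \<longleftrightarrow> 1 \<le> i \<and> i < j \<and> j \<le> 2 * Suc n \<and>
     side n i j \<in> edges n \<union> T"

definition chords_of :: "nat \<Rightarrow> (nat \<Rightarrow> nat \<Rightarrow> bool) \<Rightarrow> vertex set set" where
  "chords_of n e = {side n i j |i j. e i j} - edges n"

lemma next_vert: assumes "k \<in> {1..2 * m}"
  shows "next_vertex m (vert m k) = vert m (if k = 2 * m then 1 else Suc k)"
proof -
  have "m \<ge> 1" using assms by auto
  then show ?thesis using assms unfolding vert_def by (auto simp: Suc_diff_le)
qed

lemma edges_iff: assumes "n \<ge> 1" "1 \<le> i" "i < j" "j \<le> 2 * Suc n"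
  shows "side n i j \<in> edges n \<longleftrightarrow> j = Suc i \<or> i = 1 \<and> j = 2 * Suc n"
proof -
  let ?N = "2 * Suc n"
  let ?R = "\<exists>k\<in>{1..?N}. i = k \<and> j = (if k = ?N then 1 else Suc k) \<or> j = k \<and> i = (if k = ?N then 1 else Suc k)"
  have "side n i j \<in> edges n \<longleftrightarrow>
      (\<exists>k\<in>{1..?N}. side n i j = {vert (Suc n) k, next_vertex (Suc n) (vert (Suc n) k)})"
    unfolding edges_def Suc_eq_plus1[symmetric] verts_eq_image by blast
  also have "\<dots> \<longleftrightarrow> (\<exists>k\<in>{1..?N}. side n i j =
      {vert (Suc n) k, vert (Suc n) (if k = ?N then 1 else Suc k)})"
    using next_vert[of _ "Suc n"] by (intro bex_cong refl) simp
  also have "\<dots> \<longleftrightarrow> ?R"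
    unfolding doubleton_eq_iff vert_eq_iff by (intro bex_cong refl) auto
  also have "\<dots> \<longleftrightarrow> j = Suc i \<or> i = 1 \<and> j = ?N"
  proof
    assume "?R"
    then show "j = Suc i \<or> i = 1 \<and> j = ?N" using assms by (auto split: if_splits)
  next
    assume "j = Suc i \<or> i = 1 \<and> j = ?N"
    then show "?R"
    proof
      assume "j = Suc i"
      then show ?thesis using assms by (intro bexI[of _ i]) auto
    next
      assume "i = 1 \<and> j = ?N"
      then show ?thesis by (intro bexI[of _ ?N]) auto
    qed
  qed
  finally show ?thesis .
qed

lemma pair_positions:
  assumes "C \<subseteq> verts (Suc n)" "card C = 2"
  obtains i j where "1 \<le> i" "i < j" "j \<le> 2 * Suc n" "C = side n i j"
proof -
  obtain u v where uv: "C = {u, v}" "u \<noteq> v" using assms(2) card_2_iff by metis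
  let ?i = "pos (Suc n) u" and ?j = "pos (Suc n) v"
  have mem: "u \<in> verts (Suc n)" "v \<in> verts (Suc n)" using uv assms by auto
  have C: "C = side n ?i ?j" "C = side n ?j ?i"
    using vert_pos[OF mem(1)] vert_pos[OF mem(2)] uv by auto
  have bd: "?i \<in> {1..2 * Suc n}" "?j \<in> {1..2 * Suc n}" using pos_mem mem by blast+
  have "?i \<noteq> ?j" using pos_eq_iff[OF mem] uv by simp
  then consider "?i < ?j" | "?j < ?i" by linarith
  then show ?thesis
  proof cases
    case 1 then show ?thesis using that[of ?i ?j] bd C by simp
  next
    case 2 then show ?thesis using that[of ?j ?i] bd C by simp
  qed
qed

lemma chord_positions:
  assumes "C \<in> chords n"
  obtains i j where "1 \<le> i" "i < j" "j \<le> 2 * Suc n" "C = side n i j"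
  using pair_positions[of C n] assms unfolding chords_def Suc_eq_plus1 by blast

lemma chords_of_adj: assumes "T \<subseteq> chords n" shows "chords_of n (adj n T) = T"
proof
  show "chords_of n (adj n T) \<subseteq> T" unfolding chords_of_def adj_def by blast
  show "T \<subseteq> chords_of n (adj n T)"
  proof
    fix C assume C: "C \<in> T"
    then have Cc: "C \<in> chords n" using assms by blast
    then obtain i j where ij: "1 \<le> i" "i < j" "j \<le> 2 * Suc n" "C = side n i j"
      using chord_positions by blast
    then have "adj n T i j" using C unfolding adj_def by blast
    moreover have "C \<notin> edges n" using Cc unfolding chords_def by blast
    ultimately show "C \<in> chords_of n (adj n T)" using ij unfolding chords_of_def by blast
  qed
qed

lemma adj_chords_of:
  assumes "n \<ge> 1" "position_triangulation (2 * Suc n) e"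
  shows "chords_of n e \<subseteq> chords n" "adj n (chords_of n e) = e"
proof -
  interpret position_triangulation "2 * Suc n" e by fact
  show "chords_of n e \<subseteq> chords n"
  proof
    fix C assume "C \<in> chords_of n e"
    then obtain i j where C: "C = side n i j" "e i j" "C \<notin> edges n"
      unfolding chords_of_def by blast
    have "vert (Suc n) i \<in> verts (Suc n)" "vert (Suc n) j \<in> verts (Suc n)"
      using vert_mem e_bounds[OF C(2)] by auto
    moreover have "card C = 2" using C e_bounds[OF C(2)] by simp
    ultimately show "C \<in> chords n" using C unfolding chords_def by simp
  qed
  have "adj n (chords_of n e) i j \<longleftrightarrow> e i j" for i j
  proof
    assume a: "adj n (chords_of n e) i j"
    then have ij: "1 \<le> i" "i < j" "j \<le> 2 * Suc n" unfolding adj_def by auto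
    consider "side n i j \<in> edges n" | "side n i j \<in> chords_of n e"
      using a unfolding adj_def by blast
    then show "e i j"
    proof cases
      case 1
      then have "j = Suc i \<or> i = 1 \<and> j = 2 * Suc n" using edges_iff[OF assms(1) ij] by simp
      then show ?thesis using e_edge e_root ij by auto
    next
      case 2
      then obtain k l where kl: "side n i j = side n k l" "e k l"
        unfolding chords_of_def by blast
      have "k < l" using e_bounds[OF kl(2)] by simp
      then have "i = k \<and> j = l" using kl(1) ij(2) unfolding doubleton_eq_iff vert_eq_iff by auto
      then show ?thesis using kl(2) by simp
    qed
  next
    assume "e i j"
    then show "adj n (chords_of n e) i j" using e_bounds[of i j] unfolding adj_def chords_of_def by blast
  qed
  then show "adj n (chords_of n e) = e" by (intro ext)
qed

definition position_triangles :: "nat \<Rightarrow> vertex set set \<Rightarrow> nat set set" where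
  "position_triangles n T = {s. s \<subseteq> {1..2 * Suc n} \<and> card s = 3 \<and> (\<forall>a\<in>s. \<forall>b\<in>s. a < b \<longrightarrow> adj n T a b)}"

lemma triangles_eq: "triangles n T = (\<lambda>s. vert (Suc n) ` s) ` position_triangles n T"
proof
  show "triangles n T \<subseteq> (\<lambda>s. vert (Suc n) ` s) ` position_triangles n T"
  proof
    fix t assume t: "t \<in> triangles n T"
    then have tm: "t \<subseteq> verts (Suc n)" "card t = 3" unfolding triangles_def by auto
    let ?s = "pos (Suc n) ` t"
    have vp: "vert (Suc n) (pos (Suc n) v) = v" if "v \<in> t" for v using vert_pos that tm by blast
    have "t = vert (Suc n) ` ?s" using vp by (simp add: image_image)
    moreover have "inj_on (pos (Suc n)) t" using vp by (rule inj_on_inverseI)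
    then have "card ?s = 3" using tm card_image by metis
    moreover have "adj n T a b" if ab: "a \<in> ?s" "b \<in> ?s" "a < b" for a b
    proof -
      obtain u v where uv: "u \<in> t" "a = pos (Suc n) u" "v \<in> t" "b = pos (Suc n) v" using ab by blast
      then have "u \<noteq> v" using ab(3) by blast
      then have "{u, v} \<in> edges n \<union> T" using t uv unfolding triangles_def by blast
      moreover have "a \<in> {1..2 * Suc n}" "b \<in> {1..2 * Suc n}" using pos_mem uv tm by blast+
      ultimately show ?thesis using ab(3) vp uv unfolding adj_def by simp
    qed
    moreover have "?s \<subseteq> {1..2 * Suc n}" using pos_mem tm by blast
    ultimately have "?s \<in> position_triangles n T" unfolding position_triangles_def by blast
    then show "t \<in> (\<lambda>s. vert (Suc n) ` s) ` position_triangles n T" using \<open>t = vert (Suc n) ` ?s\<close> by blast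
  qed
  show "(\<lambda>s. vert (Suc n) ` s) ` position_triangles n T \<subseteq> triangles n T"
  proof
    fix t assume "t \<in> (\<lambda>s. vert (Suc n) ` s) ` position_triangles n T"
    then obtain s where s: "t = vert (Suc n) ` s" "s \<subseteq> {1..2 * Suc n}" "card s = 3"
      "\<And>a b. a \<in> s \<Longrightarrow> b \<in> s \<Longrightarrow> a < b \<Longrightarrow> adj n T a b" unfolding position_triangles_def by blast
    have "inj_on (vert (Suc n)) s" unfolding inj_on_def by simp
    then have "card t = 3" using s card_image by metis
    moreover have "t \<subseteq> verts (Suc n)" using s vert_mem by blast
    moreover have "{u, v} \<in> edges n \<union> T" if "u \<in> t" "v \<in> t" "u \<noteq> v" for u v
    proof -
      obtain a b where ab: "a \<in> s" "u = vert (Suc n) a" "b \<in> s" "v = vert (Suc n) b" using \<open>u \<in> t\<close> \<open>v \<in> t\<close> s(1) by blast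
      then have "a \<noteq> b" using that by blast
      then consider "a < b" | "b < a" by linarith
      then show ?thesis
      proof cases
        case 1 then show ?thesis using s(4)[OF ab(1,3)] ab unfolding adj_def by simp
      next
        case 2 then show ?thesis using s(4)[OF ab(3,1)] ab unfolding adj_def by (simp add: insert_commute)
      qed
    qed
    ultimately show "t \<in> triangles n T" unfolding triangles_def by simp
  qed
qed

lemma clockwise_polygon:
  assumes "n \<ge> 1" "convex_cs_polygon n P"
  shows "clockwise_points (2 * Suc n) (\<lambda>k. P (vert (Suc n) k))"
proof
  let ?p = "\<lambda>k. P (vert (Suc n) k)"
  show turn: "orient (?p i) (?p j) (?p k) < 0" if "1 \<le> i" "i < j" "j < k" "k \<le> 2 * Suc n" for i j k
  proof -
    have "vert (Suc n) i \<in> verts (Suc n)" "vert (Suc n) j \<in> verts (Suc n)" "vert (Suc n) k \<in> verts (Suc n)"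
      using vert_mem that by auto
    then show ?thesis using assms(2) that unfolding convex_cs_polygon_def orient_def Suc_eq_plus1[symmetric]
      by (metis pos_vert)
  qed
  show "inj_on ?p {1..2 * Suc n}"
  proof (rule linorder_inj_onI)
    fix i j assume ij: "i < j" "i \<in> {1..2 * Suc n}" "j \<in> {1..2 * Suc n}"
    show "?p i \<noteq> ?p j"
    proof
      assume eq: "?p i = ?p j"
      show False
      proof (cases "j < 2 * Suc n")
        case True
        then have "orient (?p i) (?p j) (?p (Suc j)) < 0" using turn[of i j "Suc j"] ij by simp
        then show False using eq by (simp add: orient_def)
      next
        case False
        show False
        proof (cases "Suc i < j")
          case True
          then have "orient (?p i) (?p (Suc i)) (?p j) < 0" using turn[of i "Suc i" j] ij by simp
          then show False using eq by (simp add: orient_def)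
        next
          case f: False
          then have "orient (?p 1) (?p i) (?p j) < 0" using turn[of 1 i j] ij False assms(1) by simp
          then show False using eq orient_self(2)[of "?p 1" "?p i"] by simp
        qed
      qed
    qed
  qed auto
qed

locale convex_polygon =
  fixes n :: nat and P :: "vertex \<Rightarrow> complex"
  assumes n_ge: "n \<ge> 1" and polygon: "convex_cs_polygon n P"
begin

abbreviation "p k \<equiv> P (vert (Suc n) k)"

sublocale clockwise_points "2 * Suc n" p
  using clockwise_polygon[OF n_ge polygon] .

lemma hull_vert_image: "convex hull (P ` vert (Suc n) ` s) = convex hull (p ` s)"
  by (simp add: image_image)

lemma hull_verts: "convex hull (P ` verts (n + 1)) = convex hull (p ` {1..2 * Suc n})"
  unfolding Suc_eq_plus1[symmetric] verts_eq_image by (rule hull_vert_image)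

lemma adj_edge: "1 \<le> i \<Longrightarrow> i < 2 * Suc n \<Longrightarrow> adj n T i (Suc i)"
  unfolding adj_def using edges_iff[OF n_ge, of i "Suc i"] by auto

lemma adj_root: "adj n T 1 (2 * Suc n)"
  unfolding adj_def using edges_iff[OF n_ge, of 1 "2 * Suc n"] by auto

lemma finite_position_triangles: "finite (position_triangles n T)"
  unfolding position_triangles_def by (rule finite_subset[of _ "Pow {1..2 * Suc n}"]) auto

lemma triangulation_noncrossing:
  assumes T: "triangulation n P T" and e: "adj n T i j" "adj n T k l" and lt: "i < k" "k < j"
  shows "l \<le> j"
proof (rule ccontr)
  assume l: "\<not> l \<le> j"
  have bd: "1 \<le> i" "i < j" "j \<le> 2 * Suc n" "1 \<le> k" "k < l" "l \<le> 2 * Suc n" using e unfolding adj_def by auto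
  let ?C = "side n i j" and ?D = "side n k l"
  have "?C \<notin> edges n" unfolding edges_iff[OF n_ge bd(1-3)] using lt l bd by auto
  moreover have "?D \<notin> edges n" unfolding edges_iff[OF n_ge bd(4-6)] using lt l bd by auto
  ultimately have CD: "?C \<in> T" "?D \<in> T" using e unfolding adj_def by auto
  have ne: "?C \<noteq> ?D" using lt l unfolding doubleton_eq_iff vert_eq_iff by auto
  have "\<forall>C\<in>T. \<forall>D\<in>T. C \<noteq> D \<longrightarrow>
      convex hull (P ` C) \<inter> convex hull (P ` D) \<inter> interior (convex hull (P ` verts (n + 1))) = {}"
    using T unfolding triangulation_def by (elim conjE)
  then have "convex hull (P ` ?C) \<inter> convex hull (P ` ?D) \<inter> interior (convex hull (P ` verts (n + 1))) = {}"
    using CD ne by (elim ballE[of _ _ ?C] ballE[of _ _ ?D] impE) blast+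
  then have "convex hull (p ` {i, j}) \<inter> convex hull (p ` {k, l}) \<inter> interior (convex hull (p ` {1..2 * Suc n})) = {}"
    unfolding hull_verts by simp
  moreover have "j < l" using l by simp
  ultimately show False using crossing_interior[OF bd(1) lt _ bd(6)] by blast
qed

lemma triangulation_triangle:
  assumes T: "triangulation n P T" and ij: "adj n T i j" and q: "q \<in> {1..2 * Suc n}" "q \<notin> {i, j}"
  shows "\<exists>k\<in>{1..2 * Suc n}. k \<notin> {i, j} \<and> {i, j, k} \<in> position_triangles n T \<and>
    (i < k \<and> k < j) = (i < q \<and> q < j)"
proof (rule triangle_on_side[where e = "adj n T"])
  have "convex hull (P ` verts (n + 1)) = (\<Union>t\<in>triangles n T. convex hull (P ` t))"
    using T unfolding triangulation_def by (elim conjE)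
  then show "convex hull (p ` {1..2 * Suc n}) \<subseteq> (\<Union>t\<in>position_triangles n T. convex hull (p ` t))"
    unfolding hull_verts triangles_eq by (simp add: image_image)
  show "l \<le> j" if "adj n T i j" "adj n T k l" "i < k" "k < j" for i j k l
    using triangulation_noncrossing[OF T that] .
qed (use ij q finite_position_triangles in \<open>auto simp: position_triangles_def adj_def\<close>)

lemma position_triangulation_adj:
  assumes T: "triangulation n P T" shows "position_triangulation (2 * Suc n) (adj n T)"
proof
  show "1 \<le> i \<and> i < j \<and> j \<le> 2 * Suc n" if "adj n T i j" for i j using that unfolding adj_def by blast
  show "adj n T i (Suc i)" if "1 \<le> i" "i < 2 * Suc n" for i using adj_edge that .
  show "adj n T 1 (2 * Suc n)" by (rule adj_root)
  show "l \<le> j" if "adj n T i j" "adj n T k l" "i < k" "k < j" for i j k l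
    using triangulation_noncrossing[OF T that] .
  show "\<exists>k. i < k \<and> k < j \<and> adj n T i k \<and> adj n T k j" if ij: "adj n T i j" and lt: "Suc i < j" for i j
  proof -
    have "Suc i \<in> {1..2 * Suc n}" "Suc i \<notin> {i, j}" using ij lt unfolding adj_def by auto
    then obtain k where k: "{i, j, k} \<in> position_triangles n T" "i < k \<and> k < j"
      using triangulation_triangle[OF T ij, of "Suc i"] lt by blast
    then have "adj n T i k \<and> adj n T k j" unfolding position_triangles_def by simp
    then show ?thesis using k(2) by blast
  qed
qed

lemma triangulation_chords_of:
  assumes "position_triangulation (2 * Suc n) e"
  shows "triangulation n P (chords_of n e)"
proof -
  interpret e: position_triangulation "2 * Suc n" e by fact
  let ?T = "chords_of n e"
  note adj = adj_chords_of[OF n_ge assms]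
  have "convex hull (P ` C) \<inter> convex hull (P ` D) \<inter> interior (convex hull (P ` verts (n + 1))) = {}"
    if CD: "C \<in> ?T" "D \<in> ?T" "C \<noteq> D" for C D
  proof -
    obtain i j where C: "C = side n i j" "e i j" using CD(1) unfolding chords_of_def by blast
    obtain k l where D: "D = side n k l" "e k l" using CD(2) unfolding chords_of_def by blast
    have bd: "1 \<le> i" "i < j" "j \<le> 2 * Suc n" "1 \<le> k" "k < l" "l \<le> 2 * Suc n"
      using e.e_bounds[OF C(2)] e.e_bounds[OF D(2)] by auto
    have "(i, j) \<noteq> (k, l)" using CD(3) C D by blast
    moreover have "\<not> (i < k \<and> k < j \<and> j < l)" using e.e_nc[OF C(2) D(2)] by auto
    moreover have "\<not> (k < i \<and> i < l \<and> l < j)" using e.e_nc[OF D(2) C(2)] by auto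
    ultimately have "convex hull (p ` {i, j}) \<inter> convex hull (p ` {k, l}) \<inter>
        interior (convex hull (p ` {1..2 * Suc n})) = {}"
      by (intro noncrossing_chords_meet_outside_interior bd)
    then show ?thesis unfolding hull_verts C D by simp
  qed
  moreover have "convex hull (P ` verts (n + 1)) = (\<Union>t\<in>triangles n ?T. convex hull (P ` t))"
  proof
    have "convex hull (p ` {1..2 * Suc n}) \<subseteq>
        (\<Union>(a, b, c)\<in>{(a, b, c). e a b \<and> e b c \<and> e a c}. convex hull (p ` {a, b, c}))"
      by (rule inner_triangles_cover[OF e.e_inner e.e_bounds e.e_root]) (use n_ge in simp_all)
    also have "\<dots> \<subseteq> (\<Union>s\<in>position_triangles n ?T. convex hull (p ` s))"
    proof safe
      fix a b c x assume h: "e a b" "e b c" "e a c" "x \<in> convex hull (p ` {a, b, c})"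
      have "a < b" "b < c" "1 \<le> a" "c \<le> 2 * Suc n" using e.e_bounds h by blast+
      then have "{a, b, c} \<in> position_triangles n ?T"
        unfolding position_triangles_def adj using h by auto
      then show "x \<in> (\<Union>s\<in>position_triangles n ?T. convex hull (p ` s))" using h by blast
    qed
    also have "\<dots> = (\<Union>t\<in>triangles n ?T. convex hull (P ` t))" unfolding triangles_eq by (simp add: image_image)
    finally show "convex hull (P ` verts (n + 1)) \<subseteq> (\<Union>t\<in>triangles n ?T. convex hull (P ` t))"
      unfolding hull_verts .
    show "(\<Union>t\<in>triangles n ?T. convex hull (P ` t)) \<subseteq> convex hull (P ` verts (n + 1))"
    proof (rule UN_least)
      fix t assume "t \<in> triangles n ?T"
      then have "P ` t \<subseteq> P ` verts (n + 1)" unfolding triangles_def by blast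
      then show "convex hull (P ` t) \<subseteq> convex hull (P ` verts (n + 1))" by (rule hull_mono)
    qed
  qed
  ultimately show ?thesis unfolding triangulation_def using adj(1) by (intro conjI ballI impI)
qed

end

section \<open>Half-turn symmetry\<close>

lemma bar_vert: "1 \<le> k \<Longrightarrow> k \<le> m \<Longrightarrow> bar (vert m k) = vert m (m + k)"
  "1 \<le> k \<Longrightarrow> k \<le> m \<Longrightarrow> bar (vert m (m + k)) = vert m k"
  unfolding vert_def by auto

definition half_turn_invariant :: "nat \<Rightarrow> (nat \<Rightarrow> nat \<Rightarrow> bool) \<Rightarrow> bool" where
  "half_turn_invariant m e \<longleftrightarrow>
     (\<forall>i j. 1 \<le> i \<longrightarrow> i < j \<longrightarrow> j \<le> m \<longrightarrow> e (m + i) (m + j) = e i j) \<and>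
     (\<forall>i j. i \<in> {1..m} \<longrightarrow> j \<in> {1..m} \<longrightarrow> e i (m + j) \<longrightarrow> e j (m + i))"

lemma half_turn_invariantD:
  assumes "half_turn_invariant m e"
  shows "1 \<le> i \<Longrightarrow> i < j \<Longrightarrow> j \<le> m \<Longrightarrow> e (m + i) (m + j) = e i j"
    and "i \<in> {1..m} \<Longrightarrow> j \<in> {1..m} \<Longrightarrow> e i (m + j) \<Longrightarrow> e j (m + i)"
  using assms unfolding half_turn_invariant_def by simp_all

lemma half_turn_invariant_adj:
  assumes n: "n \<ge> 1" and T: "(\<lambda>C. bar ` C) ` T = T"
  shows "half_turn_invariant (Suc n) (adj n T)"
proof -
  let ?m = "Suc n"
  have bar_T: "{bar u, bar v} \<in> T" if "{u, v} \<in> T" for u v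
  proof -
    have "bar ` {u, v} \<in> (\<lambda>C. bar ` C) ` T" using that by (rule imageI)
    then show ?thesis unfolding T by simp
  qed
  have bar_T_iff: "{bar u, bar v} \<in> T \<longleftrightarrow> {u, v} \<in> T" for u v
    using bar_T[of u v] bar_T[of "bar u" "bar v"] unfolding bar_bar by (rule iffI[rotated])
  have 1: "adj n T (?m + i) (?m + j) = adj n T i j" if "1 \<le> i" "i < j" "j \<le> ?m" for i j
  proof -
    have "side n (?m + i) (?m + j) \<in> T \<longleftrightarrow> side n i j \<in> T"
      using bar_T_iff[of "vert ?m i" "vert ?m j"] bar_vert(1)[of i ?m] bar_vert(1)[of j ?m] that by simp
    moreover have "side n (?m + i) (?m + j) \<in> edges n \<longleftrightarrow> side n i j \<in> edges n"
      using edges_iff[OF n, of i j] edges_iff[OF n, of "?m + i" "?m + j"] that by auto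
    ultimately show ?thesis unfolding adj_def Un_iff using that by simp
  qed
  have 2: "adj n T j (?m + i)" if ij: "i \<in> {1..?m}" "j \<in> {1..?m}" and a: "adj n T i (?m + j)" for i j
  proof -
    have "side n i (?m + j) \<in> T \<longleftrightarrow> side n j (?m + i) \<in> T"
      using bar_T_iff[of "vert ?m i" "vert ?m (?m + j)"] bar_vert(1)[of i ?m] bar_vert(2)[of j ?m] ij
      by (simp add: insert_commute)
    moreover have "side n i (?m + j) \<in> edges n \<longleftrightarrow> side n j (?m + i) \<in> edges n"
      using edges_iff[OF n, of i "?m + j"] edges_iff[OF n, of j "?m + i"] ij by auto
    ultimately show ?thesis using a ij unfolding adj_def Un_iff by simp
  qed
  show ?thesis unfolding half_turn_invariant_def using 1 2 by blast
qed

lemma bar_chords_of: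
  assumes n: "n \<ge> 1" and inv: "half_turn_invariant (Suc n) e"
    and e_bounds: "\<And>i j. e i j \<Longrightarrow> 1 \<le> i \<and> i < j \<and> j \<le> 2 * Suc n"
  shows "(\<lambda>C. bar ` C) ` chords_of n e = chords_of n e"
proof -
  let ?m = "Suc n"
  have step: "bar ` C \<in> chords_of n e" if C: "C \<in> chords_of n e" for C
  proof -
    obtain i j where ij: "C = side n i j" "e i j" "C \<notin> edges n"
      using C unfolding chords_of_def by blast
    have bd: "1 \<le> i" "i < j" "j \<le> 2 * ?m" using e_bounds[OF ij(2)] by auto
    have not_edge: "\<not> (j = Suc i \<or> i = 1 \<and> j = 2 * ?m)" using edges_iff[OF n bd] ij(1,3) by blast
    consider (a) "j \<le> ?m" | (b) "i \<le> ?m" "?m < j" | (c) "?m < i" by linarith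
    then obtain k l where kl: "e k l" "bar ` C = side n k l" "\<not> (l = Suc k \<or> k = 1 \<and> l = 2 * ?m)"
    proof cases
      case a
      have "e (?m + i) (?m + j)" using inv ij(2) bd a unfolding half_turn_invariant_def by simp
      moreover have "bar ` C = side n (?m + i) (?m + j)"
        using ij(1) bar_vert(1)[of _ ?m] bd a by simp
      ultimately show ?thesis using that not_edge bd by auto
    next
      case b
      then obtain j' where j': "j = ?m + j'" using less_imp_add_positive by blast
      then have r: "i \<in> {1..?m}" "j' \<in> {1..?m}" using b bd by auto
      have "e j' (?m + i)" using inv ij(2) r unfolding half_turn_invariant_def j' by blast
      moreover have "bar ` C = side n j' (?m + i)"
        using ij(1) bar_vert(1)[of i ?m] bar_vert(2)[of j' ?m] r by (simp add: j' insert_commute)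
      ultimately show ?thesis using that not_edge j' r by auto
    next
      case c
      then obtain i' where i': "i = ?m + i'" using less_imp_add_positive by blast
      then obtain j' where j': "j = ?m + j'" using bd less_imp_add_positive[of ?m j] by auto
      have r: "1 \<le> i'" "i' < j'" "j' \<le> ?m" using i' j' c bd by auto
      have "e i' j'" using inv ij(2) r unfolding half_turn_invariant_def i' j' by blast
      moreover have "bar ` C = side n i' j'"
        using ij(1) bar_vert(2)[of _ ?m] r by (simp add: i' j')
      ultimately show ?thesis using that not_edge i' j' r by auto
    qed
    have "side n k l \<notin> edges n" using edges_iff[OF n, of k l] e_bounds[OF kl(1)] kl(3) by simp
    moreover have "side n k l \<in> {side n i j |i j. e i j}" using kl(1) by blast
    ultimately show ?thesis unfolding chords_of_def kl(2) by (intro DiffI)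
  qed
  show ?thesis
  proof
    show "(\<lambda>C. bar ` C) ` chords_of n e \<subseteq> chords_of n e" using step by blast
    show "chords_of n e \<subseteq> (\<lambda>C. bar ` C) ` chords_of n e"
    proof
      fix C assume "C \<in> chords_of n e"
      then have "bar ` C \<in> chords_of n e" by (rule step)
      moreover have "C = bar ` (bar ` C)" by (simp add: image_image)
      ultimately show "C \<in> (\<lambda>C. bar ` C) ` chords_of n e" by (rule rev_image_eqI)
    qed
  qed
qed

definition pure_part :: "nat \<Rightarrow> (nat \<Rightarrow> nat \<Rightarrow> bool) \<Rightarrow> nat \<Rightarrow> nat \<Rightarrow> bool" where
  "pure_part m e i j \<longleftrightarrow> j \<le> m \<and> e i j"

definition mixed_part :: "nat \<Rightarrow> (nat \<Rightarrow> nat \<Rightarrow> bool) \<Rightarrow> nat \<Rightarrow> nat \<Rightarrow> bool" where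
  "mixed_part m e a b \<longleftrightarrow> a \<in> {1..m} \<and> b \<in> {1..m} \<and> e a (m + b)"

text \<open>The chords on all \<open>2 m\<close> positions; the last case is the half-turn of pure unbarred chords.\<close>

definition symmetric_extension :: "nat \<Rightarrow> (nat \<Rightarrow> nat \<Rightarrow> bool) \<Rightarrow> (nat \<Rightarrow> nat \<Rightarrow> bool) \<Rightarrow> nat \<Rightarrow> nat \<Rightarrow> bool" where
  "symmetric_extension m U X i j \<longleftrightarrow>
     (if j \<le> m then U i j else if i \<le> m then X i (j - m) else U (i - m) (j - m))"

lemma extension_of_parts:
  assumes inv: "half_turn_invariant m e" and bd: "\<And>i j. e i j \<Longrightarrow> 1 \<le> i \<and> i < j \<and> j \<le> 2 * m"
  shows "symmetric_extension m (pure_part m e) (mixed_part m e) = e"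
proof (intro ext)
  fix i j
  consider (a) "j \<le> m" | (b) "i \<le> m" "m < j" | (c) "m < i" "m < j" by linarith
  then show "symmetric_extension m (pure_part m e) (mixed_part m e) i j = e i j"
  proof cases
    case a then show ?thesis unfolding symmetric_extension_def pure_part_def by simp
  next
    case b
    then show ?thesis using bd[of i j] unfolding symmetric_extension_def mixed_part_def by auto
  next
    case c
    have "e (i - m) (j - m) = e i j" if "i < j" "j \<le> 2 * m"
    proof -
      have "e (m + (i - m)) (m + (j - m)) = e (i - m) (j - m)"
        by (rule half_turn_invariantD(1)[OF inv]) (use c that in auto)
      then show ?thesis using c by simp
    qed
    then show ?thesis using c bd[of i j] bd[of "i - m" "j - m"]
      unfolding symmetric_extension_def pure_part_def by auto
  qed
qed

context half_noncrossing
begin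

abbreviation "position_chords \<equiv> symmetric_extension (Suc n) chordU chordX"

lemma position_chords_parts:
  "chordU i j = (j \<le> Suc n \<and> position_chords i j)"
  "chordX a b = (a \<in> {1..Suc n} \<and> b \<in> {1..Suc n} \<and> position_chords a (Suc n + b))"
  unfolding symmetric_extension_def chordU_def using chordX_bounds[of a b] by auto

lemma position_chords_bounds: "position_chords i j \<Longrightarrow> 1 \<le> i \<and> i < j \<and> j \<le> 2 * Suc n"
  unfolding symmetric_extension_def chordU_def using chordX_bounds[of i "j - Suc n"]
  by (auto split: if_splits)

lemma chordU_D: "chordU i j \<Longrightarrow> 1 \<le> i \<and> i < j \<and> j \<le> Suc n"
  unfolding chordU_def by blast

lemma position_chords_noncrossing:
  assumes ij: "position_chords i j" and kl: "position_chords k l" and lt: "i < k" "k < j"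
  shows "l \<le> j"
proof -
  let ?m = "Suc n"
  have bd: "1 \<le> i" "i < j" "j \<le> 2 * ?m" "1 \<le> k" "k < l" "l \<le> 2 * ?m"
    using position_chords_bounds ij kl by blast+
  consider (a) "j \<le> ?m" | (b) "i \<le> ?m" "?m < j" | (c) "?m < i" by linarith
  then show ?thesis
  proof cases
    case a
    then have U: "chordU i j" using ij unfolding symmetric_extension_def by simp
    show ?thesis
    proof (cases "l \<le> ?m")
      case True
      then have "chordU k l" using kl unfolding symmetric_extension_def by simp
      then show ?thesis using chordU_U U lt by blast
    next
      case False
      then have "chordX k (l - ?m)" using kl lt a unfolding symmetric_extension_def by simp
      then show ?thesis using chordU_X[OF U _ lt(1)] lt(2) by fastforce
    qed
  next
    case b
    then have X: "chordX i (j - ?m)" using ij unfolding symmetric_extension_def by simp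
    show ?thesis
    proof (cases "l \<le> ?m \<or> ?m < k")
      case True
      show ?thesis
      proof (cases "l \<le> ?m")
        case True then show ?thesis using b by simp
      next
        case False
        then have k: "?m < k" using True by blast
        then have "chordU (k - ?m) (l - ?m)" using kl bd unfolding symmetric_extension_def by simp
        then have "l - ?m \<le> j - ?m" using chordU_X[OF _ chordX_sym[OF X]] k lt by simp
        then show ?thesis using b by simp
      qed
    next
      case False
      then have "chordX k (l - ?m)" using kl unfolding symmetric_extension_def by simp
      then have "l - ?m \<le> j - ?m" using chordX_X[OF X] lt by simp
      then show ?thesis using b by simp
    qed
  next
    case c
    then have "chordU (i - ?m) (j - ?m)" "chordU (k - ?m) (l - ?m)"
      using ij kl bd lt unfolding symmetric_extension_def by (auto split: if_splits)
    then have "l - ?m \<le> j - ?m" using chordU_U c lt by (meson diff_less_mono less_imp_le less_trans)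
    then show ?thesis using c bd by simp
  qed
qed

lemma position_triangulation_position_chords:
  assumes "n \<ge> 1" shows "position_triangulation (2 * Suc n) position_chords"
proof
  let ?m = "Suc n"
  show "1 \<le> i \<and> i < j \<and> j \<le> 2 * ?m" if "position_chords i j" for i j
    using position_chords_bounds that .
  show "position_chords i (Suc i)" if i: "1 \<le> i" "i < 2 * ?m" for i
  proof -
    consider "i < ?m" | "i = ?m" | "?m < i" by linarith
    then show ?thesis
    proof cases
      case 1 then show ?thesis using chordU_edge[of i] i unfolding symmetric_extension_def by simp
    next
      case 2 then show ?thesis using chordX_sym[OF chordX_edge] unfolding symmetric_extension_def by simp
    next
      case 3
      then have "i - ?m \<in> {1..n}" "Suc i - ?m = Suc (i - ?m)" using i by auto
      then show ?thesis using chordU_edge[of "i - ?m"] 3 unfolding symmetric_extension_def by simp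
    qed
  qed
  show "position_chords 1 (2 * ?m)" using chordX_edge unfolding symmetric_extension_def by simp
  show "l \<le> j" if "position_chords i j" "position_chords k l" "i < k" "k < j" for i j k l
    using position_chords_noncrossing that .
  show "\<exists>k. i < k \<and> k < j \<and> position_chords i k \<and> position_chords k j"
    if ij: "position_chords i j" and lt: "Suc i < j" for i j
  proof -
    have bd: "1 \<le> i" "i < j" "j \<le> 2 * ?m" using position_chords_bounds[OF ij] by auto
    consider (a) "j \<le> ?m" | (b) "i \<le> ?m" "?m < j" | (c) "?m < i" by linarith
    then show ?thesis
    proof cases
      case a
      then have "chordU i j" using ij unfolding symmetric_extension_def by simp
      then obtain k where "i < k" "k < j" "chordU i k" "chordU k j" using chordU_inner lt by blast
      then show ?thesis using a unfolding symmetric_extension_def by (intro exI[of _ k]) auto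
    next
      case b
      define b' where "b' = j - ?m"
      have j: "j = ?m + b'" using b unfolding b'_def by simp
      have X: "chordX i b'" using ij b unfolding symmetric_extension_def b'_def by simp
      have "(i, b') \<noteq> (?m, 1)" using lt j by auto
      then consider k where "k > i" "chordU i k" "chordX k b'" | k where "k < b'" "chordU k b'" "chordX i k"
        using chordX_inner[OF X] by blast
      then show ?thesis
      proof cases
        case 1
        then have "k \<le> ?m" using chordU_D by blast
        then show ?thesis using 1 b j unfolding symmetric_extension_def by (intro exI[of _ k]) auto
      next
        case 2
        then have "1 \<le> k" using chordU_D by blast
        then show ?thesis using 2 b j unfolding symmetric_extension_def by (intro exI[of _ "?m + k"]) auto
      qed
    next
      case c
      then have "chordU (i - ?m) (j - ?m)" using ij bd unfolding symmetric_extension_def by simp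
      moreover have "Suc (i - ?m) < j - ?m" using lt c by simp
      ultimately obtain k where k: "i - ?m < k" "k < j - ?m" "chordU (i - ?m) k" "chordU k (j - ?m)"
        using chordU_inner by blast
      then have "1 \<le> k" using chordU_D by blast
      then show ?thesis using k c unfolding symmetric_extension_def by (intro exI[of _ "?m + k"]) auto
    qed
  qed
qed

lemma half_turn_invariant_position_chords: "half_turn_invariant (Suc n) position_chords"
  unfolding half_turn_invariant_def symmetric_extension_def
  using chordX_sym by auto

end

section \<open>The bijection\<close>

lemma triangle_adj:
  "{i, j, k} \<in> position_triangles n T \<Longrightarrow> a \<in> {i, j, k} \<Longrightarrow> b \<in> {i, j, k} \<Longrightarrow> a < b \<Longrightarrow> adj n T a b"
  unfolding position_triangles_def by blast

locale symmetric_triangulation = convex_polygon +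
  fixes T :: "vertex set set"
  assumes T_B: "T \<in> triangulations_B n P"
begin

abbreviation "m \<equiv> Suc n"

lemma T: "triangulation n P T" "(\<lambda>C. bar ` C) ` T = T" "T \<subseteq> chords n"
proof -
  show 1: "triangulation n P T" "(\<lambda>C. bar ` C) ` T = T" using T_B unfolding triangulations_B_def by simp_all
  show "T \<subseteq> chords n" using 1(1) unfolding triangulation_def by (elim conjE)
qed

abbreviation "U \<equiv> pure_part m (adj n T)"
abbreviation "X \<equiv> mixed_part m (adj n T)"

lemma invariant: "half_turn_invariant m (adj n T)"
  by (rule half_turn_invariant_adj[OF n_ge T(2)])

sublocale pt: position_triangulation "2 * m" "adj n T"
  by (rule position_triangulation_adj[OF T(1)])

lemma adj_barred: "1 \<le> i \<Longrightarrow> i < j \<Longrightarrow> j \<le> m \<Longrightarrow> adj n T (m + i) (m + j) = U i j"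
  using half_turn_invariantD(1)[OF invariant] unfolding pure_part_def by simp

sublocale half_triangulation m U X
proof
  show "2 \<le> m" using n_ge by simp
  show U_bd: "1 \<le> i \<and> i < j \<and> j \<le> m" if "U i j" for i j
    using that pt.e_bounds unfolding pure_part_def by blast
  show "1 \<le> a \<and> a \<le> m \<and> 1 \<le> b \<and> b \<le> m" if "X a b" for a b
    using that unfolding mixed_part_def by simp
  show "U i (Suc i)" if "1 \<le> i" "i < m" for i
    using adj_edge[of i T] that unfolding pure_part_def by simp
  show "X m 1" using adj_edge[of m T] unfolding mixed_part_def by simp
  show "X b a" if "X a b" for a b
    using that half_turn_invariantD(2)[OF invariant] unfolding mixed_part_def by blast
  show "l \<le> j" if "U i j" "U k l" "i < k" "k < j" for i j k l
    using that pt.e_nc unfolding pure_part_def by blast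
  show False if "U i j" "X a b" "i < a" "a < j" for i j a b
    using that pt.e_nc[of i j a "m + b"] unfolding pure_part_def mixed_part_def by auto
  show False if "X a b" "X c d" "a < c" "b < d" for a b c d
    using that pt.e_nc[of a "m + b" c "m + d"] unfolding mixed_part_def by auto
  show "(\<exists>k>j. U i k \<and> U j k) \<or> (\<exists>k<i. U k i \<and> U k j) \<or> (\<exists>b. X i b \<and> X j b)" if U: "U i j" for i j
  proof -
    have bd: "1 \<le> i" "i < j" "j \<le> m" and a: "adj n T i j" using U_bd[OF U] U unfolding pure_part_def by auto
    have "2 * m \<in> {1..2 * m}" "2 * m \<notin> {i, j}" using bd by auto
    then obtain k where k: "k \<in> {1..2 * m}" "k \<notin> {i, j}" "{i, j, k} \<in> position_triangles n T"
      "(i < k \<and> k < j) = (i < 2 * m \<and> 2 * m < j)" using triangulation_triangle[OF T(1) a] by blast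
    note tri = triangle_adj[OF k(3)]
    consider "k < i" | "j < k" "k \<le> m" | "m < k" using k(2,4) bd by fastforce
    then show ?thesis
    proof cases
      case 1
      then have "U k i" "U k j" using tri[of k i] tri[of k j] bd unfolding pure_part_def by auto
      then show ?thesis using 1 by blast
    next
      case 2
      then have "U i k" "U j k" using tri[of i k] tri[of j k] bd unfolding pure_part_def by auto
      then show ?thesis using 2 by blast
    next
      case 3
      then have "m + (k - m) = k" "k - m \<in> {1..m}" using k(1) by auto
      then have "X i (k - m)" "X j (k - m)" using tri[of i k] tri[of j k] bd 3 unfolding mixed_part_def by auto
      then show ?thesis by blast
    qed
  qed
  show "(\<exists>k>a. U a k \<and> X k b) \<or> (\<exists>k<b. U k b \<and> X a k)" if X: "X a b" and ne: "(a, b) \<noteq> (m, 1)" for a b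
  proof -
    have bd: "a \<in> {1..m}" "b \<in> {1..m}" and e: "adj n T a (m + b)" using X unfolding mixed_part_def by auto
    have "Suc a < m + b" using bd ne by (cases "b = 1") auto
    then obtain k where k: "a < k" "k < m + b" "adj n T a k" "adj n T k (m + b)" using pt.e_inner[OF e] by blast
    show ?thesis
    proof (cases "k \<le> m")
      case True
      then have "U a k" "X k b" using k bd unfolding pure_part_def mixed_part_def by auto
      then show ?thesis using k(1) by blast
    next
      case False
      define k' where "k' = k - m"
      have k': "k = m + k'" "1 \<le> k'" "k' < b" using False k(2) unfolding k'_def by auto
      have "X a k'" using k(3) k' bd unfolding mixed_part_def by auto
      moreover have "U k' b" using k(4) adj_barred[of k' b] k' bd by simp
      ultimately show ?thesis using k'(3) by blast
    qed
  qed
qed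

definition joined :: "vertex \<Rightarrow> vertex \<Rightarrow> bool" where "joined u v \<longleftrightarrow> {u, v} \<in> edges n \<union> T"

lemma joined_sym: "joined u v = joined v u" unfolding joined_def by (simp add: insert_commute)

lemma joined_adj: "1 \<le> i \<Longrightarrow> i < j \<Longrightarrow> j \<le> 2 * m \<Longrightarrow> joined (vert m i) (vert m j) = adj n T i j"
  unfolding joined_def adj_def by simp

lemma vert_cases: "i \<le> m \<Longrightarrow> vert m i = Unbarred i" "1 \<le> i \<Longrightarrow> vert m (Suc (n + i)) = Barred i"
  unfolding vert_def by auto

lemma joined_UU: "1 \<le> i \<Longrightarrow> i < j \<Longrightarrow> j \<le> m \<Longrightarrow> joined (Unbarred i) (Unbarred j) = U i j"
  using joined_adj[of i j] unfolding pure_part_def by (simp add: vert_cases)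

lemma joined_BB: "1 \<le> i \<Longrightarrow> i < j \<Longrightarrow> j \<le> m \<Longrightarrow> joined (Barred i) (Barred j) = U i j"
  using joined_adj[of "m + i" "m + j"] adj_barred[of i j] by (simp add: vert_cases)

lemma joined_pure:
  "K = Unbarred \<or> K = Barred \<Longrightarrow> 1 \<le> i \<Longrightarrow> i < j \<Longrightarrow> j \<le> m \<Longrightarrow> joined (K i) (K j) = U i j"
  using joined_UU joined_BB by auto

lemma joined_UB: "1 \<le> a \<Longrightarrow> a \<le> m \<Longrightarrow> 1 \<le> b \<Longrightarrow> b \<le> m \<Longrightarrow> joined (Unbarred a) (Barred b) = X a b"
  using joined_adj[of a "m + b"] unfolding mixed_part_def by (simp add: vert_cases)

text \<open>\<open>triangles\<close> contains all triples of pairwise joined vertices, so the corners of \<open>Q(C)\<close> other than those of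
  \<open>C\<close> are the common neighbours.\<close>

lemma quad_iff:
  assumes "{u, v} \<in> T" "u \<noteq> v" "w \<notin> {u, v}"
  shows "w \<in> quad n T {u, v} \<longleftrightarrow> w \<in> verts m \<and> joined u w \<and> joined v w"
proof
  assume "w \<in> quad n T {u, v}"
  then obtain t where t: "t \<in> triangles n T" "{u, v} \<subseteq> t" "w \<in> t" unfolding quad_def by blast
  have "\<forall>x\<in>t. \<forall>y\<in>t. x \<noteq> y \<longrightarrow> {x, y} \<in> edges n \<union> T" "t \<subseteq> verts m"
    using t(1) unfolding triangles_def by simp_all
  then show "w \<in> verts m \<and> joined u w \<and> joined v w" using t assms(3) unfolding joined_def by auto
next
  assume w: "w \<in> verts m \<and> joined u w \<and> joined v w"
  have "{u, v} \<subseteq> verts m" using assms(1) T(3) unfolding chords_def by auto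
  moreover have "card {u, v, w} = 3" using assms by auto
  moreover have "joined u v" using assms(1) unfolding joined_def by blast
  then have "\<forall>x\<in>{u, v, w}. \<forall>y\<in>{u, v, w}. x \<noteq> y \<longrightarrow> {x, y} \<in> edges n \<union> T"
    using w joined_sym unfolding joined_def[symmetric] by auto
  ultimately have "{u, v, w} \<in> triangles n T" using w unfolding triangles_def by simp
  then show "w \<in> quad n T {u, v}" unfolding quad_def by blast
qed

lemma T_verts: "{u, v} \<in> T \<Longrightarrow> u \<in> verts m \<and> v \<in> verts m"
  using T(3) unfolding chords_def by auto

lemma labelled_in_verts [simp]: "Unbarred i \<in> verts m \<longleftrightarrow> i \<in> {1..m}" "Barred i \<in> verts m \<longleftrightarrow> i \<in> {1..m}"
  unfolding verts_def by auto

lemma red_pure: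
  assumes K: "K = Unbarred \<or> K = Barred" and C: "{K i, K j} \<in> T" and lt: "i < j"
  shows "red n T {K i, K j} \<longleftrightarrow> redU i j"
proof -
  have mem: "K k \<in> verts m \<longleftrightarrow> k \<in> {1..m}" for k using K by auto
  have bd: "1 \<le> i" "j \<le> m" using T_verts[OF C] mem by auto
  have "U i j" using joined_pure[OF K bd(1) lt bd(2)] C unfolding joined_def by simp
  have pure: "pure {K i, K j}" unfolding pure_def same_type_def using K by auto
  have higher: "(\<forall>u\<in>{K i, K j}. same_type u v \<and> label u < label v) \<longleftrightarrow>
      (\<exists>k. v = K k \<and> i < k \<and> j < k)" for v
    using K by (cases v) (auto simp: same_type_def)
  have "red n T {K i, K j} \<longleftrightarrow> (\<exists>k. i < k \<and> j < k \<and> K k \<in> quad n T {K i, K j})"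
    unfolding red_def higher using pure by (simp only: if_True) blast
  also have "\<dots> \<longleftrightarrow> (\<exists>k>j. U i k \<and> U j k)"
  proof (intro iffI; elim exE conjE)
    fix k assume k: "i < k" "j < k" "K k \<in> quad n T {K i, K j}"
    have "K i \<noteq> K j" "K k \<notin> {K i, K j}" using K k lt by auto
    then have "k \<in> {1..m}" "joined (K i) (K k)" "joined (K j) (K k)"
      using quad_iff[OF C] k(3) mem by blast+
    then show "\<exists>k>j. U i k \<and> U j k"
      using joined_pure[OF K, of i k] joined_pure[OF K, of j k] k bd lt by auto
  next
    fix k assume k: "j < k" "U i k" "U j k"
    then have "k \<le> m" using U_bounds by blast
    moreover have "K i \<noteq> K j" "K k \<notin> {K i, K j}" using K k(1) lt by auto
    ultimately have "K k \<in> quad n T {K i, K j}"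
      using quad_iff[OF C] joined_pure[OF K, of i k] joined_pure[OF K, of j k] k bd lt mem by simp
    then show "\<exists>k. i < k \<and> j < k \<and> K k \<in> quad n T {K i, K j}" using k(1) lt by (intro exI[of _ k]) simp
  qed
  finally show ?thesis unfolding redU_def using \<open>U i j\<close> by simp
qed

lemma red_mixed:
  assumes C: "{Unbarred a, Barred b} \<in> T"
  shows "red n T {Unbarred a, Barred b} \<longleftrightarrow> redX a b"
proof -
  let ?Q = "quad n T {Unbarred a, Barred b}"
  have bd: "1 \<le> a" "a \<le> m" "1 \<le> b" "b \<le> m" using T_verts[OF C] by auto
  have "X a b" using joined_UB[OF bd] C unfolding joined_def by simp
  have pure: "\<not> pure {Unbarred a, Barred b}" unfolding pure_def same_type_def by auto
  have "red n T {Unbarred a, Barred b} \<longleftrightarrow> (\<exists>k>a. Unbarred k \<in> ?Q) \<or> (\<exists>k>b. Barred k \<in> ?Q)"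
    unfolding red_def using pure
  proof (simp only: if_False, intro iffI)
    assume "\<exists>v\<in>?Q. \<exists>u\<in>{Unbarred a, Barred b}. same_type u v \<and> label u < label v"
    then obtain v where v: "v \<in> ?Q" "is_Unbarred v \<and> a < label v \<or> \<not> is_Unbarred v \<and> b < label v"
      unfolding same_type_def by auto
    then show "(\<exists>k>a. Unbarred k \<in> ?Q) \<or> (\<exists>k>b. Barred k \<in> ?Q)" by (cases v) auto
  next
    assume "(\<exists>k>a. Unbarred k \<in> ?Q) \<or> (\<exists>k>b. Barred k \<in> ?Q)"
    then show "\<exists>v\<in>?Q. \<exists>u\<in>{Unbarred a, Barred b}. same_type u v \<and> label u < label v"
      unfolding same_type_def by force
  qed
  also have "(\<exists>k>a. Unbarred k \<in> ?Q) \<longleftrightarrow> (\<exists>k>a. U a k \<and> X k b)"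
  proof (intro iffI; elim exE conjE)
    fix k assume k: "a < k" "Unbarred k \<in> ?Q"
    then have "k \<in> {1..m}" "joined (Unbarred a) (Unbarred k)" "joined (Unbarred k) (Barred b)"
      using quad_iff[OF C, of "Unbarred k"] joined_sym[of "Unbarred k"] by auto
    then show "\<exists>k>a. U a k \<and> X k b" using joined_UU[of a k] joined_UB[of k b] k bd by auto
  next
    fix k assume k: "a < k" "U a k" "X k b"
    then have "k \<le> m" using U_bounds by blast
    then show "\<exists>k>a. Unbarred k \<in> ?Q"
      using quad_iff[OF C, of "Unbarred k"] joined_UU[of a k] joined_UB[of k b] joined_sym[of "Barred b" "Unbarred k"] k bd
      by (intro exI[of _ k]) auto
  qed
  also have "(\<exists>k>b. Barred k \<in> ?Q) \<longleftrightarrow> (\<exists>k>b. U b k \<and> X a k)"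
  proof (intro iffI; elim exE conjE)
    fix k assume k: "b < k" "Barred k \<in> ?Q"
    then have "k \<in> {1..m}" "joined (Barred b) (Barred k)" "joined (Unbarred a) (Barred k)"
      using quad_iff[OF C, of "Barred k"] by auto
    then show "\<exists>k>b. U b k \<and> X a k" using joined_BB[of b k] joined_UB[of a k] k bd by auto
  next
    fix k assume k: "b < k" "U b k" "X a k"
    then have "k \<le> m" using U_bounds by blast
    then show "\<exists>k>b. Barred k \<in> ?Q"
      using quad_iff[OF C, of "Barred k"] joined_BB[of b k] joined_UB[of a k] k bd by (intro exI[of _ k]) auto
  qed
  finally show ?thesis unfolding redX_def using \<open>X a b\<close> by simp
qed

definition cut :: "vertex \<Rightarrow> vertex \<Rightarrow> bool" where
  "cut x y \<longleftrightarrow> (\<exists>C\<in>T. red n T C \<and> separates n C x y)"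

lemma U_chord_or_edge:
  assumes K: "K = Unbarred \<or> K = Barred" and U: "U i j"
  shows "{K i, K j} \<in> T \<or> j = Suc i"
proof -
  have bd: "1 \<le> i" "i < j" "j \<le> m" using U_bounds[OF U] by auto
  have "{K i, K j} \<in> edges n \<union> T" using joined_pure[OF K bd] U unfolding joined_def by simp
  moreover have "{K i, K j} \<in> edges n \<longleftrightarrow> j = Suc i"
    using K edges_iff[OF n_ge bd(1,2)] edges_iff[OF n_ge, of "m + i" "m + j"] bd
    by (elim disjE) (simp_all add: vert_cases)
  ultimately show ?thesis by blast
qed

lemma X_chord_or_edge: assumes "X a b"
  shows "{Unbarred a, Barred b} \<in> T \<or> a = m \<and> b = 1 \<or> a = 1 \<and> b = m"
proof -
  have bd: "1 \<le> a" "a \<le> m" "1 \<le> b" "b \<le> m" using X_bounds[OF assms] by auto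
  have "{Unbarred a, Barred b} \<in> edges n \<union> T" using joined_UB[OF bd] assms unfolding joined_def by simp
  moreover have "{Unbarred a, Barred b} \<in> edges n \<Longrightarrow> a = m \<and> b = 1 \<or> a = 1 \<and> b = m"
    using edges_iff[OF n_ge, of a "m + b"] bd by (auto simp: vert_cases)
  ultimately show ?thesis by blast
qed

lemma mixed_side_iff:
  "i \<le> n \<Longrightarrow> Unbarred i \<in> mixed_side n a b \<longleftrightarrow> a \<le> i"
  "1 \<le> i \<Longrightarrow> Barred i \<in> mixed_side n a b \<longleftrightarrow> i < b"
  unfolding mixed_side_def by auto

text \<open>Replaces red chords by \<open>redX\<close> and \<open>redU\<close>. The latter include polygon edges, but an edge joining \<open>m\<close> and \<open>bar 1\<close>,
  or \<open>1\<close> and \<open>bar m\<close>, has all labels up to \<open>n\<close> on one side after moving, and a pure edge has no label strictly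
  between its ends.\<close>

lemma cut_iff:
  assumes x: "x \<in> verts n" and y: "y \<in> verts n"
  shows "cut x y \<longleftrightarrow>
     (\<exists>a b. redX a b \<and> (x \<in> mixed_side n a b) \<noteq> (y \<in> mixed_side n a b)) \<or>
     (\<exists>a b. redU a b \<and> (x \<in> Unbarred ` {a<..<b}) \<noteq> (y \<in> Unbarred ` {a<..<b})) \<or>
     (\<exists>a b. redU a b \<and> (x \<in> Barred ` {a<..<b}) \<noteq> (y \<in> Barred ` {a<..<b}))"
    (is "_ \<longleftrightarrow> ?M \<or> ?U \<or> ?B")
proof
  assume "cut x y"
  then obtain C where C: "C \<in> T" "red n T C" and s: "separates n C x y" unfolding cut_def by blast
  from s show "?M \<or> ?U \<or> ?B" unfolding separates_def
  proof (elim disjE exE conjE)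
    fix a b assume "C = {Unbarred a, Barred b}" "(x \<in> mixed_side n a b) \<noteq> (y \<in> mixed_side n a b)"
    moreover have "redX a b" using red_mixed[of a b] C calculation(1) by simp
    ultimately show ?thesis by blast
  next
    fix a b assume "a < b" "C = {Unbarred a, Unbarred b}"
      "(x \<in> Unbarred ` {a<..<b}) \<noteq> (y \<in> Unbarred ` {a<..<b})"
    moreover have "redU a b" using red_pure[of Unbarred a b] C calculation(1,2) by simp
    ultimately show ?thesis by blast
  next
    fix a b assume "a < b" "C = {Barred a, Barred b}"
      "(x \<in> Barred ` {a<..<b}) \<noteq> (y \<in> Barred ` {a<..<b})"
    moreover have "redU a b" using red_pure[of Barred a b] C calculation(1,2) by simp
    ultimately show ?thesis by blast
  qed
next
  have found: "cut x y" if "C \<in> T" "red n T C" "separates n C x y" for C using that unfolding cut_def by blast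
  assume "?M \<or> ?U \<or> ?B"
  then show "cut x y"
  proof (elim disjE exE conjE)
    fix a b assume r: "redX a b" and s: "(x \<in> mixed_side n a b) \<noteq> (y \<in> mixed_side n a b)"
    have "z \<notin> mixed_side n m 1" "z \<in> mixed_side n 1 m" if "z \<in> verts n" for z
      using that unfolding verts_def by (auto simp: mixed_side_iff)
    then have "\<not> (a = m \<and> b = 1)" "\<not> (a = 1 \<and> b = m)" using s x y by blast+
    moreover have "X a b" using r unfolding redX_def by blast
    ultimately have C: "{Unbarred a, Barred b} \<in> T" using X_chord_or_edge by blast
    show ?thesis
    proof (rule found[OF C])
      show "red n T {Unbarred a, Barred b}" using red_mixed[OF C] r by simp
      show "separates n {Unbarred a, Barred b} x y"
        unfolding separates_def by (rule disjI1, rule exI[of _ a], rule exI[of _ b], rule conjI[OF refl s])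
    qed
  next
    fix a b assume r: "redU a b" and s: "(x \<in> Unbarred ` {a<..<b}) \<noteq> (y \<in> Unbarred ` {a<..<b})"
    have U: "U a b" using r unfolding redU_def by blast
    then have lt: "a < b" using U_bounds by blast
    have "b \<noteq> Suc a" using s by auto
    then have C: "{Unbarred a, Unbarred b} \<in> T" using U_chord_or_edge[of Unbarred, OF _ U] by blast
    show ?thesis
    proof (rule found[OF C])
      show "red n T {Unbarred a, Unbarred b}" using red_pure[of Unbarred, OF _ C lt] r by simp
      show "separates n {Unbarred a, Unbarred b} x y"
        unfolding separates_def by (rule disjI2, rule disjI1, rule exI[of _ a], rule exI[of _ b], rule conjI[OF lt conjI[OF refl s]])
    qed
  next
    fix a b assume r: "redU a b" and s: "(x \<in> Barred ` {a<..<b}) \<noteq> (y \<in> Barred ` {a<..<b})"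
    have U: "U a b" using r unfolding redU_def by blast
    then have lt: "a < b" using U_bounds by blast
    have "b \<noteq> Suc a" using s by auto
    then have C: "{Barred a, Barred b} \<in> T" using U_chord_or_edge[of Barred, OF _ U] by blast
    show ?thesis
    proof (rule found[OF C])
      show "red n T {Barred a, Barred b}" using red_pure[of Barred, OF _ C lt] r by simp
      show "separates n {Barred a, Barred b} x y"
        unfolding separates_def by (rule disjI2, rule disjI2, rule exI[of _ a], rule exI[of _ b], rule conjI[OF lt conjI[OF refl s]])
    qed
  qed
qed

lemma image_iff_label:
  "Unbarred i \<in> Unbarred ` A \<longleftrightarrow> i \<in> A" "Barred i \<in> Barred ` A \<longleftrightarrow> i \<in> A"
  "Unbarred i \<notin> Barred ` A" "Barred i \<notin> Unbarred ` A"
  by auto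

lemma not_cut_iff_same_block:
  assumes x: "x \<in> verts n" and y: "y \<in> verts n"
  shows "\<not> cut x y \<longleftrightarrow> same_block E F x y"
proof -
  show ?thesis
  proof (cases x; cases y)
    fix i j assume xy: "x = Unbarred i" "y = Unbarred j"
    note mem = x[unfolded xy(1)] y[unfolded xy(2)]
    have ij: "i \<in> {1..<m}" "j \<in> {1..<m}" "i \<le> n" "j \<le> n" using mem unfolding verts_def by auto
    have "\<not> cut (Unbarred i) (Unbarred j) \<longleftrightarrow> (\<forall>a b. redU a b \<longrightarrow> (a < i \<and> i < b) = (a < j \<and> j < b)) \<and>
       (\<forall>a b. redX a b \<longrightarrow> (a \<le> i) = (a \<le> j))"
      unfolding cut_iff[OF mem] mixed_side_iff(1)[OF ij(3)] mixed_side_iff(1)[OF ij(4)] image_iff_label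
        greaterThanLessThan_iff by auto
    then show ?thesis unfolding xy same_block.simps E_def using ij(1,2) by (simp only: simp_thms)
  next
    fix i j assume xy: "x = Unbarred i" "y = Barred j"
    note mem = x[unfolded xy(1)] y[unfolded xy(2)]
    have ij: "i \<in> {1..<m}" "j \<in> {1..<m}" "i \<le> n" "1 \<le> j" using mem unfolding verts_def by auto
    have "\<not> cut (Unbarred i) (Barred j) \<longleftrightarrow> (\<forall>a b. redU a b \<longrightarrow> \<not> (a < i \<and> i < b) \<and> \<not> (a < j \<and> j < b)) \<and>
       (\<forall>a b. redX a b \<longrightarrow> (a \<le> i) = (j < b))"
      unfolding cut_iff[OF mem] mixed_side_iff(1)[OF ij(3)] mixed_side_iff(2)[OF ij(4)] image_iff_label
        greaterThanLessThan_iff by auto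
    then show ?thesis unfolding xy same_block.simps F_def using ij(1,2) by (simp only: simp_thms)
  next
    fix i j assume xy: "x = Barred i" "y = Unbarred j"
    note mem = x[unfolded xy(1)] y[unfolded xy(2)]
    have ij: "i \<in> {1..<m}" "j \<in> {1..<m}" "1 \<le> i" "j \<le> n" using mem unfolding verts_def by auto
    have "\<not> cut (Barred i) (Unbarred j) \<longleftrightarrow> (\<forall>a b. redU a b \<longrightarrow> \<not> (a < i \<and> i < b) \<and> \<not> (a < j \<and> j < b)) \<and>
       (\<forall>a b. redX a b \<longrightarrow> (i < b) = (a \<le> j))"
      unfolding cut_iff[OF mem] mixed_side_iff(2)[OF ij(3)] mixed_side_iff(1)[OF ij(4)] image_iff_label
        greaterThanLessThan_iff by auto
    also have "(\<forall>a b. redX a b \<longrightarrow> (i < b) = (a \<le> j)) \<longleftrightarrow> (\<forall>a b. redX a b \<longrightarrow> (a \<le> i) = (j < b))"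
      using redX_sym by (meson not_le)
    finally show ?thesis unfolding xy same_block.simps F_def using ij(1,2) by (simp only: simp_thms)
  next
    fix i j assume xy: "x = Barred i" "y = Barred j"
    note mem = x[unfolded xy(1)] y[unfolded xy(2)]
    have ij: "i \<in> {1..<m}" "j \<in> {1..<m}" "1 \<le> i" "1 \<le> j" using mem unfolding verts_def by auto
    have "\<not> cut (Barred i) (Barred j) \<longleftrightarrow> (\<forall>a b. redU a b \<longrightarrow> (a < i \<and> i < b) = (a < j \<and> j < b)) \<and>
       (\<forall>a b. redX a b \<longrightarrow> (i < b) = (j < b))"
      unfolding cut_iff[OF mem] mixed_side_iff(2)[OF ij(3)] mixed_side_iff(2)[OF ij(4)] image_iff_label
        greaterThanLessThan_iff by auto
    also have "(\<forall>a b. redX a b \<longrightarrow> (i < b) = (j < b)) \<longleftrightarrow> (\<forall>a b. redX a b \<longrightarrow> (a \<le> i) = (a \<le> j))"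
      using redX_sym by (meson not_le)
    finally show ?thesis unfolding xy same_block.simps E_def using ij(1,2) by (simp only: simp_thms)
  qed
qed

lemma half_noncrossing: "half_noncrossing n E F"
  using nc.half_noncrossing_axioms by simp

lemma psi_eq_blocks: "psi n T = blocks n E F"
proof -
  have "{(x, y). x \<in> verts n \<and> y \<in> verts n \<and> \<not> cut x y} = {(x, y). same_block E F x y}"
    using not_cut_iff_same_block half_noncrossing.same_block_mem[OF half_noncrossing] by blast
  then show ?thesis unfolding psi_def blocks_def cut_def by simp
qed

text \<open>A triangulation is contained in the noncrossing chord set of its own partition, and it is maximal.\<close>

lemma adj_eq_position_chords: "adj n T = half_noncrossing.position_chords n E F"
proof -
  interpret h: half_noncrossing n E F by (rule half_noncrossing)
  have sub: "h.position_chords i j" if e: "adj n T i j" for i j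
  proof -
    have "symmetric_extension m U X i j"
      using extension_of_parts[OF invariant pt.e_bounds] e by simp
    then show ?thesis using U_imp_chordU X_imp_chordX
      unfolding symmetric_extension_def by (simp split: if_splits)
  qed
  show ?thesis
  proof (intro ext iffI)
    fix i j assume ij: "h.position_chords i j"
    show "adj n T i j"
    proof (rule pt.maximal[where e' = h.position_chords])
      show "l \<le> j" if "h.position_chords i j" "h.position_chords k l" "i < k" "k < j" for i j k l
        using h.position_chords_noncrossing that .
    qed (use sub ij h.position_chords_bounds[OF ij] in blast)+
  qed (rule sub)
qed

end

theorem proposition7:
  fixes n :: nat and P :: "vertex \<Rightarrow> complex"
  assumes "n \<ge> 1"
    and "convex_cs_polygon n P"
  shows "bij_betw (psi n) (triangulations_B n P) (NC_B n)"
proof -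
  interpret convex_polygon n P by unfold_locales fact+
  have sym: "symmetric_triangulation n P T" if "T \<in> triangulations_B n P" for T
    by unfold_locales (rule that)
  show ?thesis
  proof (rule bij_betw_imageI)
    show "inj_on (psi n) (triangulations_B n P)"
    proof (rule inj_onI)
      fix S T assume S: "S \<in> triangulations_B n P" and T: "T \<in> triangulations_B n P" and eq: "psi n S = psi n T"
      interpret S: symmetric_triangulation n P S by (rule sym[OF S])
      interpret T: symmetric_triangulation n P T by (rule sym[OF T])
      have "blocks n S.E S.F = blocks n T.E T.F" using eq S.psi_eq_blocks T.psi_eq_blocks by simp
      then have "S.E = T.E" "S.F = T.F" using blocks_inj[OF S.half_noncrossing T.half_noncrossing] by blast+
      then have adj: "adj n S = adj n T" using S.adj_eq_position_chords T.adj_eq_position_chords by simp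
      show "S = T" using chords_of_adj[OF S.T(3)] chords_of_adj[OF T.T(3)] unfolding adj by (rule trans[OF HOL.sym])
    qed
    show "psi n ` triangulations_B n P = NC_B n"
    proof
      show "psi n ` triangulations_B n P \<subseteq> NC_B n"
      proof safe
        fix T assume T: "T \<in> triangulations_B n P"
        interpret T: symmetric_triangulation n P T by (rule sym[OF T])
        show "psi n T \<in> NC_B n"
          unfolding T.psi_eq_blocks by (rule half_noncrossing.blocks_in_NC_B[OF T.half_noncrossing])
      qed
      show "NC_B n \<subseteq> psi n ` triangulations_B n P"
      proof
        fix \<pi> assume "\<pi> \<in> NC_B n"
        then obtain E F where EF: "half_noncrossing n E F" "\<pi> = blocks n E F" by (rule NC_B_eq_blocks)
        interpret h: half_noncrossing n E F by (rule EF(1))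
        define T where "T = chords_of n h.position_chords"
        note pt = h.position_triangulation_position_chords[OF assms(1)]
        have "triangulation n P T" unfolding T_def by (rule triangulation_chords_of[OF pt])
        moreover have "(\<lambda>C. bar ` C) ` T = T" unfolding T_def
          by (rule bar_chords_of[OF assms(1) h.half_turn_invariant_position_chords h.position_chords_bounds])
        ultimately have T: "T \<in> triangulations_B n P" unfolding triangulations_B_def by simp
        interpret T: symmetric_triangulation n P T by (rule sym[OF T])
        interpret hT: half_noncrossing n T.E T.F by (rule T.half_noncrossing)
        have "h.position_chords = hT.position_chords"
          using adj_chords_of(2)[OF assms(1) pt] T.adj_eq_position_chords unfolding T_def by simp
        then have "E = T.E \<and> F = T.F"
          by (intro half_noncrossing_eqI[OF EF(1) T.half_noncrossing])
            (simp_all only: h.position_chords_parts hT.position_chords_parts)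
        then have "\<pi> = psi n T" using EF(2) T.psi_eq_blocks by simp
        then show "\<pi> \<in> psi n ` triangulations_B n P" using T by blast
      qed
    qed
  qed
qed

end
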